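(* Let $k \leq n$ be positive integers. As ungraded $\mathfrak{S}_n$-modules, $R_{n,k} \cong \mathbb{Q}[\mathcal{OP}_{n,k}]$. Equivalently, the ungraded Frobenius character of $R_{n,k}$ is $$\mathrm{Frob}(R_{n,k}) = \sum_{\substack{\lambda \vdash n \\ \ell(\lambda) = k}} \binom{k}{m_1(\lambda), \dots, m_n(\lambda)} h_\lambda(\mathbf{x}),$$ where $\binom{k}{m_1(\lambda), \dots, m_n(\lambda)} = \frac{k!}{m_1(\lambda)! \cdots m_n(\lambda)!}$.
   Context: For positive integers $k \le n$, $I_{n,k} \subseteq \mathbb{Q}[x_1,\dots,x_n]$ is the ideal $\langle x_1^k, \dots, x_n^k, e_n, e_{n-1}, \dots, e_{n-k+1}\rangle$, where $e_d = e_d(x_1,\dots,x_n)$ is the elementary symmetric polynomial of degree $d$, and $R_{n,k} := \mathbb{Q}[x_1,\dots,x_n]/I_{n,k}$. The symmetric group $\mathfrak{S}_n$ acts on $R_{n,k}$ by permuting variables. $\mathcal{OP}_{n,k}$ is the set of ordered set partitions $(B_1 \mid \cdots \mid B_k)$ of $\{1,\dots,n\}$ into $k$ nonempty blocks; $\mathfrak{S}_n$ acts on it by permuting letters, and $\mathbb{Q}[\mathcal{OP}_{n,k}]$ is the corresponding permutation module. For a partition $\lambda \vdash n$, $\ell(\lambda)$ is its number of parts, $m_i(\lambda)$ is the multiplicity of $i$ as a part, $h_\lambda(\mathbf{x})$ and $s_\lambda(\mathbf x)$ are the complete homogeneous and Schur symmetric functions in infinitely many variables $\mathbf{x} = (x_1,x_2,\dots)$.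 For a finite-dimensional $\mathfrak{S}_n$-module $V \cong \bigoplus_\lambda (S^\lambda)^{\oplus c_\lambda}$ ($S^\lambda$ the irreducible indexed by $\lambda$), $\mathrm{Frob}(V) = \sum_\lambda c_\lambda s_\lambda(\mathbf{x})$. *)

theory Defs
  imports
    "HOL-Algebra.Algebra"
    "HOL-Combinatorics.Combinatorics"
    "HOL-Library.Poly_Mapping"
    "HOL-Library.Disjoint_Sets"
begin

record ('g, 'v) rep = "(rat, 'v) module" +
  act :: "'g \<Rightarrow> 'v \<Rightarrow> 'v"

definition rep_iso :: "('g, 'm) monoid_scheme \<Rightarrow> ('g, 'v) rep \<Rightarrow> ('g, 'w) rep \<Rightarrow> bool" where
  "rep_iso G V W \<longleftrightarrow> (\<exists>f. bij_betw f (carrier V) (carrier W)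
     \<and> (\<forall>x\<in>carrier V. \<forall>y\<in>carrier V. f (x \<oplus>\<^bsub>V\<^esub> y) = f x \<oplus>\<^bsub>W\<^esub> f y)
     \<and> (\<forall>c. \<forall>x\<in>carrier V. f (c \<odot>\<^bsub>V\<^esub> x) = c \<odot>\<^bsub>W\<^esub> f x)
     \<and> (\<forall>g\<in>carrier G. \<forall>x\<in>carrier V. f (act V g x) = act W g (f x)))"

text \<open>Representations without a multiplication leave the ring fields \<open>mult\<close> and \<open>one\<close>
  of the record undefined; \<^const>\<open>rep_iso\<close> does not look at them.\<close>

definition rep_sum :: "'i set \<Rightarrow> ('i \<Rightarrow> ('g, 'v) rep) \<Rightarrow> ('g, 'i \<Rightarrow> 'v) rep" where
  \<comment> \<open>for a finite index set the direct sum is the full product\<close>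
  "rep_sum I M = \<lparr>carrier = (\<Pi>\<^sub>E i\<in>I. carrier (M i)),
     monoid.mult = undefined, one = undefined,
     ring.zero = (\<lambda>i\<in>I. \<zero>\<^bsub>M i\<^esub>),
     ring.add = (\<lambda>x y. \<lambda>i\<in>I. x i \<oplus>\<^bsub>M i\<^esub> y i),
     smult = (\<lambda>c x. \<lambda>i\<in>I. c \<odot>\<^bsub>M i\<^esub> x i),
     act = (\<lambda>g x. \<lambda>i\<in>I. act (M i) g (x i))\<rparr>"

definition push :: "('a \<Rightarrow> 'b) \<Rightarrow> ('a \<Rightarrow>\<^sub>0 'c) \<Rightarrow> ('b \<Rightarrow>\<^sub>0 'c::comm_monoid_add)" where
  \<comment> \<open>the additive extension of the map \<open>x \<mapsto> g x\<close> on keys, i.e. on basis elements\<close>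
  "push g f = (\<Sum>x\<in>Poly_Mapping.keys f. Poly_Mapping.single (g x) (Poly_Mapping.lookup f x))"

definition perm_rep :: "'x set \<Rightarrow> ('g \<Rightarrow> 'x \<Rightarrow> 'x) \<Rightarrow> ('g, 'x \<Rightarrow>\<^sub>0 rat) rep" where
  \<comment> \<open>the vector space with basis \<open>B\<close>, where \<open>g\<close> sends the basis element \<open>b\<close> to \<open>\<phi> g b\<close>\<close>
  "perm_rep B \<phi> = \<lparr>carrier = {f. Poly_Mapping.keys f \<subseteq> B},
     monoid.mult = undefined, one = undefined, ring.zero = 0, ring.add = (+),
     smult = (\<lambda>c. Poly_Mapping.map ((*) c)),
     act = (\<lambda>g. push (\<phi> g))\<rparr>"

type_synonym mpoly = "(nat \<Rightarrow>\<^sub>0 nat) \<Rightarrow>\<^sub>0 rat"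
  \<comment> \<open>a monomial is its exponent function, a polynomial its coefficient function\<close>

definition mpoly_ring :: "nat \<Rightarrow> mpoly ring" where
  "mpoly_ring n = \<lparr>carrier = {p. \<forall>m\<in>Poly_Mapping.keys p. Poly_Mapping.keys m \<subseteq> {1..n}},
     monoid.mult = (*), one = 1, ring.zero = 0, ring.add = (+)\<rparr>"

definition pvar :: "nat \<Rightarrow> mpoly" where
  "pvar i = Poly_Mapping.single (Poly_Mapping.single i 1) 1"

definition pconst :: "rat \<Rightarrow> mpoly" where
  "pconst c = Poly_Mapping.single 0 c"

definition elem_sym :: "nat \<Rightarrow> nat \<Rightarrow> mpoly" where
  "elem_sym n d = (\<Sum>S | S \<subseteq> {1..n} \<and> card S = d. \<Prod>i\<in>S. pvar i)"

definition I_ideal :: "nat \<Rightarrow> nat \<Rightarrow> mpoly set" where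
  "I_ideal n k = Idl\<^bsub>mpoly_ring n\<^esub> ((\<lambda>i. pvar i ^ k) ` {1..n} \<union> elem_sym n ` {n - k + 1..n})"

text \<open>Scaling a coset by \<open>c\<close> is multiplication by the coset of the constant \<open>c\<close>; the
  elementwise image would be wrong for \<open>c = 0\<close>. A permutation \<open>\<pi>\<close> maps the monomial \<open>m\<close> to
  \<open>push \<pi> m\<close>, that is, it substitutes \<open>x\<^bsub>\<pi> i\<^esub>\<close> for \<open>x\<^sub>i\<close>.\<close>

definition R_rep :: "nat \<Rightarrow> nat \<Rightarrow> (nat \<Rightarrow> nat, mpoly set) rep" where
  "R_rep n k = (let P = mpoly_ring n; I = I_ideal n k; Q = P Quot I in
     \<lparr>carrier = carrier Q, monoid.mult = (\<otimes>\<^bsub>Q\<^esub>), one = \<one>\<^bsub>Q\<^esub>, ring.zero = \<zero>\<^bsub>Q\<^esub>, ring.add = (\<oplus>\<^bsub>Q\<^esub>),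
      smult = (\<lambda>c C. (I +>\<^bsub>P\<^esub> pconst c) \<otimes>\<^bsub>Q\<^esub> C),
      act = (\<lambda>\<pi> C. push (push \<pi>) ` C)\<rparr>)"

definition ordered_set_partitions :: "nat \<Rightarrow> nat \<Rightarrow> nat set list set" where
  "ordered_set_partitions n k =
     {B. length B = k \<and> distinct B \<and> partition_on {1..n} (set B)}"

definition permute_blocks :: "(nat \<Rightarrow> nat) \<Rightarrow> nat set list \<Rightarrow> nat set list" where
  "permute_blocks \<pi> B = map (\<lambda>b. \<pi> ` b) B"

definition OP_rep :: "nat \<Rightarrow> nat \<Rightarrow> (nat \<Rightarrow> nat, nat set list \<Rightarrow>\<^sub>0 rat) rep" where
  "OP_rep n k = perm_rep (ordered_set_partitions n k) permute_blocks"

definition partitions :: "nat \<Rightarrow> nat list set" where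
  "partitions n = {\<mu>. sorted_wrt (\<ge>) \<mu> \<and> 0 \<notin> set \<mu> \<and> sum_list \<mu> = n}"

definition cells :: "nat list \<Rightarrow> (nat \<times> nat) set" where
  "cells \<mu> = {(i, j). i < length \<mu> \<and> j < \<mu> ! i}"

text \<open>The tabloid of a tableau is the ordered set partition formed by its rows.\<close>

definition tabloids :: "nat \<Rightarrow> nat list \<Rightarrow> nat set list set" where
  "tabloids n \<mu> = {B \<in> ordered_set_partitions n (length \<mu>). map card B = \<mu>}"

definition tabloid_of :: "nat list \<Rightarrow> (nat \<times> nat \<Rightarrow> nat) \<Rightarrow> nat set list" where
  "tabloid_of \<mu> t = map (\<lambda>i. t ` {c \<in> cells \<mu>. fst c = i}) [0..<length \<mu>]"

definition column_stabilizer :: "nat \<Rightarrow> nat list \<Rightarrow> (nat \<times> nat \<Rightarrow> nat) \<Rightarrow> (nat \<Rightarrow> nat) set" where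
  "column_stabilizer n \<mu> t = {\<pi>. \<pi> permutes {1..n} \<and>
     (\<forall>j. \<pi> ` t ` {c \<in> cells \<mu>. snd c = j} = t ` {c \<in> cells \<mu>. snd c = j})}"

definition polytabloid :: "nat \<Rightarrow> nat list \<Rightarrow> (nat \<times> nat \<Rightarrow> nat) \<Rightarrow> nat set list \<Rightarrow>\<^sub>0 rat" where
  "polytabloid n \<mu> t = (\<Sum>\<pi>\<in>column_stabilizer n \<mu> t.
     Poly_Mapping.single (permute_blocks \<pi> (tabloid_of \<mu> t)) (of_int (sign \<pi>)))"

definition specht :: "nat \<Rightarrow> nat list \<Rightarrow> (nat \<Rightarrow> nat, nat set list \<Rightarrow>\<^sub>0 rat) rep" where
  "specht n \<mu> = perm_rep (tabloids n \<mu>) permute_blocks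
     \<lparr>carrier := Modules.module.span (\<lambda>c. Poly_Mapping.map ((*) c))
        (polytabloid n \<mu> ` {t. bij_betw t (cells \<mu>) {1..n}})\<rparr>"

text \<open>Formal power series over the rationals in countably many variables, as coefficient
  functions on monomials. The variables are indexed by all natural numbers, starting with \<open>0\<close>.\<close>

type_synonym symfun = "(nat \<Rightarrow>\<^sub>0 nat) \<Rightarrow> rat"

definition sf_mult :: "symfun \<Rightarrow> symfun \<Rightarrow> symfun" where
  "sf_mult f g = (\<lambda>m. \<Sum>(a, b) | a + b = m. f a * g b)"

definition h_single :: "nat \<Rightarrow> symfun" where
  "h_single d = (\<lambda>m. if (\<Sum>i\<in>Poly_Mapping.keys m. Poly_Mapping.lookup m i) = d then 1 else 0)"

definition h_fun :: "nat list \<Rightarrow> symfun" where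
  "h_fun \<mu> = foldr (\<lambda>d. sf_mult (h_single d)) \<mu> (\<lambda>m. if m = 0 then 1 else 0)"

definition ssyt :: "nat list \<Rightarrow> (nat \<times> nat \<Rightarrow> nat) set" where
  \<comment> \<open>the value \<open>0\<close> outside the shape makes the tableau determined by its entries\<close>
  "ssyt \<mu> = {T. (\<forall>c. c \<notin> cells \<mu> \<longrightarrow> T c = 0)
     \<and> (\<forall>i j. (i, Suc j) \<in> cells \<mu> \<longrightarrow> T (i, j) \<le> T (i, Suc j))
     \<and> (\<forall>i j. (Suc i, j) \<in> cells \<mu> \<longrightarrow> T (i, j) < T (Suc i, j))}"

definition content :: "nat list \<Rightarrow> (nat \<times> nat \<Rightarrow> nat) \<Rightarrow> nat \<Rightarrow>\<^sub>0 nat" where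
  "content \<mu> T = (\<Sum>c\<in>cells \<mu>. Poly_Mapping.single (T c) 1)"

definition schur :: "nat list \<Rightarrow> symfun" where
  "schur \<mu> = (\<lambda>m. of_nat (card {T \<in> ssyt \<mu>. content \<mu> T = m}))"

definition specht_mults :: "nat \<Rightarrow> (nat \<Rightarrow> nat, 'v) rep \<Rightarrow> nat list \<Rightarrow> nat" where
  \<comment> \<open>the multiplicities of the Specht modules in a decomposition of \<open>V\<close> (they are unique)\<close>
  "specht_mults n V = (SOME c. rep_iso (sym_group n) V
     (rep_sum {(\<mu>, j). \<mu> \<in> partitions n \<and> j < c \<mu>} (\<lambda>(\<mu>, j). specht n \<mu>)))"

definition Frob :: "nat \<Rightarrow> (nat \<Rightarrow> nat, 'v) rep \<Rightarrow> symfun" where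
  "Frob n V = (\<lambda>m. \<Sum>\<mu>\<in>partitions n. of_nat (specht_mults n V \<mu>) * schur \<mu> m)"

end

theory Submission
  imports Defs
begin

text \<open>
  The points with coordinates in \<open>{0, \<dots>, k - 1}\<close> that use every value form the \<open>S\<^sub>n\<close>-set of ordered set partitions.
  The generators of the ideal are leading forms of polynomials that vanish on this locus, so every function on the locus is
  the restriction of a harmonic polynomial, that is, one orthogonal to the ideal for the inner product in which the monomials
  are orthonormal. Filtering the quotient by powers of the last variable bounds its dimension by the number of points,
  hence evaluation is an isomorphism from the harmonic polynomials, and these represent the quotient equivariantly.

  For the Frobenius character, the Specht module is identified with the highest weight vectors of the tabloid module, the
  vectors killed by all operators that sum over the ways of moving one letter between adjacent rows. A highest weight vector
  that is invariant under a Young subgroup is determined by its coefficients at semistandard tableaux (by an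
  \<open>sl\<^sub>2\<close> argument), while the symmetrized polytabloids of semistandard tableaux are triangular; so the
  invariants of the Specht module are counted by semistandard tableaux. The orbits of the Young subgroup on ordered set partitions are
  matrices without zero rows, counted by products of complete homogeneous symmetric functions. Comparing the
  dimensions of invariants gives the Frobenius character, whatever decomposition into Specht modules is chosen.
\<close>

section \<open>Rational vector spaces with a standard basis\<close>

text \<open>The ideal itself does not vanish on the locus; its elements are only leading parts of
  polynomials that do. So evaluation makes no sense on the quotient, and a canonical equivariant
  choice of representatives is required before points and cosets can be compared.

  Over the rationals the standard inner products are positive definite, and the group permutes the
  orthonormal basis. Complements of stable subspaces are therefore stable. This one fact gives the
  representatives of the quotient and splits Specht modules off a permutation module.

  Membership in the span of the polytabloids is hard to test for a given vector, whereas the highest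
  weight conditions are linear equations in its coefficients. They make it possible to recognize
  that a map takes values in a Specht module, and to bound the invariants from above.

  \<open>Frob\<close> is built from chosen multiplicities. Its coefficient at a monomial is the
  dimension of the invariants of the Young subgroup with the exponents as orbit sizes, which can be
  read off the module itself.\<close>

abbreviation scl :: "rat \<Rightarrow> ('a \<Rightarrow>\<^sub>0 rat) \<Rightarrow> ('a \<Rightarrow>\<^sub>0 rat)" where
  "scl c \<equiv> Poly_Mapping.map ((*) c)"

abbreviation lk :: "('a \<Rightarrow>\<^sub>0 'b::zero) \<Rightarrow> 'a \<Rightarrow> 'b" where
  "lk \<equiv> Poly_Mapping.lookup"

abbreviation ks :: "('a \<Rightarrow>\<^sub>0 'b::zero) \<Rightarrow> 'a set" where
  "ks \<equiv> Poly_Mapping.keys"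

abbreviation sng :: "'a \<Rightarrow> 'b::zero \<Rightarrow> 'a \<Rightarrow>\<^sub>0 'b" where
  "sng \<equiv> Poly_Mapping.single"

lemma lookup_scl [simp]: "lk (scl c f) x = c * lk f x"
  by (simp add: Poly_Mapping.map.rep_eq when_def)

interpretation PM: vector_space scl
  by unfold_locales (auto intro!: poly_mapping_eqI simp: lookup_add algebra_simps)

lemma poly_mapping_sum_single:
  assumes "finite A" "ks f \<subseteq> A"
  shows "f = (\<Sum>x\<in>A. sng x (lk f x))"
proof (rule poly_mapping_eqI)
  fix x show "lk f x = lk (\<Sum>x\<in>A. sng x (lk f x)) x"
    using assms by (auto simp: lookup_sum lookup_single when_def in_keys_iff sum.delta)
qed

lemma scl_single [simp]: "scl c (sng x d) = sng x (c * d)"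
  by (rule poly_mapping_eqI) (simp add: lookup_single when_def)

lemma subspace_keys: "PM.subspace {f. ks f \<subseteq> S}"
  by (auto simp: PM.subspace_def in_keys_iff lookup_add subset_iff) (metis add_0)

lemma span_keys:
  assumes "finite S" "ks f \<subseteq> S"
  shows "f \<in> PM.span ((\<lambda>x. sng x 1) ` S)"
proof -
  have "f = (\<Sum>x\<in>S. scl (lk f x) (sng x 1))"
    using poly_mapping_sum_single[OF assms] by simp
  also have "\<dots> \<in> PM.span ((\<lambda>x. sng x 1) ` S)"
    by (intro PM.span_sum PM.span_scale PM.span_base) auto
  finally show ?thesis .
qed

lemma finite_basis:
  assumes "finite S" "V \<subseteq> {f. ks f \<subseteq> S}"
  obtains B where "B \<subseteq> V" "PM.independent B" "V \<subseteq> PM.span B" "finite B" "card B \<le> card S"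
proof -
  obtain B where B: "B \<subseteq> V" "PM.independent B" "V \<subseteq> PM.span B"
    using PM.maximal_independent_subset by blast
  have "finite B \<and> card B \<le> card ((\<lambda>x. sng x (1::rat)) ` S)"
    using assms B span_keys[OF assms(1)] by (intro PM.independent_span_bound) auto
  with B that card_image_le[OF assms(1), of "\<lambda>x. sng x (1::rat)"] show ?thesis by (metis le_trans)
qed

section \<open>Inner product and orthogonal projection\<close>

definition ip :: "('a \<Rightarrow>\<^sub>0 rat) \<Rightarrow> ('a \<Rightarrow>\<^sub>0 rat) \<Rightarrow> rat" where
  "ip f g = (\<Sum>x\<in>ks f. lk f x * lk g x)"

lemma ip_superset: "finite A \<Longrightarrow> ks f \<subseteq> A \<Longrightarrow> ip f g = (\<Sum>x\<in>A. lk f x * lk g x)"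
  unfolding ip_def by (rule sum.mono_neutral_left) (auto simp: in_keys_iff)

lemma ip_commute: "ip f g = ip g f"
proof -
  have "ip f g = (\<Sum>x\<in>ks f \<union> ks g. lk f x * lk g x)" by (rule ip_superset) auto
  moreover have "ip g f = (\<Sum>x\<in>ks f \<union> ks g. lk g x * lk f x)" by (rule ip_superset) auto
  ultimately show ?thesis by (simp add: mult.commute)
qed

lemma ip_add_right: "ip f (g + h) = ip f g + ip f h"
  by (simp add: ip_def lookup_add algebra_simps sum.distrib)
lemma ip_diff_right: "ip f (g - h) = ip f g - ip f h"
  by (simp add: ip_def lookup_minus algebra_simps sum_subtractf)
lemma ip_scl_right: "ip f (scl c g) = c * ip f g"
  by (simp add: ip_def algebra_simps sum_distrib_left)
lemma ip_zero_right [simp]: "ip f 0 = 0"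
  by (simp add: ip_def)
lemma ip_sum_right: "ip f (sum g A) = (\<Sum>a\<in>A. ip f (g a))"
  by (induction A rule: infinite_finite_induct) (auto simp: ip_add_right)
lemma ip_add_left: "ip (f + g) h = ip f h + ip g h"
  by (metis ip_add_right ip_commute)
lemma ip_diff_left: "ip (f - g) h = ip f h - ip g h"
  by (metis ip_diff_right ip_commute)
lemma ip_scl_left: "ip (scl c f) g = c * ip f g"
  by (metis ip_scl_right ip_commute)
lemma ip_zero_left [simp]: "ip 0 f = 0"
  by (simp add: ip_def)
lemma ip_sum_left: "ip (sum g A) f = (\<Sum>a\<in>A. ip (g a) f)"
  by (metis (no_types, lifting) ip_sum_right ip_commute sum.cong)

text \<open>A sum of rational squares vanishes only if each square does. This positivity is the
  source of all complements below.\<close>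

lemma ip_self_eq_0 [simp]: "ip f f = 0 \<longleftrightarrow> f = 0"
proof
  assume "ip f f = 0"
  then have "\<forall>x\<in>ks f. lk f x * lk f x = 0"
    unfolding ip_def by (subst (asm) sum_nonneg_eq_0_iff) auto
  then show "f = 0" by (metis in_keys_iff keys_eq_empty ex_in_conv mult_eq_0_iff)
qed simp

text \<open>Gram-Schmidt without normalization. It is proved for all \<open>x\<close> at once
  because the induction projects the new vector \<open>a\<close> as well as
  \<open>x\<close>.\<close>

lemma orth_proj_span:
  assumes "finite S"
  shows "\<exists>y\<in>PM.span S. \<forall>s\<in>PM.span S. ip (x - y) s = 0"
  using assms
proof (induction S arbitrary: x rule: finite_induct)
  case empty
  then show ?case by auto
next
  case (insert a S)
  obtain b where b: "b \<in> PM.span S" "\<forall>s\<in>PM.span S. ip (a - b) s = 0" using insert.IH by blast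
  obtain y where y: "y \<in> PM.span S" "\<forall>s\<in>PM.span S. ip (x - y) s = 0" using insert.IH by blast
  define a' where "a' = a - b"
  \<comment> \<open>If \<open>a\<close> already lies in the span of \<open>S\<close>, then
    \<open>a' = 0\<close> and the quotient is 0 by convention, which is the right
    coefficient.\<close>
  define c where "c = ip (x - y) a' / ip a' a'"
  have sub: "PM.span S \<subseteq> PM.span (insert a S)" by (intro PM.span_mono) auto
  have a': "a' \<in> PM.span (insert a S)"
    unfolding a'_def using b(1) sub PM.span_base[of a "insert a S"] by (intro PM.span_diff) auto
  show ?case
  proof (intro bexI ballI)
    show "y + scl c a' \<in> PM.span (insert a S)"
      using y(1) sub a' by (intro PM.span_add PM.span_scale) auto
    fix s assume "s \<in> PM.span (insert a S)"
    then obtain k where "s - scl k a \<in> PM.span S" by (metis PM.span_breakdown_eq)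
    then have "s - scl k a + scl k b \<in> PM.span S" using b(1) by (intro PM.span_add PM.span_scale)
    then obtain t where t: "t \<in> PM.span S" "s = t + scl k a'"
      by (auto simp: a'_def PM.scale_right_diff_distrib algebra_simps)
    have "ip (x - y) t = 0" "ip a' t = 0" using t y b by (auto simp: a'_def)
    moreover have "ip (x - y) a' = c * ip a' a'"
      by (cases "a' = 0") (auto simp: c_def)
    ultimately show "ip (x - (y + scl c a')) s = 0"
      by (simp add: t(2) ip_add_right ip_scl_right ip_diff_left ip_add_left ip_scl_left algebra_simps)
  qed
qed

lemma orth_proj:
  assumes "PM.subspace Y" "finite S" "Y \<subseteq> {f. ks f \<subseteq> S}"
  obtains y where "y \<in> Y" "\<And>s. s \<in> Y \<Longrightarrow> ip (x - y) s = 0"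
proof -
  obtain B where B: "B \<subseteq> Y" "Y \<subseteq> PM.span B" "finite B"
    using finite_basis[OF assms(2,3)] by metis
  then have "PM.span B = Y" using assms(1) by (metis PM.span_subspace)
  with orth_proj_span[OF B(3)] that show ?thesis by metis
qed

section \<open>Linear maps induced by maps of the basis\<close>

lemma lookup_push:
  "lk (push g f) y = (\<Sum>x\<in>ks f. lk f x when g x = y)"
  by (simp add: push_def lookup_sum lookup_single)

lemma push_superset:
  "finite A \<Longrightarrow> ks f \<subseteq> A \<Longrightarrow> push g f = (\<Sum>x\<in>A. sng (g x) (lk f x))"
  unfolding push_def by (rule sum.mono_neutral_left) (auto simp: in_keys_iff)

lemma push_add: "push g (f + h) = push g f + push g h"
proof -
  let ?A = "ks f \<union> ks h"
  have "push g (f + h) = (\<Sum>x\<in>?A. sng (g x) (lk (f + h) x))"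
    by (rule push_superset) (auto simp: in_keys_iff lookup_add)
  also have "\<dots> = (\<Sum>x\<in>?A. sng (g x) (lk f x)) + (\<Sum>x\<in>?A. sng (g x) (lk h x))"
    by (simp add: lookup_add single_add sum.distrib)
  also have "\<dots> = push g f + push g h"
    by (intro arg_cong2[where f = "(+)"] push_superset[symmetric]) auto
  finally show ?thesis .
qed

lemma push_zero [simp]: "push g 0 = 0" by (simp add: push_def)

lemma push_single [simp]: "push g (sng x c) = sng (g x) c"
  by (cases "c = 0") (auto simp: push_def)

lemma push_sum: "push g (sum f A) = (\<Sum>a\<in>A. push g (f a))"
  by (induction A rule: infinite_finite_induct) (auto simp: push_add)

lemma push_scl: "push g (scl c f) = scl c (push g f)"
proof -
  have "push g (scl c f) = (\<Sum>x\<in>ks f. sng (g x) (lk (scl c f) x))"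
    by (rule push_superset) (auto simp: in_keys_iff)
  then show ?thesis by (simp add: push_def PM.scale_sum_right)
qed

lemma push_diff: "push g (f - h) = push g f - push g (h :: 'a \<Rightarrow>\<^sub>0 rat)"
  using push_add[of g "f - h" h] by simp

lemma push_push: "push g (push h f) = push (g \<circ> h) f"
proof -
  have "push g (push h f) = (\<Sum>x\<in>ks f. sng (g (h x)) (lk f x))"
    unfolding push_def[of h] push_sum push_single ..
  then show ?thesis by (simp add: push_def)
qed

lemma push_id_on: "(\<And>x. x \<in> ks f \<Longrightarrow> g x = x) \<Longrightarrow> push g f = f"
  unfolding push_def by (simp add: poly_mapping_sum_single[symmetric])

lemma lookup_push_inj: "inj_on g S \<Longrightarrow> ks f \<subseteq> S \<Longrightarrow> x \<in> S \<Longrightarrow> lk (push g f) (g x) = lk f x"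
proof -
  assume *: "inj_on g S" "ks f \<subseteq> S" "x \<in> S"
  then have "lk (push g f) (g x) = (\<Sum>z\<in>ks f. lk f z when z = x)"
    unfolding lookup_push by (intro sum.cong refl) (auto simp: inj_on_def when_def)
  also have "\<dots> = lk f x" by (auto simp: when_def in_keys_iff)
  finally show ?thesis .
qed

lemma keys_push: "ks (push g f) \<subseteq> g ` ks f"
  by (auto simp: in_keys_iff lookup_push when_def elim!: sum.not_neutral_contains_not_neutral split: if_splits)

lemma ip_push:
  assumes "inj_on g S" "ks f \<subseteq> S" "ks h \<subseteq> S"
  shows "ip (push g f) (push g h) = ip f h"
proof -
  have "ip (push g f) (push g h) = (\<Sum>x\<in>g ` ks f. lk (push g f) x * lk (push g h) x)"
    by (rule ip_superset) (auto simp: keys_push)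
  also have "\<dots> = (\<Sum>x\<in>ks f. lk (push g f) (g x) * lk (push g h) (g x))"
    using assms by (subst sum.reindex) (auto intro: inj_on_subset)
  also have "\<dots> = ip f h" unfolding ip_def
    using assms by (intro sum.cong refl) (simp add: lookup_push_inj[OF assms(1)] subset_iff)
  finally show ?thesis .
qed

section \<open>Highest weight vectors\<close>

text \<open>Truncated subtraction is harmless: \<open>Eop\<close> and \<open>Fop\<close> multiply
  each term by the entry that is lowered. Moving a letter down in the argument makes the function
  gain weight in row \<open>i\<close>, so \<open>move_down\<close> belongs to the raising
  operator.\<close>

definition move_down :: "nat \<Rightarrow> nat \<Rightarrow> (nat \<Rightarrow> nat \<Rightarrow> nat) \<Rightarrow> nat \<Rightarrow> nat \<Rightarrow> nat" where
  "move_down i a A = (\<lambda>j b. if b = a \<and> j = i then A i a - 1 else if b = a \<and> j = Suc i then Suc (A j a) else A j b)"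

definition move_up :: "nat \<Rightarrow> nat \<Rightarrow> (nat \<Rightarrow> nat \<Rightarrow> nat) \<Rightarrow> nat \<Rightarrow> nat \<Rightarrow> nat" where
  "move_up i a A = (\<lambda>j b. if b = a \<and> j = i then Suc (A i a) else if b = a \<and> j = Suc i then A j a - 1 else A j b)"

text \<open>\<open>f A\<close> is the coefficient of the divided-power monomial with exponent matrix \<open>A\<close>, whose columns belong to the
  \<open>N\<close> letters; with this normalization a vector of a tabloid module that is invariant under a Young subgroup
  becomes a function of matrices without rescaling.\<close>

definition Eop :: "nat \<Rightarrow> nat \<Rightarrow> ((nat \<Rightarrow> nat \<Rightarrow> nat) \<Rightarrow> rat) \<Rightarrow> (nat \<Rightarrow> nat \<Rightarrow> nat) \<Rightarrow> rat" where
  "Eop N i f = (\<lambda>A. \<Sum>a<N. of_nat (A i a) * f (move_down i a A))"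

definition Fop :: "nat \<Rightarrow> nat \<Rightarrow> ((nat \<Rightarrow> nat \<Rightarrow> nat) \<Rightarrow> rat) \<Rightarrow> (nat \<Rightarrow> nat \<Rightarrow> nat) \<Rightarrow> rat" where
  "Fop N i f = (\<lambda>A. \<Sum>a<N. of_nat (A (Suc i) a) * f (move_up i a A))"

text \<open>Weights are integers so that the shifts by \<open>Eop\<close> and \<open>Fop\<close>
  need no side conditions; a negative weight then forces the zero function.\<close>

definition row_weight :: "nat \<Rightarrow> nat \<Rightarrow> ((nat \<Rightarrow> nat \<Rightarrow> nat) \<Rightarrow> rat) \<Rightarrow> int \<Rightarrow> int \<Rightarrow> bool" where
  "row_weight N i f p q \<longleftrightarrow>
     (\<forall>A. f A \<noteq> 0 \<longrightarrow> int (\<Sum>a<N. A i a) = p \<and> int (\<Sum>a<N. A (Suc i) a) = q)"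

lemma Eop_lin: "Eop N i (\<lambda>A. c * f A + d * g A) = (\<lambda>A. c * Eop N i f A + d * Eop N i g A)"
  by (simp add: Eop_def algebra_simps sum.distrib sum_distrib_left)

lemma Fop_lin: "Fop N i (\<lambda>A. c * f A + d * g A) = (\<lambda>A. c * Fop N i f A + d * Fop N i g A)"
  by (simp add: Fop_def algebra_simps sum.distrib sum_distrib_left)

lemma Eop_pow_lin:
  "(Eop N i ^^ m) (\<lambda>A. c * f A + d * g A) = (\<lambda>A. c * (Eop N i ^^ m) f A + d * (Eop N i ^^ m) g A)"
  by (induction m) (simp_all add: Eop_lin)

lemma Eop_zero [simp]: "Eop N i (\<lambda>A. 0) = (\<lambda>A. 0)" and Fop_zero [simp]: "Fop N i (\<lambda>A. 0) = (\<lambda>A. 0)"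
  by (simp_all add: Eop_def Fop_def)

lemma Eop_scale: "Eop N i (\<lambda>A. c * f A) = (\<lambda>A. c * Eop N i f A)"
  using Eop_lin[of N i c f 0 f] by simp
lemma Fop_scale: "Fop N i (\<lambda>A. c * f A) = (\<lambda>A. c * Fop N i f A)"
  using Fop_lin[of N i c f 0 f] by simp
lemma Eop_pow_scale: "(Eop N i ^^ m) (\<lambda>A. c * f A) = (\<lambda>A. c * (Eop N i ^^ m) f A)"
  using Eop_pow_lin[of m N i c f 0 f] by simp

lemma sum_mvdn_row:
  assumes "a < N" "A i a > 0"
  shows "int (\<Sum>b<N. move_down i a A i b) = int (\<Sum>b<N. A i b) - 1"
    "int (\<Sum>b<N. move_down i a A (Suc i) b) = int (\<Sum>b<N. A (Suc i) b) + 1"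
  using assms by (simp_all add: move_down_def sum.remove[of "{..<N}" a])

lemma sum_mvup_row:
  assumes "a < N" "A (Suc i) a > 0"
  shows "int (\<Sum>b<N. move_up i a A i b) = int (\<Sum>b<N. A i b) + 1"
    "int (\<Sum>b<N. move_up i a A (Suc i) b) = int (\<Sum>b<N. A (Suc i) b) - 1"
  using assms by (simp_all add: move_up_def sum.remove[of "{..<N}" a])

lemma row_weight_Eop:
  assumes "row_weight N i f p q" shows "row_weight N i (Eop N i f) (p + 1) (q - 1)"
  unfolding row_weight_def
proof (intro allI impI)
  fix A assume "Eop N i f A \<noteq> 0"
  then obtain a where a: "a < N" "A i a > 0" "f (move_down i a A) \<noteq> 0"
    unfolding Eop_def by (auto elim!: sum.not_neutral_contains_not_neutral)
  from a(3) assms sum_mvdn_row[of a N A i, OF a(1,2)]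
  show "int (\<Sum>a<N. A i a) = p + 1 \<and> int (\<Sum>a<N. A (Suc i) a) = q - 1"
    unfolding row_weight_def by (smt (verit))
qed

lemma row_weight_Fop:
  assumes "row_weight N i f p q" shows "row_weight N i (Fop N i f) (p - 1) (q + 1)"
  unfolding row_weight_def
proof (intro allI impI)
  fix A assume "Fop N i f A \<noteq> 0"
  then obtain a where a: "a < N" "A (Suc i) a > 0" "f (move_up i a A) \<noteq> 0"
    unfolding Fop_def by (auto elim!: sum.not_neutral_contains_not_neutral)
  from a(3) assms sum_mvup_row[of a N A i, OF a(1,2)]
  show "int (\<Sum>a<N. A i a) = p - 1 \<and> int (\<Sum>a<N. A (Suc i) a) = q + 1"
    unfolding row_weight_def by (smt (verit))
qed

lemma row_weight_Eop_pow:
  "row_weight N i f p q \<Longrightarrow> row_weight N i ((Eop N i ^^ m) f) (p + int m) (q - int m)"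
proof (induction m)
  case (Suc m)
  from row_weight_Eop[OF Suc.IH[OF Suc.prems]] show ?case by (simp add: algebra_simps)
qed simp

lemma row_weight_neg: "row_weight N i f p q \<Longrightarrow> p < 0 \<Longrightarrow> f = (\<lambda>A. 0)"
  unfolding row_weight_def by (metis of_nat_0_le_iff not_le)

lemma Eop_Fop_commutator:
  "Eop N i (Fop N i f) A = Fop N i (Eop N i f) A
     + (of_nat (\<Sum>a<N. A i a) - of_nat (\<Sum>a<N. A (Suc i) a)) * f A"
proof -
  let ?e = "\<lambda>a b. of_nat (A i a) * (of_nat (move_down i a A (Suc i) b) * f (move_up i b (move_down i a A))) :: rat"
  let ?f = "\<lambda>a b. of_nat (A (Suc i) b) * (of_nat (move_up i b A i a) * f (move_down i a (move_up i b A))) :: rat"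
  have comm: "A i a > 0 \<Longrightarrow> A (Suc i) b > 0 \<Longrightarrow> a \<noteq> b \<Longrightarrow> move_up i b (move_down i a A) = move_down i a (move_up i b A)" for a b
    by (intro ext) (auto simp: move_up_def move_down_def)
  have d1: "A i a > 0 \<Longrightarrow> move_up i a (move_down i a A) = A" for a
    by (intro ext) (auto simp: move_up_def move_down_def)
  have d2: "A (Suc i) a > 0 \<Longrightarrow> move_down i a (move_up i a A) = A" for a
    by (intro ext) (auto simp: move_up_def move_down_def)
  have e1: "move_down i a A (Suc i) a = Suc (A (Suc i) a)" and e2: "move_up i a A i a = Suc (A i a)" for a
    by (simp_all add: move_down_def move_up_def)
  \<comment> \<open>Moves of different letters commute. For one letter the two orders have
    coefficients x(y + 1) and y(x + 1), where x and y are its entries in rows \<open>i\<close> and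
    \<open>Suc i\<close>; the difference is x - y.\<close>
  have "?e a b - ?f a b = (if a = b then (of_nat (A i a) - of_nat (A (Suc i) a)) * f A else 0)" for a b
  proof (cases "a = b")
    case True
    have "?e a a = of_nat (A i a) * (of_nat (A (Suc i) a) + 1) * f A"
      by (cases "A i a = 0") (auto simp: d1 e1)
    moreover have "?f a a = of_nat (A (Suc i) a) * (of_nat (A i a) + 1) * f A"
      by (cases "A (Suc i) a = 0") (auto simp: d2 e2)
    ultimately show ?thesis using True by (simp add: algebra_simps)
  next
    case False
    have "?e a b = of_nat (A i a) * (of_nat (A (Suc i) b) * f (move_up i b (move_down i a A)))"
      using False by (simp add: move_down_def)
    moreover have "?f a b = of_nat (A (Suc i) b) * (of_nat (A i a) * f (move_down i a (move_up i b A)))"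
      using False by (simp add: move_up_def)
    moreover have "A i a = 0 \<or> A (Suc i) b = 0 \<or> move_up i b (move_down i a A) = move_down i a (move_up i b A)"
      using comm False by blast
    ultimately show ?thesis using False by auto
  qed
  then have "(\<Sum>a<N. \<Sum>b<N. ?e a b - ?f a b) = (\<Sum>a<N. (of_nat (A i a) - of_nat (A (Suc i) a)) * f A)"
    by simp
  moreover have "(\<Sum>a<N. \<Sum>b<N. ?e a b - ?f a b) = Eop N i (Fop N i f) A - Fop N i (Eop N i f) A"
    unfolding sum_subtractf
  proof (rule arg_cong2[where f = "(-)"])
    show "(\<Sum>a<N. \<Sum>b<N. ?e a b) = Eop N i (Fop N i f) A"
      by (simp add: Eop_def Fop_def sum_distrib_left)
    have "(\<Sum>a<N. \<Sum>b<N. ?f a b) = (\<Sum>b<N. \<Sum>a<N. ?f a b)" by (rule sum.swap)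
    then show "(\<Sum>a<N. \<Sum>b<N. ?f a b) = Fop N i (Eop N i f) A"
      by (simp add: Eop_def Fop_def sum_distrib_left)
  qed
  ultimately show ?thesis
    by (simp add: sum_subtractf flip: sum_distrib_right)
qed

lemma Eop_Fop_weight:
  assumes "row_weight N i f p q"
  shows "Eop N i (Fop N i f) = (\<lambda>A. Fop N i (Eop N i f) A + of_int (p - q) * f A)"
proof
  fix A
  have "f A = 0 \<or> of_nat (\<Sum>a<N. A i a) = (of_int p :: rat) \<and> of_nat (\<Sum>a<N. A (Suc i) a) = (of_int q :: rat)"
    using assms unfolding row_weight_def by (metis of_int_of_nat_eq)
  then show "Eop N i (Fop N i f) A = Fop N i (Eop N i f) A + of_int (p - q) * f A"
    unfolding Eop_Fop_commutator by auto
qed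

text \<open>\<open>F u\<close> is again an eigenvector of \<open>F E\<close>, with smaller
  eigenvalue and one letter less in row \<open>i\<close>. The descent ends at row sum -1, whence the
  shift in \<open>int p - 1\<close>; on the way back \<open>u\<close> vanishes because its
  eigenvalue under \<open>E F\<close> is negative.\<close>

lemma FE_eigenvector_zero:
  assumes "row_weight N i u (int p - 1) q" "int p - 1 < q" "Fop N i (Eop N i u) = (\<lambda>A. \<theta> * u A)" "\<theta> \<le> 0"
  shows "u = (\<lambda>A. 0)"
  using assms
proof (induction p arbitrary: u q \<theta>)
  case 0
  then show ?case using row_weight_neg by fastforce
next
  case (Suc p)
  have EF: "Eop N i (Fop N i u) = (\<lambda>A. (\<theta> + of_int (int p - q)) * u A)"
    using Eop_Fop_weight[OF Suc.prems(1)] Suc.prems(3) by (simp add: algebra_simps)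
  have neg: "\<theta> + of_int (int p - q) < 0" using Suc.prems(2,4) by (simp add: add_nonpos_neg)
  have "row_weight N i (Fop N i u) (int p - 1) (q + 1)"
    using row_weight_Fop[OF Suc.prems(1)] by simp
  moreover have "Fop N i (Eop N i (Fop N i u)) = (\<lambda>A. (\<theta> + of_int (int p - q)) * Fop N i u A)"
    unfolding EF by (rule Fop_scale)
  ultimately have "Fop N i u = (\<lambda>A. 0)"
    using Suc.prems(2) neg by (intro Suc.IH[of _ "q + 1" "\<theta> + of_int (int p - q)"]) auto
  with EF have "(\<lambda>A. (\<theta> + of_int (int p - q)) * u A) = (\<lambda>A. 0)" by simp
  with neg show ?case by (metis mult_eq_0_iff less_irrefl)
qed

text \<open>The coefficient is the sum of the weights h, h + 2, ..., h + 2m that are met when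
  \<open>F\<close> is moved past the raising operators, with h = p - q.\<close>

lemma Eop_pow_Fop:
  assumes "row_weight N i y p q"
  shows "(Eop N i ^^ Suc m) (Fop N i y) =
    (\<lambda>A. Fop N i ((Eop N i ^^ Suc m) y) A + of_int ((int m + 1) * (p - q + int m)) * (Eop N i ^^ m) y A)"
proof (induction m)
  case 0
  then show ?case using Eop_Fop_weight[OF assms] by simp
next
  case (Suc m)
  let ?y = "(Eop N i ^^ Suc m) y"
  have "(Eop N i ^^ Suc (Suc m)) (Fop N i y) = Eop N i ((Eop N i ^^ Suc m) (Fop N i y))" by simp
  also have "\<dots> = Eop N i (\<lambda>A. 1 * Fop N i ?y A + of_int ((int m + 1) * (p - q + int m)) * (Eop N i ^^ m) y A)"
    unfolding Suc.IH by simp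
  also have "\<dots> = (\<lambda>A. Eop N i (Fop N i ?y) A + of_int ((int m + 1) * (p - q + int m)) * ?y A)"
    unfolding Eop_lin by simp
  also have "\<dots> = (\<lambda>A. Fop N i (Eop N i ?y) A + of_int ((int (Suc m) + 1) * (p - q + int (Suc m))) * ?y A)"
    unfolding Eop_Fop_weight[OF row_weight_Eop_pow[OF assms]] by (simp add: algebra_simps)
  finally show ?case by simp
qed

text \<open>In a finite-dimensional \<open>sl\<^sub>2\<close>-module, \<open>E\<^sup>r\<^sup>+\<^sup>1\<close> is injective on the weight space of weight
  \<open>p - q < -r\<close>. The proof avoids complete reducibility: if \<open>E\<^sup>r\<^sup>+\<^sup>1 u = 0\<close>, then inductively \<open>u\<close> is an
  eigenvector of \<open>F E\<close> with an eigenvalue of the wrong sign.\<close>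

lemma Eop_pow_inj:
  assumes "row_weight N i u p q" "(Eop N i ^^ Suc r) u = (\<lambda>A. 0)" "p + int r < q"
  shows "u = (\<lambda>A. 0)"
  using assms(2,3,1)
proof (induction r arbitrary: u)
  case 0
  show ?case
  proof (cases "p < 0")
    case True with 0 row_weight_neg show ?thesis by blast
  next
    case False
    with 0 show ?thesis by (intro FE_eigenvector_zero[of N i u "nat (p + 1)" q 0]) auto
  qed
next
  case (Suc r)
  \<comment> \<open>This is the coefficient of \<open>Eop_pow_Fop\<close> for \<open>E u\<close>,
    whose weight difference is p - q + 2. With it, \<open>E\<close> to the power r + 1 kills
    \<open>F E u - \<theta> u\<close>, so the induction hypothesis makes \<open>u\<close> an
    eigenvector. The hypothesis on weights gives \<open>\<theta> \<le> 0\<close>.\<close>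
  define \<theta> where "\<theta> = (of_int ((int r + 1) * (p - q + 2 + int r)) :: rat)"
  let ?E = "Eop N i" and ?F = "Fop N i"
  have "(?E ^^ Suc r) (\<lambda>A. 1 * ?F (?E u) A + (- \<theta>) * u A) =
      (\<lambda>A. (?E ^^ Suc r) (?F (?E u)) A - \<theta> * (?E ^^ Suc r) u A)"
    unfolding Eop_pow_lin by simp
  also have "\<dots> = (\<lambda>A. 0)"
    unfolding Eop_pow_Fop[OF row_weight_Eop[OF Suc.prems(3)]]
    using Suc.prems(1) by (simp add: \<theta>_def funpow_swap1 algebra_simps)
  finally have E0: "(?E ^^ Suc r) (\<lambda>A. 1 * ?F (?E u) A + (- \<theta>) * u A) = (\<lambda>A. 0)" .
  have wt: "row_weight N i (\<lambda>A. 1 * ?F (?E u) A + (- \<theta>) * u A) p q"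
    using row_weight_Fop[OF row_weight_Eop[OF Suc.prems(3)]] Suc.prems(3)
    unfolding row_weight_def by (metis add.right_neutral add_diff_cancel diff_add_cancel mult_eq_0_iff)
  have "(\<lambda>A. 1 * ?F (?E u) A + (- \<theta>) * u A) = (\<lambda>A. 0)"
    using Suc.prems(2) by (intro Suc.IH[OF E0 _ wt]) simp
  then have FE: "?F (?E u) = (\<lambda>A. \<theta> * u A)" by (simp add: fun_eq_iff)
  have "(int r + 1) * (p - q + 2 + int r) \<le> 0"
    using Suc.prems(2) by (intro mult_nonneg_nonpos) auto
  then have "\<theta> \<le> 0" unfolding \<theta>_def by (simp only: of_int_le_0_iff)
  show ?case
  proof (cases "p < 0")
    case True with Suc.prems(3) row_weight_neg show ?thesis by blast
  next
    case False
    with Suc.prems FE \<open>\<theta> \<le> 0\<close> show ?thesis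
      by (intro FE_eigenvector_zero[of N i u "nat (p + 1)" q \<theta>]) auto
  qed
qed

text \<open>For a tableau with \<open>A i a\<close> entries \<open>a\<close> in row
  \<open>i\<close>, rows sorted, this says that columns increase strictly: row \<open>Suc i\<close>
  has at most as many entries up to \<open>a\<close> as row \<open>i\<close> has entries below
  \<open>a\<close>.\<close>

definition semistandard_matrix :: "nat \<Rightarrow> nat \<Rightarrow> (nat \<Rightarrow> nat \<Rightarrow> nat) \<Rightarrow> bool" where
  "semistandard_matrix l N A \<longleftrightarrow> (\<forall>i a. Suc i < l \<longrightarrow> a < N \<longrightarrow> (\<Sum>b\<le>a. A (Suc i) b) \<le> (\<Sum>b<a. A i b))"

definition add_column :: "nat \<Rightarrow> (nat \<Rightarrow> nat \<Rightarrow> nat) \<Rightarrow> (nat \<Rightarrow> nat) \<Rightarrow> nat \<Rightarrow> nat \<Rightarrow> nat" where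
  "add_column N A \<beta> = (\<lambda>i a. if a = N then \<beta> i else A i a)"

text \<open>A highest weight function that vanishes at all semistandard matrices is zero; this gives
  the upper bound for invariants. The induction removes the last letter: a suitable slice with fixed
  last column is again a highest weight function, so only the inequality for the last letter has to
  be shown.\<close>

theorem highest_weight_semistandard:
  assumes "f A0 \<noteq> 0"
    and "\<And>A i a. f A \<noteq> 0 \<Longrightarrow> N \<le> a \<Longrightarrow> A i a = 0"
    and "\<And>A i. f A \<noteq> 0 \<Longrightarrow> (\<Sum>a<N. A i a) = \<mu> i"
    and "\<And>i A. Suc i < l \<Longrightarrow> Eop N i f A = 0"
  shows "\<exists>A. f A \<noteq> 0 \<and> semistandard_matrix l N A"
  using assms
proof (induction N arbitrary: f A0 \<mu>)
  case 0
  then show ?case unfolding semistandard_matrix_def by blast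
next
  case (Suc N)
  \<comment> \<open>The support contains a matrix whose last column lies as far down as possible.
    Moving one more copy of the last letter down would raise \<open>\<Phi>\<close> by 1, so those
    terms vanish, and the slice with this last column is killed by all \<open>Eop\<close>.\<close>
  define \<Phi> where "\<Phi> = (\<lambda>A :: nat \<Rightarrow> nat \<Rightarrow> nat. \<Sum>i<l. i * A i N)"
  have "\<forall>A. f A \<noteq> 0 \<longrightarrow> \<Phi> A < Suc (\<Sum>i<l. i * \<mu> i)"
  proof (intro allI impI)
    fix A assume "f A \<noteq> 0"
    then have "A i N \<le> \<mu> i" for i using Suc.prems(3)[of A i] by simp
    then show "\<Phi> A < Suc (\<Sum>i<l. i * \<mu> i)"
      unfolding \<Phi>_def less_Suc_eq_le by (intro sum_mono mult_le_mono) auto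
  qed
  then obtain A1 where A1: "f A1 \<noteq> 0" "\<And>A. f A \<noteq> 0 \<Longrightarrow> \<Phi> A \<le> \<Phi> A1"
    using ex_has_greatest_nat[of "\<lambda>A. f A \<noteq> 0" A0 \<Phi>] Suc.prems(1) by metis
  define \<alpha> where "\<alpha> = (\<lambda>i. A1 i N)"
  define low where "low = (\<lambda>A :: nat \<Rightarrow> nat \<Rightarrow> nat. \<forall>i a. N \<le> a \<longrightarrow> A i a = 0)"
  define g where "g = (\<lambda>\<beta> A. if low A then f (add_column N A \<beta>) else 0)"
  have low_mv: "low (move_down i a A) \<longleftrightarrow> low A" if "a < N" for i a A
    using that by (auto simp: low_def move_down_def)
  \<comment> \<open>The highest weight equation for all letters, separated into moves of the first
    \<open>N\<close> letters and the single move of the last one.\<close>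
  have Eg: "Eop N i (g \<beta>) A =
      (if low A then - (of_nat (\<beta> i) * f (move_down i N (add_column N A \<beta>))) else 0)"
    if "Suc i < l" for i \<beta> A
  proof (cases "low A")
    case True
    have "0 = Eop (Suc N) i f (add_column N A \<beta>)" using Suc.prems(4)[OF that] by simp
    also have "\<dots> = (\<Sum>a<N. of_nat (A i a) * f (move_down i a (add_column N A \<beta>)))
        + of_nat (\<beta> i) * f (move_down i N (add_column N A \<beta>))"
      by (simp add: Eop_def add_column_def)
    also have "(\<Sum>a<N. of_nat (A i a) * f (move_down i a (add_column N A \<beta>))) = Eop N i (g \<beta>) A"
      unfolding Eop_def
    proof (intro sum.cong refl)
      fix a assume "a \<in> {..<N}"
      then have "move_down i a (add_column N A \<beta>) = add_column N (move_down i a A) \<beta>"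
        by (intro ext) (auto simp: move_down_def add_column_def)
      then show "of_nat (A i a) * f (move_down i a (add_column N A \<beta>)) = of_nat (A i a) * g \<beta> (move_down i a A)"
        using True low_mv \<open>a \<in> {..<N}\<close> by (simp add: g_def)
    qed
    finally show ?thesis using True by simp
  next
    case False
    then show ?thesis by (simp add: Eop_def g_def low_mv)
  qed
  have weights: "(\<Sum>a<N. A i a) + \<beta> i = \<mu> i" if "g \<beta> A \<noteq> 0" for \<beta> A i
  proof -
    have "f (add_column N A \<beta>) \<noteq> 0" using that by (auto simp: g_def split: if_splits)
    from Suc.prems(3)[OF this, of i] show ?thesis by (simp add: add_column_def)
  qed
  have top: "\<alpha> i = 0 \<or> f (move_down i N (add_column N A \<alpha>)) = 0" if i: "Suc i < l" for i A
  proof (rule ccontr)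
    assume *: "\<not> ?thesis"
    have "{..<l} = insert i (insert (Suc i) ({..<l} - {i, Suc i}))" using i by auto
    then have sp: "\<Phi> B = i * B i N + (Suc i * B (Suc i) N + (\<Sum>j\<in>{..<l} - {i, Suc i}. j * B j N))" for B
      unfolding \<Phi>_def by (metis (no_types, lifting) DiffD2 finite_Diff finite_insert finite_lessThan insertCI
          insertE n_not_Suc_n sum.insert)
    have "(\<Sum>j\<in>{..<l} - {i, Suc i}. j * move_down i N (add_column N A \<alpha>) j N) = (\<Sum>j\<in>{..<l} - {i, Suc i}. j * A1 j N)"
      by (intro sum.cong) (auto simp: move_down_def add_column_def \<alpha>_def)
    moreover have "i * (\<alpha> i - 1) + Suc i * Suc (\<alpha> (Suc i)) > i * \<alpha> i + Suc i * \<alpha> (Suc i)"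
      using * by (cases "\<alpha> i") auto
    ultimately have "\<Phi> (move_down i N (add_column N A \<alpha>)) > \<Phi> A1"
      unfolding sp by (simp add: move_down_def add_column_def \<alpha>_def)
    with A1(2)[of "move_down i N (add_column N A \<alpha>)"] * show False by simp
  qed
  have "\<exists>A. g \<alpha> A \<noteq> 0 \<and> semistandard_matrix l N A"
  proof (rule Suc.IH)
    have "add_column N (\<lambda>i a. if a < N then A1 i a else 0) \<alpha> = A1"
      using Suc.prems(2)[OF A1(1)] by (auto simp: add_column_def \<alpha>_def fun_eq_iff)
    then show "g \<alpha> (\<lambda>i a. if a < N then A1 i a else 0) \<noteq> 0" using A1(1) by (simp add: g_def low_def)
  next
    fix A i a assume "g \<alpha> A \<noteq> 0" "N \<le> a"
    then show "A i a = 0" by (auto simp: g_def low_def split: if_splits)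
  next
    fix A i assume "g \<alpha> A \<noteq> 0"
    from weights[OF this, of i] show "(\<Sum>a<N. A i a) = \<mu> i - \<alpha> i" by simp
  next
    fix i A assume i: "Suc i < l"
    from top[OF i, of A] show "Eop N i (g \<alpha>) A = 0" using Eg[OF i] by auto
  qed
  then obtain A where A: "g \<alpha> A \<noteq> 0" "semistandard_matrix l N A" by blast
  have "semistandard_matrix l (Suc N) (add_column N A \<alpha>)"
    unfolding semistandard_matrix_def
  proof (intro allI impI)
    fix i a assume i: "Suc i < l" and a: "a < Suc N"
    show "(\<Sum>b\<le>a. add_column N A \<alpha> (Suc i) b) \<le> (\<Sum>b<a. add_column N A \<alpha> i b)"
    proof (cases "a < N")
      case True
      then have "(\<Sum>b\<le>a. add_column N A \<alpha> (Suc i) b) = (\<Sum>b\<le>a. A (Suc i) b)"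
        "(\<Sum>b<a. add_column N A \<alpha> i b) = (\<Sum>b<a. A i b)"
        by (auto simp: add_column_def intro!: sum.cong)
      with A(2) i True show ?thesis by (simp add: semistandard_matrix_def)
    next
      case False
      then have [simp]: "a = N" using a by simp
      \<comment> \<open>\<open>\<beta> s\<close> lifts \<open>s\<close> copies of the last letter
        from row \<open>Suc i\<close> to row \<open>i\<close>, and \<open>r\<close> lifts all of
        them. Applying \<open>E\<close> undoes one lift up to a nonzero factor, so the slice at
        \<open>\<beta> r\<close> is nonzero but killed by \<open>E\<close> to the power r + 1. By
        \<open>Eop_pow_inj\<close> its weights p, q satisfy q \<le> p + r, which is the required
        inequality.\<close>
      define \<beta> where "\<beta> = (\<lambda>s. \<alpha>(i := \<alpha> i + s, Suc i := \<alpha> (Suc i) - s))"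
      define r where "r = \<alpha> (Suc i)"
      have step: "Eop N i (g (\<beta> (Suc s))) = (\<lambda>A. - of_nat (\<alpha> i + Suc s) * g (\<beta> s) A)" if "Suc s \<le> r" for s
      proof
        fix A
        have "move_down i N (add_column N A (\<beta> (Suc s))) = add_column N A (\<beta> s)"
          using that by (intro ext) (auto simp: move_down_def add_column_def \<beta>_def r_def)
        then show "Eop N i (g (\<beta> (Suc s))) A = - of_nat (\<alpha> i + Suc s) * g (\<beta> s) A"
          unfolding Eg[OF i] by (simp add: g_def \<beta>_def algebra_simps)
      qed
      have "s \<le> r \<Longrightarrow> \<exists>\<kappa>. \<kappa> \<noteq> 0 \<and> (Eop N i ^^ s) (g (\<beta> s)) = (\<lambda>A. \<kappa> * g (\<beta> 0) A)" for s
      proof (induction s)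
        case 0
        show ?case by (intro exI[of _ 1]) simp
      next
        case (Suc s)
        then obtain \<kappa> where \<kappa>: "\<kappa> \<noteq> 0" "(Eop N i ^^ s) (g (\<beta> s)) = (\<lambda>A. \<kappa> * g (\<beta> 0) A)" by auto
        have "(Eop N i ^^ Suc s) (g (\<beta> (Suc s))) = (\<lambda>A. - of_nat (\<alpha> i + Suc s) * (\<kappa> * g (\<beta> 0) A))"
          using step[OF Suc.prems] \<kappa>(2) by (simp only: funpow_Suc_right o_apply Eop_pow_scale)
        then show ?case using \<kappa>(1)
          by (intro exI[of _ "- of_nat (\<alpha> i + Suc s) * \<kappa>"]) (simp add: mult.assoc del: of_nat_add of_nat_Suc)
      qed
      then obtain \<kappa> where \<kappa>: "\<kappa> \<noteq> 0" "(Eop N i ^^ r) (g (\<beta> r)) = (\<lambda>A. \<kappa> * g (\<beta> 0) A)" by blast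
      have [simp]: "\<beta> 0 = \<alpha>" by (simp add: \<beta>_def)
      have "Eop N i (g \<alpha>) = (\<lambda>A. 0)"
        using Eg[OF i] top[OF i] by (auto simp: fun_eq_iff)
      then have zero: "(Eop N i ^^ Suc r) (g (\<beta> r)) = (\<lambda>A. 0)"
        using \<kappa>(2) by (simp add: Eop_scale)
      have wt: "row_weight N i (g (\<beta> r)) (int (\<mu> i) - int (\<alpha> i + r)) (int (\<mu> (Suc i)))"
        unfolding row_weight_def
      proof (intro allI impI)
        fix A assume "g (\<beta> r) A \<noteq> 0"
        from weights[OF this, of i] weights[OF this, of "Suc i"]
        have "(\<Sum>a<N. A i a) + (\<alpha> i + r) = \<mu> i" "(\<Sum>a<N. A (Suc i) a) = \<mu> (Suc i)"
          by (simp_all add: \<beta>_def r_def)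
        then show "int (\<Sum>a<N. A i a) = int (\<mu> i) - int (\<alpha> i + r) \<and> int (\<Sum>a<N. A (Suc i) a) = int (\<mu> (Suc i))"
          by linarith
      qed
      have "g (\<beta> r) \<noteq> (\<lambda>A. 0)"
      proof
        assume *: "g (\<beta> r) = (\<lambda>A. 0)"
        have "(Eop N i ^^ r) (\<lambda>A. 0) = (\<lambda>A. 0)" by (induction r) auto
        with * \<kappa> have "\<kappa> * g \<alpha> A = 0" by (metis \<open>\<beta> 0 = \<alpha>\<close>)
        with \<kappa>(1) A(1) show False by simp
      qed
      with Eop_pow_inj[OF wt zero] have "int (\<mu> (Suc i)) \<le> int (\<mu> i) - int (\<alpha> i)" by fastforce
      moreover have "(\<Sum>b\<le>N. add_column N A \<alpha> (Suc i) b) = \<mu> (Suc i)"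
        using weights[OF A(1), of "Suc i"] by (simp add: add_column_def lessThan_Suc_atMost[symmetric])
      moreover have "(\<Sum>b<N. add_column N A \<alpha> i b) + \<alpha> i = \<mu> i"
        using weights[OF A(1), of i] by (simp add: add_column_def)
      ultimately show ?thesis by simp
    qed
  qed
  moreover have "f (add_column N A \<alpha>) \<noteq> 0" using A(1) by (auto simp: g_def split: if_splits)
  ultimately show ?case by blast
qed

section \<open>Tabloids\<close>

lemma bij_betw_fibres:
  assumes "finite A" "finite B" "\<And>b. card {x\<in>A. f x = b} = card {y\<in>B. g y = b}"
  obtains h where "bij_betw h A B" "\<And>x. x \<in> A \<Longrightarrow> g (h x) = f x"
proof -
  have "\<forall>b. \<exists>h. bij_betw h {x\<in>A. f x = b} {y\<in>B. g y = b}"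
    using assms by (auto intro!: finite_same_card_bij)
  then obtain k where k: "\<And>b. bij_betw (k b) {x\<in>A. f x = b} {y\<in>B. g y = b}" by metis
  define h where "h = (\<lambda>x. k (f x) x)"
  have gh: "h x \<in> B \<and> g (h x) = f x" if "x \<in> A" for x
    using bij_betwE[OF k[of "f x"]] that by (auto simp: h_def)
  have "bij_betw h A B"
  proof (rule bij_betwI')
    fix x y assume xy: "x \<in> A" "y \<in> A"
    show "(h x = h y) = (x = y)"
    proof
      assume eq: "h x = h y"
      then have "f x = f y" using gh xy by metis
      with eq bij_betw_imp_inj_on[OF k[of "f x"]] xy show "x = y"
        by (auto simp: h_def inj_on_def)
    qed simp
  next
    fix y assume "y \<in> B"
    then have "y \<in> k (g y) ` {x\<in>A. f x = g y}" using bij_betw_imp_surj_on[OF k[of "g y"]] by auto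
    then obtain x where "x \<in> A" "f x = g y" "y = k (g y) x" by auto
    then show "\<exists>x\<in>A. y = h x" unfolding h_def by metis
  qed (use gh in blast)
  with gh that show ?thesis by blast
qed

section \<open>Row functions and the action on tabloids\<close>

abbreviation pinv :: "(nat \<Rightarrow> nat) \<Rightarrow> nat \<Rightarrow> nat" where
  "pinv \<equiv> inv_into UNIV"

text \<open>Calculations use row functions: permuting letters becomes composition, and moving a
  letter to another row becomes an update. A letter with value outside \<open>{..<l}\<close> is in
  no block, so identities can be stated for arbitrary \<open>\<rho>\<close>.\<close>

definition tab :: "nat \<Rightarrow> nat \<Rightarrow> (nat \<Rightarrow> nat) \<Rightarrow> nat set list" where
  "tab l n \<rho> = map (\<lambda>i. {y\<in>{1..n}. \<rho> y = i}) [0..<l]"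

definition sact :: "(nat \<Rightarrow> nat) \<Rightarrow> (nat set list \<Rightarrow>\<^sub>0 rat) \<Rightarrow> nat set list \<Rightarrow>\<^sub>0 rat" where
  "sact \<pi> = push (permute_blocks \<pi>)"

lemma length_tab [simp]: "length (tab l n \<rho>) = l"
  and nth_tab [simp]: "i < l \<Longrightarrow> tab l n \<rho> ! i = {y\<in>{1..n}. \<rho> y = i}"
  by (simp_all add: tab_def)

lemma tab_cong: "(\<And>y. y \<in> {1..n} \<Longrightarrow> \<rho> y = \<rho>' y) \<Longrightarrow> tab l n \<rho> = tab l n \<rho>'"
  by (auto simp: tab_def)

lemma tab_eqD:
  assumes "tab l n \<rho> = tab l n \<rho>'" "y \<in> {1..n}" "\<rho> y < l" shows "\<rho>' y = \<rho> y"
proof -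
  have "{z\<in>{1..n}. \<rho> z = \<rho> y} = {z\<in>{1..n}. \<rho>' z = \<rho> y}"
    using arg_cong[OF assms(1), of "\<lambda>B. B ! \<rho> y"] assms(3) by simp
  with assms(2) show ?thesis by blast
qed

lemma permute_blocks_tab:
  assumes "\<pi> permutes {1..n}"
  shows "permute_blocks \<pi> (tab l n \<rho>) = tab l n (\<rho> \<circ> pinv \<pi>)"
proof -
  have "\<pi> ` {y\<in>{1..n}. \<rho> y = i} = {y\<in>{1..n}. \<rho> (pinv \<pi> y) = i}" for i
  proof (intro Set.set_eqI iffI)
    fix x assume "x \<in> \<pi> ` {y\<in>{1..n}. \<rho> y = i}"
    then show "x \<in> {y\<in>{1..n}. \<rho> (pinv \<pi> y) = i}"
      using permutes_in_image[OF assms] permutes_inverses(2)[OF assms] by auto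
  next
    fix x assume "x \<in> {y\<in>{1..n}. \<rho> (pinv \<pi> y) = i}"
    then show "x \<in> \<pi> ` {y\<in>{1..n}. \<rho> y = i}"
      using permutes_in_image[OF permutes_inv[OF assms]] permutes_inverses(1)[OF assms]
      by (intro image_eqI[of _ _ "pinv \<pi> x"]) auto
  qed
  then show ?thesis by (simp add: permute_blocks_def tab_def)
qed

lemma permute_blocks_comp: "permute_blocks \<sigma> (permute_blocks \<tau> B) = permute_blocks (\<sigma> \<circ> \<tau>) B"
  by (simp add: permute_blocks_def image_comp)

lemma permute_blocks_id [simp]: "permute_blocks id B = B"
  by (simp add: permute_blocks_def)

lemma inj_permute_blocks:
  assumes "\<pi> permutes S" shows "inj (permute_blocks \<pi>)"
  by (rule inj_on_inverseI[of _ "permute_blocks (pinv \<pi>)"])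
    (simp add: permute_blocks_comp permutes_inv_o[OF assms])

lemma sact_sact: "sact \<sigma> (sact \<tau> v) = sact (\<sigma> \<circ> \<tau>) v"
  by (simp add: sact_def push_push permute_blocks_comp o_def[of "permute_blocks _"])

lemma sact_id [simp]: "sact id v = v"
  by (simp add: sact_def push_id_on)

lemma sact_diff: "sact \<pi> (v - w) = sact \<pi> v - sact \<pi> w"
  and sact_scl: "sact \<pi> (scl c v) = scl c (sact \<pi> v)"
  and sact_sum: "sact \<pi> (sum f A) = (\<Sum>a\<in>A. sact \<pi> (f a))"
  and sact_0 [simp]: "sact \<pi> 0 = 0"
  by (simp_all add: sact_def push_diff push_scl push_sum)

lemma lookup_sact_permute:
  "\<pi> permutes S \<Longrightarrow> lk (sact \<pi> v) (permute_blocks \<pi> B) = lk v B"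
  unfolding sact_def by (rule lookup_push_inj[OF inj_permute_blocks]) auto

lemma lookup_sact_tab:
  assumes "\<pi> permutes {1..n}" shows "lk (sact \<pi> v) (tab l n \<rho>) = lk v (tab l n (\<rho> \<circ> \<pi>))"
proof -
  have "permute_blocks \<pi> (tab l n (\<rho> \<circ> \<pi>)) = tab l n \<rho>"
    unfolding permute_blocks_tab[OF assms] comp_assoc permutes_inv_o[OF assms] by simp
  with lookup_sact_permute[OF assms] show ?thesis by metis
qed

lemma ip_sact: "\<pi> permutes S \<Longrightarrow> ip (sact \<pi> v) (sact \<pi> w) = ip v w"
  unfolding sact_def by (rule ip_push[OF inj_permute_blocks]) auto

lemma sact_inv: "\<pi> permutes S \<Longrightarrow> sact (pinv \<pi>) (sact \<pi> v) = v" "\<pi> permutes S \<Longrightarrow> sact \<pi> (sact (pinv \<pi>) v) = v"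
  by (simp_all add: sact_sact permutes_inv_o)

lemma ip_sact_left: "\<pi> permutes S \<Longrightarrow> ip (sact \<pi> v) w = ip v (sact (pinv \<pi>) w)"
  by (metis ip_sact sact_inv(2))

lemma finite_osp: "finite (ordered_set_partitions n k)"
proof (rule finite_subset)
  show "ordered_set_partitions n k \<subseteq> {B. set B \<subseteq> Pow {1..n} \<and> length B = k}"
    by (auto simp: ordered_set_partitions_def partition_on_def)
  show "finite {B. set B \<subseteq> Pow {1..n} \<and> length B = k}" by (intro finite_lists_length_eq) auto
qed

lemma finite_tabloids: "finite (tabloids n \<mu>)"
  unfolding tabloids_def using finite_osp by auto

lemma tab_in_osp_iff: "tab l n \<rho> \<in> ordered_set_partitions n l \<longleftrightarrow> \<rho> ` {1..n} = {..<l}"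
proof
  assume "tab l n \<rho> \<in> ordered_set_partitions n l"
  then have p: "partition_on {1..n} (set (tab l n \<rho>))" by (simp add: ordered_set_partitions_def)
  show "\<rho> ` {1..n} = {..<l}"
  proof (intro Set.set_eqI iffI)
    fix i assume "i \<in> \<rho> ` {1..n}"
    then obtain y where y: "y \<in> {1..n}" "\<rho> y = i" by auto
    then have "y \<in> \<Union> (set (tab l n \<rho>))" using p by (simp add: partition_on_def)
    with y show "i \<in> {..<l}" by (auto simp: tab_def)
  next
    fix i assume "i \<in> {..<l}"
    then have "tab l n \<rho> ! i \<in> set (tab l n \<rho>)" by (intro nth_mem) simp
    then have "tab l n \<rho> ! i \<noteq> {}" using p by (auto simp: partition_on_def)
    with \<open>i \<in> {..<l}\<close> show "i \<in> \<rho> ` {1..n}" by auto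
  qed
next
  assume r: "\<rho> ` {1..n} = {..<l}"
  have ne: "{y\<in>{1..n}. \<rho> y = i} \<noteq> {}" if "i < l" for i
  proof -
    have "i \<in> \<rho> ` {1..n}" using r that by simp
    then show ?thesis by auto
  qed
  have "inj_on (\<lambda>i. {y\<in>{1..n}. \<rho> y = i}) {..<l}"
  proof (rule inj_onI)
    fix i j assume ij: "i \<in> {..<l}" "{y\<in>{1..n}. \<rho> y = i} = {y\<in>{1..n}. \<rho> y = j}"
    then obtain y where "y \<in> {y\<in>{1..n}. \<rho> y = i}" using ne by blast
    with ij(2) show "i = j" by blast
  qed
  then have "distinct (tab l n \<rho>)" by (simp add: tab_def distinct_map atLeast0LessThan)
  moreover have "partition_on {1..n} (set (tab l n \<rho>))"
    unfolding partition_on_def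
  proof (intro conjI)
    have "\<rho> y < l" if "y \<in> {1..n}" for y using r that by blast
    then show "\<Union> (set (tab l n \<rho>)) = {1..n}" by (auto simp: tab_def)
    show "disjoint (set (tab l n \<rho>))" by (auto simp: tab_def disjoint_def)
    show "{} \<notin> set (tab l n \<rho>)"
    proof
      assume "{} \<in> set (tab l n \<rho>)"
      then obtain i where "i < l" "tab l n \<rho> ! i = {}" by (auto simp: in_set_conv_nth simp del: nth_tab)
      with ne[of i] nth_tab[of i l n \<rho>] show False by metis
    qed
  qed
  ultimately show "tab l n \<rho> \<in> ordered_set_partitions n l"
    by (simp add: ordered_set_partitions_def)
qed

lemma osp_tab:
  assumes "B \<in> ordered_set_partitions n l"
  obtains \<rho> where "B = tab l n \<rho>" "\<rho> ` {1..n} = {..<l}"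
proof -
  have B: "length B = l" "distinct B" "partition_on {1..n} (set B)"
    using assms by (auto simp: ordered_set_partitions_def)
  have "\<exists>i<l. y \<in> B ! i" if "y \<in> {1..n}" for y
    using B that unfolding partition_on_def by (metis UnionE in_set_conv_nth)
  then obtain \<rho> where \<rho>: "\<And>y. y \<in> {1..n} \<Longrightarrow> \<rho> y < l \<and> y \<in> B ! \<rho> y" by metis
  have "B ! i = {y\<in>{1..n}. \<rho> y = i}" if "i < l" for i
  proof (intro Set.set_eqI iffI)
    fix y assume y: "y \<in> B ! i"
    then have n: "y \<in> {1..n}" using B that nth_mem unfolding partition_on_def by blast
    have "B ! i = B ! \<rho> y"
    proof (rule ccontr)
      assume "B ! i \<noteq> B ! \<rho> y"
      then have "B ! i \<inter> B ! \<rho> y = {}"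
        using B \<rho>[OF n] that by (auto simp: partition_on_def disjoint_def)
      with y \<rho>[OF n] show False by auto
    qed
    then show "y \<in> {y\<in>{1..n}. \<rho> y = i}"
      using B that \<rho>[OF n] n nth_eq_iff_index_eq by fastforce
  qed (use \<rho> in auto)
  then have "B = tab l n \<rho>" using B(1) by (intro nth_equalityI) auto
  with assms tab_in_osp_iff that show ?thesis by metis
qed

lemma permute_blocks_osp:
  assumes "\<pi> permutes {1..n}" "B \<in> ordered_set_partitions n l"
  shows "permute_blocks \<pi> B \<in> ordered_set_partitions n l"
proof -
  obtain \<rho> where \<rho>: "B = tab l n \<rho>" "\<rho> ` {1..n} = {..<l}" using osp_tab[OF assms(2)] .
  show ?thesis unfolding \<rho>(1) permute_blocks_tab[OF assms(1)] tab_in_osp_iff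
    using \<rho>(2) permutes_image[OF permutes_inv[OF assms(1)]] by (metis image_comp)
qed

lemma permute_blocks_tabloids:
  assumes "\<pi> permutes {1..n}" "B \<in> tabloids n \<mu>"
  shows "permute_blocks \<pi> B \<in> tabloids n \<mu>"
proof -
  have "map card (permute_blocks \<pi> B) = map card B"
    using inj_on_subset[OF permutes_inj[OF assms(1)] subset_UNIV]
    by (simp add: permute_blocks_def card_image)
  with assms permute_blocks_osp show ?thesis by (auto simp: tabloids_def)
qed

lemma tab_in_tabloids_iff:
  assumes "0 \<notin> set \<mu>"
  shows "tab (length \<mu>) n \<rho> \<in> tabloids n \<mu> \<longleftrightarrow>
    (\<forall>y\<in>{1..n}. \<rho> y < length \<mu>) \<and> (\<forall>i<length \<mu>. card {y\<in>{1..n}. \<rho> y = i} = \<mu> ! i)"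
    (is "?l \<longleftrightarrow> ?r")
proof
  assume ?l
  then have "\<rho> ` {1..n} = {..<length \<mu>}" "map card (tab (length \<mu>) n \<rho>) = \<mu>"
    by (simp_all add: tabloids_def tab_in_osp_iff)
  then show ?r by (auto simp: list_eq_iff_nth_eq)
next
  assume r: ?r
  have "\<rho> ` {1..n} = {..<length \<mu>}"
  proof (intro Set.set_eqI iffI)
    fix i assume "i \<in> {..<length \<mu>}"
    then have "card {y\<in>{1..n}. \<rho> y = i} \<noteq> 0" using r assms by (metis lessThan_iff nth_mem)
    then have "{y\<in>{1..n}. \<rho> y = i} \<noteq> {}" by (metis card.empty)
    then show "i \<in> \<rho> ` {1..n}" by auto
  qed (use r in auto)
  moreover have "map card (tab (length \<mu>) n \<rho>) = \<mu>"
    using r by (auto simp: list_eq_iff_nth_eq)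
  ultimately show ?l by (simp add: tabloids_def tab_in_osp_iff)
qed

lemma tabloids_tab:
  assumes "B \<in> tabloids n \<mu>" obtains \<rho> where "B = tab (length \<mu>) n \<rho>"
  using assms osp_tab unfolding tabloids_def by blast

section \<open>Young subgroups and the matrices that index their orbits\<close>

lemma finite_permutes_nat: "finite {\<sigma>. \<sigma> permutes {1..n::nat}}"
  by (simp add: finite_permutations)

text \<open>The Young subgroup whose orbits are the fibres of \<open>w\<close>. For
  \<open>w = id\<close> it is trivial and for constant \<open>w\<close> it is the whole symmetric
  group; both extremes are used.\<close>

definition stab :: "nat \<Rightarrow> (nat \<Rightarrow> nat) \<Rightarrow> (nat \<Rightarrow> nat) set" where
  "stab n w = {\<sigma>. \<sigma> permutes {1..n} \<and> (\<forall>y\<in>{1..n}. w (\<sigma> y) = w y)}"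

lemma finite_stab: "finite (stab n w)"
  unfolding stab_def by (rule finite_subset[OF _ finite_permutes_nat]) auto

lemma id_in_stab [simp]: "id \<in> stab n w"
  by (simp add: stab_def permutes_id)

lemma stab_id_eq: "stab n id = {id}"
proof -
  have "\<sigma> = id" if "\<sigma> \<in> stab n id" for \<sigma>
  proof
    fix y show "\<sigma> y = id y"
      using that permutes_not_in[of \<sigma> "{1..n}" y] by (cases "y \<in> {1..n}") (simp_all add: stab_def)
  qed
  then show ?thesis using id_in_stab by blast
qed

lemma stab_comp: "\<sigma> \<in> stab n w \<Longrightarrow> \<tau> \<in> stab n w \<Longrightarrow> \<sigma> \<circ> \<tau> \<in> stab n w"
proof -
  assume s: "\<sigma> \<in> stab n w" "\<tau> \<in> stab n w"
  then have "\<tau> permutes {1..n}" by (simp add: stab_def)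
  from permutes_in_image[OF this] s show ?thesis
    unfolding stab_def by (auto intro: permutes_compose simp del: atLeastAtMost_iff)
qed

lemma stab_inv: "\<sigma> \<in> stab n w \<Longrightarrow> pinv \<sigma> \<in> stab n w"
proof -
  assume s: "\<sigma> \<in> stab n w"
  then have p: "\<sigma> permutes {1..n}" by (simp add: stab_def)
  have "w (pinv \<sigma> y) = w y" if "y \<in> {1..n}" for y
  proof -
    have "pinv \<sigma> y \<in> {1..n}" using that permutes_in_image[OF permutes_inv[OF p]] by blast
    then have "w (\<sigma> (pinv \<sigma> y)) = w (pinv \<sigma> y)" using s by (simp add: stab_def)
    then show ?thesis by (simp add: permutes_inverses[OF p])
  qed
  with permutes_inv[OF p] show ?thesis by (simp add: stab_def)
qed

definition stab_sum :: "nat \<Rightarrow> (nat \<Rightarrow> nat) \<Rightarrow> (nat set list \<Rightarrow>\<^sub>0 rat) \<Rightarrow> nat set list \<Rightarrow>\<^sub>0 rat" where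
  "stab_sum n w v = (\<Sum>\<sigma>\<in>stab n w. sact \<sigma> v)"

lemma sact_stab_sum:
  assumes "\<tau> \<in> stab n w" shows "sact \<tau> (stab_sum n w v) = stab_sum n w v"
proof -
  have p: "\<tau> permutes {1..n}" using assms by (simp add: stab_def)
  have "sact \<tau> (stab_sum n w v) = (\<Sum>\<sigma>\<in>stab n w. sact (\<tau> \<circ> \<sigma>) v)"
    by (simp add: stab_sum_def sact_sum sact_sact)
  also have "\<dots> = stab_sum n w v" unfolding stab_sum_def
    by (rule sum.reindex_bij_witness[of _ "\<lambda>\<sigma>. pinv \<tau> \<circ> \<sigma>" "\<lambda>\<sigma>. \<tau> \<circ> \<sigma>"])
      (auto simp: assms stab_comp stab_inv comp_assoc[symmetric] permutes_inv_o[OF p])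
  finally show ?thesis .
qed

definition mat :: "nat \<Rightarrow> (nat \<Rightarrow> nat) \<Rightarrow> (nat \<Rightarrow> nat) \<Rightarrow> nat \<Rightarrow> nat \<Rightarrow> nat" where
  "mat n w \<rho> i a = card {y\<in>{1..n}. \<rho> y = i \<and> w y = a}"

text \<open>The entries count the pairs of row and value. Equal counts mean equal multisets of
  pairs, and a permutation matching them preserves \<open>w\<close>.\<close>

lemma mat_eq_imp_stab:
  assumes "mat n w \<rho> = mat n w \<rho>'"
  obtains \<sigma> where "\<sigma> \<in> stab n w" "\<And>y. y \<in> {1..n} \<Longrightarrow> \<rho>' (\<sigma> y) = \<rho> y"
proof -
  have "card {y\<in>{1..n}. (\<rho> y, w y) = b} = card {y\<in>{1..n}. (\<rho>' y, w y) = b}" for b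
    using fun_cong[OF fun_cong[OF assms, of "fst b"], of "snd b"]
    by (cases b) (simp add: mat_def)
  then have "image_mset (\<lambda>y. (\<rho> y, w y)) (mset_set {1..n}) = image_mset (\<lambda>y. (\<rho>' y, w y)) (mset_set {1..n})"
    by (intro multiset_eqI) (simp add: count_image_mset_eq_card_vimage)
  from image_mset_eq_implies_permutes[OF finite_atLeastAtMost this] obtain \<sigma> where
    "\<sigma> permutes {1..n}" "\<forall>y\<in>{1..n}. (\<rho> y, w y) = (\<rho>' (\<sigma> y), w (\<sigma> y))" .
  then show ?thesis by (intro that[of \<sigma>]) (simp_all add: stab_def)
qed

lemma mat_comp_stab:
  assumes "\<sigma> \<in> stab n w" "\<And>y. y \<in> {1..n} \<Longrightarrow> \<rho>' (\<sigma> y) = \<rho> y"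
  shows "mat n w \<rho> = mat n w \<rho>'"
proof (intro ext)
  fix i a
  have p: "\<sigma> permutes {1..n}" using assms(1) by (simp add: stab_def)
  have "{y\<in>{1..n}. \<rho>' y = i \<and> w y = a} = \<sigma> ` {y\<in>{1..n}. \<rho> y = i \<and> w y = a}"
  proof (intro Set.set_eqI iffI)
    fix y assume y: "y \<in> {y\<in>{1..n}. \<rho>' y = i \<and> w y = a}"
    then have z: "pinv \<sigma> y \<in> {1..n}" using permutes_in_image[OF permutes_inv[OF p]] by blast
    have "w (\<sigma> (pinv \<sigma> y)) = w (pinv \<sigma> y)" using assms(1) z unfolding stab_def by blast
    then have "\<rho> (pinv \<sigma> y) = \<rho>' y" "w (pinv \<sigma> y) = w y"
      using assms(2)[OF z] permutes_inverses(1)[OF p, of y] by simp_all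
    with y z show "y \<in> \<sigma> ` {y\<in>{1..n}. \<rho> y = i \<and> w y = a}"
      by (intro image_eqI[of _ _ "pinv \<sigma> y"]) (auto simp: permutes_inverses[OF p])
  qed (use assms permutes_in_image[OF p] in \<open>auto simp: stab_def\<close>)
  then show "mat n w \<rho> i a = mat n w \<rho>' i a"
    unfolding mat_def using permutes_inj_on[OF p] by (simp add: card_image)
qed

lemma mat_upd_down:
  assumes "y \<in> {1..n}" "\<rho> y = i"
  shows "mat n w (\<rho>(y := Suc i)) = move_down i (w y) (mat n w \<rho>)"
proof (intro ext)
  fix j b
  let ?S = "{z\<in>{1..n}. \<rho> z = j \<and> w z = b}"
  have S: "{z\<in>{1..n}. (\<rho>(y := Suc i)) z = j \<and> w z = b} =
    (if b = w y \<and> j = i then ?S - {y} else if b = w y \<and> j = Suc i then insert y ?S else ?S)"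
    using assms by auto
  show "mat n w (\<rho>(y := Suc i)) j b = move_down i (w y) (mat n w \<rho>) j b"
    unfolding mat_def S move_down_def using assms by (auto simp: card_Diff_singleton)
qed

lemma mat_upd_up:
  assumes "y \<in> {1..n}" "\<rho> y = Suc i"
  shows "mat n w (\<rho>(y := i)) = move_up i (w y) (mat n w \<rho>)"
proof (intro ext)
  fix j b
  let ?S = "{z\<in>{1..n}. \<rho> z = j \<and> w z = b}"
  have S: "{z\<in>{1..n}. (\<rho>(y := i)) z = j \<and> w z = b} =
    (if b = w y \<and> j = i then insert y ?S else if b = w y \<and> j = Suc i then ?S - {y} else ?S)"
    using assms by auto
  show "mat n w (\<rho>(y := i)) j b = move_up i (w y) (mat n w \<rho>) j b"
    unfolding mat_def S move_up_def using assms by (auto simp: card_Diff_singleton)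
qed

lemma card_fibre_sum:
  assumes "finite S" "\<And>y. y \<in> S \<Longrightarrow> w y \<in> T" "finite T"
  shows "card S = (\<Sum>a\<in>T. card {y\<in>S. w y = a})"
proof -
  have "(\<Sum>a\<in>T. \<Sum>y\<in>{y\<in>S. w y = a}. 1::nat) = (\<Sum>y\<in>S. 1)"
    using assms by (intro sum.group) auto
  then show ?thesis by simp
qed

lemma mat_row_sum:
  assumes "\<And>y. y \<in> {1..n} \<Longrightarrow> w y < N"
  shows "(\<Sum>a<N. mat n w \<rho> i a) = card {y\<in>{1..n}. \<rho> y = i}"
  using card_fibre_sum[of "{y\<in>{1..n}. \<rho> y = i}" w "{..<N}"] assms
  by (simp add: mat_def conj_assoc)

text \<open>Each equation is a coefficient of the map that moves one letter from row
  \<open>Suc i\<close> up to row \<open>i\<close> in all possible ways, so this is a common kernel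
  in the style of James. For \<open>\<rho>\<close> of unsuitable row lengths the equation reads 0 =
  0.\<close>

definition hw :: "nat \<Rightarrow> nat list \<Rightarrow> (nat set list \<Rightarrow>\<^sub>0 rat) set" where
  "hw n \<mu> = {v. ks v \<subseteq> tabloids n \<mu> \<and>
     (\<forall>i \<rho>. Suc i < length \<mu> \<longrightarrow> (\<Sum>y\<in>{y\<in>{1..n}. \<rho> y = i}. lk v (tab (length \<mu>) n (\<rho>(y := Suc i)))) = 0)}"

lemma subspace_hw: "PM.subspace (hw n \<mu>)"
proof (rule PM.subspaceI)
  fix v w c assume "v \<in> hw n \<mu>" "w \<in> hw n \<mu>"
  then show "v + w \<in> hw n \<mu>" "scl c v \<in> hw n \<mu>"
    using keys_add[of v w]
    by (auto simp: hw_def lookup_add sum.distrib in_keys_iff simp flip: sum_distrib_left)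
qed (simp add: hw_def)

lemma sact_keys_tabloids:
  assumes "\<pi> permutes {1..n}" "ks v \<subseteq> tabloids n \<mu>" shows "ks (sact \<pi> v) \<subseteq> tabloids n \<mu>"
  using keys_push[of "permute_blocks \<pi>" v] assms permute_blocks_tabloids[OF assms(1)]
  unfolding sact_def by blast

lemma sact_hw:
  assumes p: "\<pi> permutes {1..n}" and v: "v \<in> hw n \<mu>"
  shows "sact \<pi> v \<in> hw n \<mu>"
  unfolding hw_def
proof (intro CollectI conjI allI impI)
  show "ks (sact \<pi> v) \<subseteq> tabloids n \<mu>" using assms by (auto simp: hw_def intro: sact_keys_tabloids[THEN subsetD])
next
  fix i \<rho> assume i: "Suc i < length \<mu>"
  have "(\<Sum>y\<in>{y\<in>{1..n}. \<rho> y = i}. lk (sact \<pi> v) (tab (length \<mu>) n (\<rho>(y := Suc i)))) =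
    (\<Sum>y\<in>{y\<in>{1..n}. (\<rho> \<circ> \<pi>) y = i}. lk v (tab (length \<mu>) n ((\<rho> \<circ> \<pi>)(y := Suc i))))"
  proof (rule sum.reindex_bij_witness[of _ \<pi> "pinv \<pi>"])
    fix y assume y: "y \<in> {y\<in>{1..n}. \<rho> y = i}"
    have "(\<rho>(y := Suc i)) \<circ> \<pi> = (\<rho> \<circ> \<pi>)(pinv \<pi> y := Suc i)"
      using permutes_inverses[OF p] permutes_inj[OF p] by (auto simp: fun_eq_iff inj_def)
    then show "lk v (tab (length \<mu>) n ((\<rho> \<circ> \<pi>)(pinv \<pi> y := Suc i))) = lk (sact \<pi> v) (tab (length \<mu>) n (\<rho>(y := Suc i)))"
      unfolding lookup_sact_tab[OF p] by simp
  qed (use permutes_in_image[OF p] permutes_in_image[OF permutes_inv[OF p]] permutes_inverses[OF p] in auto)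
  also have "\<dots> = 0" using v i unfolding hw_def by blast
  finally show "(\<Sum>y\<in>{y\<in>{1..n}. \<rho> y = i}. lk (sact \<pi> v) (tab (length \<mu>) n (\<rho>(y := Suc i)))) = 0" .
qed

text \<open>An invariant vector has a coefficient that depends on the matrix only. Grouping the
  letters of row \<open>i\<close> by their value under \<open>w\<close> collects
  \<open>A i a\<close> equal terms, which turns the equations of \<open>hw\<close> into
  \<open>Eop N i f = 0\<close>.\<close>

lemma hw_vanish:
  assumes v: "v \<in> hw n \<mu>" and inv: "\<And>\<sigma>. \<sigma> \<in> stab n w \<Longrightarrow> sact \<sigma> v = v"
    and \<mu>: "0 \<notin> set \<mu>" and w: "\<And>y. y \<in> {1..n} \<Longrightarrow> w y < N"
    and van: "\<And>\<rho>. semistandard_matrix (length \<mu>) N (mat n w \<rho>) \<Longrightarrow> tab (length \<mu>) n \<rho> \<in> tabloids n \<mu>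
      \<Longrightarrow> lk v (tab (length \<mu>) n \<rho>) = 0"
  shows "v = 0"
proof (rule ccontr)
  assume "v \<noteq> 0"
  let ?l = "length \<mu>"
  have supp: "ks v \<subseteq> tabloids n \<mu>" using v by (simp add: hw_def)
  obtain B where B: "B \<in> ks v" using \<open>v \<noteq> 0\<close> by (metis ex_in_conv keys_eq_empty)
  then obtain \<rho>0 where \<rho>0: "lk v (tab ?l n \<rho>0) \<noteq> 0"
    using supp tabloids_tab by (metis in_keys_iff subsetD)
  have orb: "lk v (tab ?l n \<rho>) = lk v (tab ?l n \<rho>')" if "mat n w \<rho> = mat n w \<rho>'" for \<rho> \<rho>'
  proof -
    from mat_eq_imp_stab[OF that] obtain \<sigma> where
      \<sigma>: "\<sigma> \<in> stab n w" "\<And>y. y \<in> {1..n} \<Longrightarrow> \<rho>' (\<sigma> y) = \<rho> y" by metis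
    have "lk v (tab ?l n \<rho>') = lk (sact \<sigma> v) (tab ?l n \<rho>')" using inv[OF \<sigma>(1)] by simp
    also have "\<dots> = lk v (tab ?l n (\<rho>' \<circ> \<sigma>))"
      using \<sigma>(1) by (intro lookup_sact_tab) (simp add: stab_def)
    also have "tab ?l n (\<rho>' \<circ> \<sigma>) = tab ?l n \<rho>" using \<sigma>(2) by (intro tab_cong) simp
    finally show ?thesis by simp
  qed
  \<comment> \<open>Matrices that come from no row function get the value 0; elsewhere the choice is
    immaterial by \<open>orb\<close>.\<close>
  define f where "f = (\<lambda>A. if \<exists>\<rho>. mat n w \<rho> = A then lk v (tab ?l n (SOME \<rho>. mat n w \<rho> = A)) else 0)"
  have f: "f (mat n w \<rho>) = lk v (tab ?l n \<rho>)" for \<rho>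
  proof -
    have "mat n w (SOME \<rho>'. mat n w \<rho>' = mat n w \<rho>) = mat n w \<rho>"
      using someI[of "\<lambda>\<rho>'. mat n w \<rho>' = mat n w \<rho>" \<rho>] by simp
    then have "lk v (tab ?l n (SOME \<rho>'. mat n w \<rho>' = mat n w \<rho>)) = lk v (tab ?l n \<rho>)" by (rule orb)
    moreover have "\<exists>\<rho>'. mat n w \<rho>' = mat n w \<rho>" by blast
    ultimately show ?thesis unfolding f_def by simp
  qed
  have fnz: "\<exists>\<rho>. A = mat n w \<rho> \<and> lk v (tab ?l n \<rho>) \<noteq> 0 \<and> tab ?l n \<rho> \<in> tabloids n \<mu>" if "f A \<noteq> 0" for A
  proof -
    have "\<exists>\<rho>. mat n w \<rho> = A" using that unfolding f_def by metis
    then obtain \<rho> where \<rho>: "mat n w \<rho> = A" by blast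
    with that f[of \<rho>] have "lk v (tab ?l n \<rho>) \<noteq> 0" by simp
    moreover from this have "tab ?l n \<rho> \<in> tabloids n \<mu>" using supp in_keys_iff by fast
    ultimately show ?thesis using \<rho> by blast
  qed
  have "\<exists>A. f A \<noteq> 0 \<and> semistandard_matrix ?l N A"
  proof (rule highest_weight_semistandard[of f "mat n w \<rho>0" N "\<lambda>i. if i < ?l then \<mu> ! i else 0" ?l])
    show "f (mat n w \<rho>0) \<noteq> 0" using \<rho>0 f by simp
  next
    fix A i a assume "f A \<noteq> 0" "N \<le> a"
    then obtain \<rho> where "A = mat n w \<rho>" using fnz by blast
    moreover have "{y\<in>{1..n}. \<rho> y = i \<and> w y = a} = {}" using w \<open>N \<le> a\<close> by force
    ultimately show "A i a = 0" by (simp add: mat_def)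
  next
    fix A i assume "f A \<noteq> 0"
    then obtain \<rho> where \<rho>: "A = mat n w \<rho>" "tab ?l n \<rho> \<in> tabloids n \<mu>" using fnz by blast
    have "{y\<in>{1..n}. \<rho> y = i} = {}" if "\<not> i < ?l"
      using \<rho>(2) that unfolding tab_in_tabloids_iff[OF \<mu>] by force
    then have "card {y\<in>{1..n}. \<rho> y = i} = (if i < ?l then \<mu> ! i else 0)"
      using \<rho>(2) unfolding tab_in_tabloids_iff[OF \<mu>] by (cases "i < ?l") (simp_all only: card.empty if_True if_False not_False_eq_True simp_thms)
    moreover have "(\<Sum>a<N. A i a) = card {y\<in>{1..n}. \<rho> y = i}"
      unfolding \<rho>(1) by (rule mat_row_sum) (rule w)
    ultimately show "(\<Sum>a<N. A i a) = (if i < ?l then \<mu> ! i else 0)" by simp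
  next
    fix i A assume i: "Suc i < ?l"
    show "Eop N i f A = 0"
    proof (cases "\<exists>\<rho>. mat n w \<rho> = A")
      case True
      then obtain \<rho> where \<rho>: "A = mat n w \<rho>" by blast
      have "of_nat (A i a) * f (move_down i a A) =
        (\<Sum>y\<in>{y\<in>{y\<in>{1..n}. \<rho> y = i}. w y = a}. lk v (tab ?l n (\<rho>(y := Suc i))))" for a
      proof -
        have "(\<Sum>y\<in>{y\<in>{y\<in>{1..n}. \<rho> y = i}. w y = a}. lk v (tab ?l n (\<rho>(y := Suc i)))) =
          (\<Sum>y\<in>{y\<in>{y\<in>{1..n}. \<rho> y = i}. w y = a}. f (move_down i a A))"
          by (intro sum.cong refl) (auto simp: \<rho> f[symmetric] mat_upd_down)
        then show ?thesis by (simp add: \<rho> mat_def conj_assoc)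
      qed
      then have "Eop N i f A = (\<Sum>a<N. \<Sum>y\<in>{y\<in>{y\<in>{1..n}. \<rho> y = i}. w y = a}. lk v (tab ?l n (\<rho>(y := Suc i))))"
        by (simp add: Eop_def)
      also have "\<dots> = (\<Sum>y\<in>{y\<in>{1..n}. \<rho> y = i}. lk v (tab ?l n (\<rho>(y := Suc i))))"
        using w by (intro sum.group) auto
      also have "\<dots> = 0" using v i by (simp add: hw_def)
      finally show ?thesis .
    next
      case False
      \<comment> \<open>A nonzero term would come from a row function, and moving one letter back up
        would realize \<open>A\<close> itself.\<close>
      have "of_nat (A i a) * f (move_down i a A) = 0" for a
      proof (rule ccontr)
        assume *: "\<not> ?thesis"
        then obtain \<rho> where \<rho>: "move_down i a A = mat n w \<rho>" using fnz by fastforce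
        have "mat n w \<rho> (Suc i) a > 0" unfolding \<rho>[symmetric] by (simp add: move_down_def)
        then obtain y where y: "y \<in> {1..n}" "\<rho> y = Suc i" "w y = a"
          unfolding mat_def card_gt_0_iff by auto
        have "mat n w (\<rho>(y := i)) = move_up i a (move_down i a A)"
          using mat_upd_up[of y n \<rho> i w, OF y(1,2)] y(3) \<rho> by simp
        also have "\<dots> = A" using * by (intro ext) (auto simp: move_up_def move_down_def)
        finally show False using False by blast
      qed
      then show ?thesis unfolding Eop_def by (intro sum.neutral) blast
    qed
  qed
  then obtain A where A: "f A \<noteq> 0" "semistandard_matrix ?l N A" by blast
  with fnz van show False by blast
qed

section \<open>Polytabloids\<close>

lemma finite_cells: "finite (cells \<mu>)"
proof (rule finite_subset)
  show "cells \<mu> \<subseteq> (\<Union>i<length \<mu>. {i} \<times> {..<\<mu> ! i})" by (auto simp: cells_def)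
qed auto

lemma card_row_cells: "i < length \<mu> \<Longrightarrow> card {c\<in>cells \<mu>. fst c = i \<and> P (snd c)} = card {j. j < \<mu> ! i \<and> P j}"
proof -
  assume i: "i < length \<mu>"
  have "{c\<in>cells \<mu>. fst c = i \<and> P (snd c)} = Pair i ` {j. j < \<mu> ! i \<and> P j}"
    using i by (auto simp: cells_def)
  then show ?thesis by (simp add: card_image inj_on_def)
qed

lemma card_cells: "card (cells \<mu>) = sum_list \<mu>"
proof -
  have "card (cells \<mu>) = (\<Sum>i<length \<mu>. card {c\<in>cells \<mu>. fst c = i})"
    by (rule card_fibre_sum[OF finite_cells]) (auto simp: cells_def)
  also have "\<dots> = (\<Sum>i<length \<mu>. \<mu> ! i)"
    by (intro sum.cong refl) (use card_row_cells[where P = "\<lambda>_. True"] in simp)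
  finally show ?thesis by (simp add: sum_list_sum_nth atLeast0LessThan)
qed

lemma partitionsD:
  assumes "\<mu> \<in> partitions n"
  shows "0 \<notin> set \<mu>" "sum_list \<mu> = n" "i \<le> j \<Longrightarrow> j < length \<mu> \<Longrightarrow> \<mu> ! j \<le> \<mu> ! i"
  using assms by (auto simp: partitions_def sorted_wrt_iff_nth_less) (metis le_neq_implies_less order_refl)

lemma lookup_content: "lk (content \<mu> T) a = card {c\<in>cells \<mu>. T c = a}"
proof -
  have "lk (content \<mu> T) a = (\<Sum>c\<in>cells \<mu>. if T c = a then Suc 0 else 0)"
    by (simp add: content_def lookup_sum lookup_single when_def)
  also have "\<dots> = card {c\<in>cells \<mu>. T c = a}"
    using finite_cells[of \<mu>] by (simp add: sum.If_cases Int_def)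
  finally show ?thesis .
qed

locale tableau =
  fixes n :: nat and \<mu> :: "nat list" and t :: "nat \<times> nat \<Rightarrow> nat"
  assumes part: "\<mu> \<in> partitions n" and bij: "bij_betw t (cells \<mu>) {1..n}"
begin

definition cell :: "nat \<Rightarrow> nat \<times> nat" where "cell = inv_into (cells \<mu>) t"
definition row :: "nat \<Rightarrow> nat" where "row y = fst (cell y)"
definition col :: "nat \<Rightarrow> nat" where "col y = snd (cell y)"

lemma cell_in: "y \<in> {1..n} \<Longrightarrow> cell y \<in> cells \<mu>"
  unfolding cell_def using bij by (metis bij_betw_def inv_into_into)
lemma t_cell: "y \<in> {1..n} \<Longrightarrow> t (cell y) = y"
  unfolding cell_def using bij by (metis bij_betw_def f_inv_into_f)
lemma cell_t: "c \<in> cells \<mu> \<Longrightarrow> cell (t c) = c"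
  unfolding cell_def using bij by (simp add: bij_betw_def inv_into_f_f)
lemma t_in: "c \<in> cells \<mu> \<Longrightarrow> t c \<in> {1..n}"
  using bij by (rule bij_betw_apply)
lemma cell_eq: "y \<in> {1..n} \<Longrightarrow> cell y = (row y, col y)"
  by (simp add: row_def col_def)
lemma row_col_inj: "y \<in> {1..n} \<Longrightarrow> z \<in> {1..n} \<Longrightarrow> row y = row z \<Longrightarrow> col y = col z \<Longrightarrow> y = z"
  by (metis cell_eq t_cell)
lemma row_less: "y \<in> {1..n} \<Longrightarrow> row y < length \<mu>"
  using cell_in[of y] by (auto simp: row_def cells_def)

lemma image_t_filter: "t ` {c\<in>cells \<mu>. P c} = {y\<in>{1..n}. P (cell y)}"
proof (intro Set.set_eqI iffI)
  fix y assume "y \<in> {y\<in>{1..n}. P (cell y)}"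
  then show "y \<in> t ` {c\<in>cells \<mu>. P c}"
    by (intro image_eqI[of _ _ "cell y"]) (simp_all add: cell_in t_cell del: atLeastAtMost_iff)
qed (use t_in cell_t in auto)

lemma card_filter: "card {y\<in>{1..n}. P (cell y)} = card {c\<in>cells \<mu>. P c}"
  unfolding image_t_filter[symmetric] using bij
  by (intro card_image) (auto simp: bij_betw_def intro: inj_on_subset)

lemma tabloid_of_eq: "tabloid_of \<mu> t = tab (length \<mu>) n row"
  unfolding tabloid_of_def tab_def row_def image_t_filter ..

lemma tab_row_tabloids: "tab (length \<mu>) n row \<in> tabloids n \<mu>"
  unfolding tab_in_tabloids_iff[OF partitionsD(1)[OF part]]
proof (intro conjI ballI allI impI)
  fix i assume "i < length \<mu>"
  then show "card {y\<in>{1..n}. row y = i} = \<mu> ! i"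
    using card_filter[of "\<lambda>c. fst c = i"] card_row_cells[of i \<mu> "\<lambda>_. True"] by (simp add: row_def)
qed (rule row_less)

lemma col_stab: "\<pi> \<in> column_stabilizer n \<mu> t \<longleftrightarrow> \<pi> permutes {1..n} \<and> (\<forall>y\<in>{1..n}. col (\<pi> y) = col y)"
proof (cases "\<pi> permutes {1..n}")
  case p: True
  have eq: "t ` {c\<in>cells \<mu>. snd c = j} = {y\<in>{1..n}. col y = j}" for j
    unfolding image_t_filter col_def ..
  have "(\<forall>j. \<pi> ` {y\<in>{1..n}. col y = j} = {y\<in>{1..n}. col y = j}) \<longleftrightarrow> (\<forall>y\<in>{1..n}. col (\<pi> y) = col y)"
  proof
    assume *: "\<forall>j. \<pi> ` {y\<in>{1..n}. col y = j} = {y\<in>{1..n}. col y = j}"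
    show "\<forall>y\<in>{1..n}. col (\<pi> y) = col y"
    proof
      fix y assume "y \<in> {1..n}"
      then have "\<pi> y \<in> \<pi> ` {z\<in>{1..n}. col z = col y}" by blast
      with * show "col (\<pi> y) = col y" by blast
    qed
  next
    assume *: "\<forall>y\<in>{1..n}. col (\<pi> y) = col y"
    show "\<forall>j. \<pi> ` {y\<in>{1..n}. col y = j} = {y\<in>{1..n}. col y = j}"
    proof
      fix j
      have "\<pi> ` {y\<in>{1..n}. col y = j} \<subseteq> {y\<in>{1..n}. col y = j}"
        using * permutes_in_image[OF p] by blast
      moreover have "card (\<pi> ` {y\<in>{1..n}. col y = j}) = card {y\<in>{1..n}. col y = j}"
        by (intro card_image permutes_inj_on[OF p])
      ultimately show "\<pi> ` {y\<in>{1..n}. col y = j} = {y\<in>{1..n}. col y = j}"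
        by (intro card_subset_eq) auto
    qed
  qed
  with p show ?thesis unfolding column_stabilizer_def eq by blast
next
  case False
  then show ?thesis by (simp add: column_stabilizer_def)
qed

abbreviation "C \<equiv> column_stabilizer n \<mu> t"

lemma finite_C: "finite C"
  by (rule finite_subset[OF _ finite_permutes_nat]) (auto simp: column_stabilizer_def)

lemma id_in_C: "id \<in> C"
  by (simp add: col_stab permutes_id)

lemma lookup_polytabloid:
  "lk (polytabloid n \<mu> t) (tab (length \<mu>) n \<rho>) = (\<Sum>\<pi>\<in>{\<pi>\<in>C. \<forall>y\<in>{1..n}. \<rho> (\<pi> y) = row y}. of_int (sign \<pi>))"
proof -
  have iff: "permute_blocks \<pi> (tabloid_of \<mu> t) = tab (length \<mu>) n \<rho> \<longleftrightarrow> (\<forall>y\<in>{1..n}. \<rho> (\<pi> y) = row y)"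
    if "\<pi> \<in> C" for \<pi>
  proof -
    have p: "\<pi> permutes {1..n}" using that by (simp add: col_stab)
    show ?thesis unfolding tabloid_of_eq permute_blocks_tab[OF p]
    proof
      assume *: "tab (length \<mu>) n (row \<circ> pinv \<pi>) = tab (length \<mu>) n \<rho>"
      show "\<forall>y\<in>{1..n}. \<rho> (\<pi> y) = row y"
      proof
        fix y assume y: "y \<in> {1..n}"
        then have y': "\<pi> y \<in> {1..n}" using permutes_in_image[OF p] by blast
        from tab_eqD[OF * y'] row_less[OF y] show "\<rho> (\<pi> y) = row y"
          by (simp add: permutes_inverses[OF p])
      qed
    next
      assume *: "\<forall>y\<in>{1..n}. \<rho> (\<pi> y) = row y"
      show "tab (length \<mu>) n (row \<circ> pinv \<pi>) = tab (length \<mu>) n \<rho>"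
      proof (rule tab_cong)
        fix y assume "y \<in> {1..n}"
        then have "pinv \<pi> y \<in> {1..n}" using permutes_in_image[OF permutes_inv[OF p]] by blast
        with * have "\<rho> (\<pi> (pinv \<pi> y)) = row (pinv \<pi> y)" by blast
        then show "(row \<circ> pinv \<pi>) y = \<rho> y" by (simp add: permutes_inverses[OF p])
      qed
    qed
  qed
  have "lk (polytabloid n \<mu> t) (tab (length \<mu>) n \<rho>) =
    (\<Sum>\<pi>\<in>C. if \<forall>y\<in>{1..n}. \<rho> (\<pi> y) = row y then of_int (sign \<pi>) else 0)"
    unfolding polytabloid_def lookup_sum
    by (intro sum.cong refl) (simp only: lookup_single when_def iff)
  then show ?thesis by (simp only: sum.inter_filter[OF finite_C])
qed

lemma keys_polytabloid: "ks (polytabloid n \<mu> t) \<subseteq> tabloids n \<mu>"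
proof -
  have "ks (sng (permute_blocks \<pi> (tabloid_of \<mu> t)) (of_int (sign \<pi>) :: rat)) \<subseteq> tabloids n \<mu>" if "\<pi> \<in> C" for \<pi>
    using permute_blocks_tabloids[OF _ tab_row_tabloids] that by (auto simp: tabloid_of_eq col_stab)
  then show ?thesis unfolding polytabloid_def using keys_sum by fastforce
qed

text \<open>A sign-reversing involution. A term is a letter \<open>y\<close> together with a column
  permutation \<open>\<pi>\<close> that leads to the arrangement with \<open>y\<close> moved into
  row \<open>Suc i\<close>. Take the cell that \<open>\<pi>\<close> fills with \<open>y\<close> and
  exchange \<open>y\<close> with the letter that \<open>\<pi>\<close> puts into the cell above: the
  permutation stays in the column stabilizer and its sign flips.\<close>

lemma polytabloid_hw: "polytabloid n \<mu> t \<in> hw n \<mu>"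
  unfolding hw_def
proof (intro CollectI conjI allI impI keys_polytabloid)
  fix i \<rho> assume i: "Suc i < length \<mu>"
  define P where "P = (SIGMA y:{y\<in>{1..n}. \<rho> y = i}. {\<pi>\<in>C. \<forall>z\<in>{1..n}. (\<rho>(y := Suc i)) (\<pi> z) = row z})"
  define up where "up = (\<lambda>z. t (i, col z))"
  define \<tau> where "\<tau> = (\<lambda>(y, \<pi>). (\<pi> (up (pinv \<pi> y)), transpose y (\<pi> (up (pinv \<pi> y))) \<circ> \<pi>))"
  have key: "\<tau> (y, \<pi>) \<in> P \<and> \<tau> (\<tau> (y, \<pi>)) = (y, \<pi>) \<and> sign (snd (\<tau> (y, \<pi>))) = - sign \<pi>"
    if P: "(y, \<pi>) \<in> P" for y \<pi>
  proof -
    have y: "y \<in> {1..n}" "\<rho> y = i" and \<pi>: "\<pi> \<in> C" and eq: "\<And>z. z \<in> {1..n} \<Longrightarrow> (\<rho>(y := Suc i)) (\<pi> z) = row z"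
      using P unfolding P_def by blast+
    have p: "\<pi> permutes {1..n}" and pc: "\<And>z. z \<in> {1..n} \<Longrightarrow> col (\<pi> z) = col z" using \<pi> by (auto simp: col_stab)
    define z0 where "z0 = pinv \<pi> y"
    have z0: "z0 \<in> {1..n}" "\<pi> z0 = y"
      using y permutes_in_image[OF permutes_inv[OF p]] permutes_inverses[OF p] unfolding z0_def by blast+
    have r0: "row z0 = Suc i" using eq[OF z0(1)] z0(2) by simp
    \<comment> \<open>Row lengths weakly decrease, so there is a cell directly above that of
      \<open>z0\<close>.\<close>
    have "(i, col z0) \<in> cells \<mu>"
      using cell_in[OF z0(1)] partitionsD(3)[OF part, of i "Suc i"] i
      unfolding cell_eq[OF z0(1)] r0 by (auto simp: cells_def)
    define z1 where "z1 = up z0"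
    have z1: "z1 \<in> {1..n}" "row z1 = i" "col z1 = col z0"
      unfolding z1_def up_def row_def col_def using \<open>(i, col z0) \<in> cells \<mu>\<close> cell_t t_in
      by (auto simp: col_def simp del: atLeastAtMost_iff)
    define y' where "y' = \<pi> z1"
    have ne: "z1 \<noteq> z0" using z1(2) r0 by auto
    then have ne': "y' \<noteq> y" unfolding y'_def z0(2)[symmetric] using permutes_inj[OF p] by (auto simp: inj_def)
    have y': "y' \<in> {1..n}" unfolding y'_def using z1 permutes_in_image[OF p] by blast
    have ry': "\<rho> y' = i" using eq[OF z1(1)] z1(2) ne' unfolding y'_def by simp
    define \<pi>' where "\<pi>' = transpose y y' \<circ> \<pi>"
    have \<tau>1: "\<tau> (y, \<pi>) = (y', \<pi>')" by (simp add: \<tau>_def \<pi>'_def y'_def z1_def z0_def)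
    have p': "\<pi>' permutes {1..n}" unfolding \<pi>'_def
      using p permutes_swap_id[OF y(1) y'] by (rule permutes_compose)
    have v0: "\<pi>' z0 = y'" and v1: "\<pi>' z1 = y" using z0(2) by (simp_all add: \<pi>'_def y'_def)
    have vz: "\<pi>' z = \<pi> z" if "z \<noteq> z0" "z \<noteq> z1" for z
    proof -
      have "\<pi> z \<noteq> y" "\<pi> z \<noteq> y'" using that z0(2) permutes_inj[OF p] unfolding y'_def by (auto simp: inj_def)
      then show ?thesis by (simp add: \<pi>'_def)
    qed
    have cy: "col y' = col y" using pc[OF z1(1)] pc[OF z0(1)] z1(3) z0(2) by (simp add: y'_def)
    have "\<pi>' \<in> C" unfolding col_stab
    proof (intro conjI ballI p')
      fix z assume z: "z \<in> {1..n}"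
      show "col (\<pi>' z) = col z"
        using v0 v1 vz[of z] pc[OF z] pc[OF z0(1)] pc[OF z1(1)] cy z0(2) by (cases "z = z0 \<or> z = z1") (auto simp: y'_def)
    qed
    moreover have "(\<rho>(y' := Suc i)) (\<pi>' z) = row z" if z: "z \<in> {1..n}" for z
    proof -
      consider "z = z0" | "z = z1" | "z \<noteq> z0" "z \<noteq> z1" by blast
      then show ?thesis
      proof cases
        case 3
        then have "\<pi> z \<noteq> y" "\<pi> z \<noteq> y'" using z0(2) permutes_inj[OF p] unfolding y'_def by (auto simp: inj_def)
        with eq[OF z] vz[OF 3] show ?thesis by simp
      qed (use v0 v1 r0 z1(2) y(2) ne' in auto)
    qed
    ultimately have P': "(y', \<pi>') \<in> P" unfolding P_def using y' ry' by blast
    have z0': "pinv \<pi>' y' = z0" using v0 permutes_inverses(2)[OF p'] by metis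
    have "\<tau> (y', \<pi>') = (y, transpose y' y \<circ> \<pi>')"
      unfolding \<tau>_def by (simp add: z0' z1_def[symmetric] v1)
    also have "transpose y' y \<circ> \<pi>' = \<pi>"
      by (simp add: \<pi>'_def comp_assoc[symmetric] transpose_commute[of y' y])
    finally have "\<tau> (\<tau> (y, \<pi>)) = (y, \<pi>)" by (simp add: \<tau>1)
    moreover have "sign \<pi>' = - sign \<pi>"
      unfolding \<pi>'_def using ne' p permutation_permutes
      by (subst sign_compose) (auto simp: permutation_swap_id sign_swap_id)
    ultimately show ?thesis using P' by (simp add: \<tau>1)
  qed
  have fin: "finite {y\<in>{1..n}. \<rho> y = i}" "\<And>y. finite {\<pi>\<in>C. \<forall>z\<in>{1..n}. (\<rho>(y := Suc i)) (\<pi> z) = row z}"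
    using finite_C by auto
  have "(\<Sum>y\<in>{y\<in>{1..n}. \<rho> y = i}. lk (polytabloid n \<mu> t) (tab (length \<mu>) n (\<rho>(y := Suc i)))) =
    (\<Sum>(y, \<pi>)\<in>P. of_int (sign \<pi>))"
    unfolding lookup_polytabloid P_def by (rule sum.Sigma) (use fin in auto)
  also have "\<dots> = (\<Sum>x\<in>P. of_int (sign (snd x)))" by (simp add: case_prod_beta)
  also have "\<dots> = 0"
  proof -
    let ?s = "\<lambda>x. of_int (sign (snd x)) :: rat"
    have "(\<Sum>x\<in>P. ?s x) = (\<Sum>x\<in>P. - ?s x)"
      by (rule sum.reindex_bij_witness[of _ \<tau> \<tau>]) (use key in \<open>force+\<close>)
    then show ?thesis by (simp add: sum_negf)
  qed
  finally show "(\<Sum>y\<in>{y\<in>{1..n}. \<rho> y = i}. lk (polytabloid n \<mu> t) (tab (length \<mu>) n (\<rho>(y := Suc i)))) = 0" .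
qed

text \<open>Among the column permutations of a column-strict filling, the identity is the only one that
  maximizes the pairing of rows and entries: a permutation with an inversion in some column can be improved by
  a transposition.\<close>

lemma row_pairing_max:
  assumes strict: "\<forall>y\<in>{1..n}. \<forall>z\<in>{1..n}. col y = col z \<longrightarrow> row y < row z \<longrightarrow> w y < w z"
    and \<pi>: "\<pi> \<in> C" "\<pi> \<noteq> id"
  shows "(\<Sum>y\<in>{1..n}. row y * w (\<pi> y)) < (\<Sum>y\<in>{1..n}. row y * (w y :: nat))"
proof -
  define W where "W = (\<lambda>\<pi>. \<Sum>y\<in>{1..n}. row y * w (\<pi> y))"
  have improve: "\<exists>\<pi>'\<in>C. W \<pi> < W \<pi>'" if \<pi>: "\<pi> \<in> C" "\<pi> \<noteq> id" for \<pi>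
  proof -
    have p: "\<pi> permutes {1..n}" and pc: "\<And>z. z \<in> {1..n} \<Longrightarrow> col (\<pi> z) = col z" using \<pi> by (auto simp: col_stab)
    define M where "M = {y\<in>{1..n}. \<pi> y \<noteq> y}"
    have "M \<noteq> {}" using \<pi>(2) permutes_not_in[OF p] unfolding M_def by fastforce
    \<comment> \<open>A moved letter of least row: its image \<open>y1\<close> and its preimage
      \<open>y2\<close> are moved letters of the same column and hence lie strictly lower. Composing
      with the transposition of \<open>y\<close> and \<open>y2\<close> fixes \<open>y\<close> and
      sends \<open>y2\<close> to \<open>y1\<close>, which by the rearrangement inequality increases
      the pairing.\<close>
    then obtain y where y: "y \<in> M" "\<And>z. z \<in> M \<Longrightarrow> row y \<le> row z"
      using arg_min_nat_lemma[of "\<lambda>y. y \<in> M" _ row] by blast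
    have yn: "y \<in> {1..n}" "\<pi> y \<noteq> y" using y(1) by (auto simp: M_def)
    define y1 where "y1 = \<pi> y"
    define y2 where "y2 = pinv \<pi> y"
    have y2: "\<pi> y2 = y" unfolding y2_def by (rule permutes_inverses(1)[OF p])
    have n1: "y1 \<in> {1..n}" unfolding y1_def using yn(1) permutes_in_image[OF p] by blast
    have n2: "y2 \<in> {1..n}" unfolding y2_def using yn(1) permutes_in_image[OF permutes_inv[OF p]] by blast
    have "\<pi> y1 \<noteq> y1" "y2 \<noteq> y" using yn(2) y2 permutes_inj[OF p] unfolding y1_def by (auto simp: inj_def)
    then have M: "y1 \<in> M" "y2 \<in> M" using n1 n2 y2 by (auto simp: M_def)
    have c: "col y1 = col y" "col y2 = col y" using pc[OF yn(1)] pc[OF n2] y2 by (auto simp: y1_def)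
    have r1: "row y < row y1" using y(2)[OF M(1)] row_col_inj[OF yn(1) n1] c yn(2) unfolding y1_def
      by (metis le_neq_implies_less)
    have r2: "row y < row y2" using y(2)[OF M(2)] row_col_inj[OF yn(1) n2] c \<open>y2 \<noteq> y\<close>
      by (metis le_neq_implies_less)
    define \<pi>' where "\<pi>' = \<pi> \<circ> transpose y y2"
    have "\<pi>' permutes {1..n}" unfolding \<pi>'_def using permutes_swap_id[OF yn(1) n2] p by (rule permutes_compose)
    moreover have "col (\<pi>' z) = col z" if "z \<in> {1..n}" for z
      using pc[OF that] pc[OF yn(1)] pc[OF n2] c by (cases "z = y \<or> z = y2") (auto simp: \<pi>'_def transpose_def)
    ultimately have C': "\<pi>' \<in> C" by (simp add: col_stab)
    have split: "W \<sigma> = row y * w (\<sigma> y) + (row y2 * w (\<sigma> y2) + (\<Sum>z\<in>{1..n} - {y} - {y2}. row z * w (\<sigma> z)))" for \<sigma>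
      unfolding W_def using yn(1) n2 \<open>y2 \<noteq> y\<close>
      by (subst sum.remove[of "{1..n}" y], simp, simp, subst sum.remove[of "{1..n} - {y}" y2]) auto
    have rest: "(\<Sum>z\<in>{1..n} - {y} - {y2}. row z * w (\<pi>' z)) = (\<Sum>z\<in>{1..n} - {y} - {y2}. row z * w (\<pi> z))"
      by (intro sum.cong refl) (auto simp: \<pi>'_def transpose_def)
    have w: "w y < w y1" using strict yn(1) n1 c r1 by (simp del: atLeastAtMost_iff)
    obtain d e where "row y2 = row y + Suc d" "w y1 = w y + Suc e"
      using r2 w by (metis less_iff_Suc_add add_Suc_right)
    then have "row y * w y1 + row y2 * w y < row y * w y + row y2 * w y1"
      by (simp add: algebra_simps)
    then have "W \<pi> < W \<pi>'" unfolding split rest by (simp add: \<pi>'_def y2 y1_def[symmetric])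
    with C' show ?thesis by blast
  qed
  have fin: "finite (W ` C)" using finite_C by simp
  have le: "W \<sigma> \<le> Max (W ` C)" if "\<sigma> \<in> C" for \<sigma> using fin that by simp
  obtain \<pi>m where m: "\<pi>m \<in> C" "W \<pi>m = Max (W ` C)" using Max_in[OF fin] id_in_C by fastforce
  with improve le have "\<pi>m = id" by (metis not_le)
  with improve[OF \<pi>] le m have "W \<pi> < W id" by (metis less_le_trans)
  then show ?thesis by (simp add: W_def)
qed

end

section \<open>Semistandard bases\<close>

text \<open>Back substitution. The element \<open>x\<close> added last has maximal weight, so no
  other \<open>a T\<close> has a nonzero coefficient at \<open>b x\<close>, and the coefficient of
  \<open>a x\<close> is determined first.\<close>

lemma triangular_solve:
  fixes a :: "'i \<Rightarrow> 'a \<Rightarrow>\<^sub>0 rat" and W :: "'i \<Rightarrow> nat"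
  assumes "finite J" "\<And>T. T \<in> J \<Longrightarrow> lk (a T) (b T) \<noteq> 0"
    "\<And>T T'. T \<in> J \<Longrightarrow> T' \<in> J \<Longrightarrow> T \<noteq> T' \<Longrightarrow> lk (a T) (b T') \<noteq> 0 \<Longrightarrow> W T' < W T"
  shows "\<exists>c. \<forall>T\<in>J. lk (v - (\<Sum>T\<in>J. scl (c T) (a T))) (b T) = 0"
  using assms
proof (induction J arbitrary: v rule: finite_ranking_induct[where f = W])
  case empty
  then show ?case by simp
next
  case (insert x S)
  define d where "d = lk v (b x) / lk (a x) (b x)"
  have IH: "\<exists>c. \<forall>T\<in>S. lk (v' - (\<Sum>T\<in>S. scl (c T) (a T))) (b T) = 0" for v'
    by (rule insert.IH) (use insert.prems in blast)+
  show ?case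
  proof (cases "x \<in> S")
    case True
    then show ?thesis using IH by (simp add: insert_absorb)
  next
    case False
    obtain c where c: "\<forall>T\<in>S. lk ((v - scl d (a x)) - (\<Sum>T\<in>S. scl (c T) (a T))) (b T) = 0" using IH by blast
    have "(\<Sum>T\<in>S. scl ((c(x := d)) T) (a T)) = (\<Sum>T\<in>S. scl (c T) (a T))"
      using False by (intro sum.cong refl) auto
    then have eq: "v - (\<Sum>T\<in>insert x S. scl ((c(x := d)) T) (a T)) = v - scl d (a x) - (\<Sum>T\<in>S. scl (c T) (a T))"
      using insert.hyps(1) False by (simp add: algebra_simps)
    have z: "lk (a T) (b x) = 0" if "T \<in> S" for T
      using insert.prems(2)[of T x] insert.hyps(2)[of T] that False by force
    have "lk (v - (\<Sum>T\<in>insert x S. scl ((c(x := d)) T) (a T))) (b T) = 0" if T: "T \<in> insert x S" for T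
    proof (cases "T = x")
      case True
      have "lk (\<Sum>T\<in>S. scl (c T) (a T)) (b x) = 0"
        unfolding lookup_sum by (intro sum.neutral) (simp add: z)
      then show ?thesis unfolding eq True using insert.prems(1)[of x] by (simp add: lookup_minus d_def)
    next
      case False
      with T c show ?thesis unfolding eq by blast
    qed
    then show ?thesis by blast
  qed
qed

lemma triangular_independent:
  fixes a :: "'i \<Rightarrow> 'a \<Rightarrow>\<^sub>0 rat" and W :: "'i \<Rightarrow> nat"
  assumes "finite J" "\<And>T. T \<in> J \<Longrightarrow> lk (a T) (b T) \<noteq> 0"
    "\<And>T T'. T \<in> J \<Longrightarrow> T' \<in> J \<Longrightarrow> T \<noteq> T' \<Longrightarrow> lk (a T) (b T') \<noteq> 0 \<Longrightarrow> W T' < W T"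
    and zero: "(\<Sum>T\<in>J. scl (c T) (a T)) = 0" and "T \<in> J"
  shows "c T = 0"
proof (rule ccontr)
  assume "c T \<noteq> 0"
  define K where "K = {T\<in>J. c T \<noteq> 0}"
  have K: "finite (W ` K)" "W ` K \<noteq> {}" using assms(1,5) \<open>c T \<noteq> 0\<close> by (auto simp: K_def)
  obtain x where x: "x \<in> K" "W x = Max (W ` K)" using Max_in[OF K] by fastforce
  have "lk (\<Sum>T\<in>J. scl (c T) (a T)) (b x) = (\<Sum>T\<in>J. c T * lk (a T) (b x))" by (simp add: lookup_sum)
  also have "\<dots> = (\<Sum>T\<in>{x}. c T * lk (a T) (b x))"
  proof (rule sum.mono_neutral_right[OF assms(1)])
    show "\<forall>T\<in>J - {x}. c T * lk (a T) (b x) = 0"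
    proof
      fix T assume T: "T \<in> J - {x}"
      show "c T * lk (a T) (b x) = 0"
      proof (cases "c T = 0")
        case False
        then have "W T \<le> W x" using T K(1) x(2) by (auto simp: K_def)
        with assms(3)[of T x] T x show ?thesis by (auto simp: K_def)
      qed simp
    qed
  qed (use x in \<open>auto simp: K_def\<close>)
  finally show False using zero x assms(2)[of x] by (auto simp: K_def)
qed

lemma lookup_stab_sum:
  "lk (stab_sum n w v) (tab l n \<rho>) = (\<Sum>\<sigma>\<in>stab n w. lk v (tab l n (\<rho> \<circ> \<sigma>)))"
  unfolding stab_sum_def lookup_sum by (intro sum.cong refl lookup_sact_tab) (simp add: stab_def)

lemma stab_sum_hw: "v \<in> hw n \<mu> \<Longrightarrow> stab_sum n w v \<in> hw n \<mu>"
  unfolding stab_sum_def by (intro PM.subspace_sum[OF subspace_hw] sact_hw) (auto simp: stab_def)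

context tableau begin

lemma pairing_stab:
  assumes "\<sigma> \<in> stab n w" "\<pi> \<in> C" "\<And>y. y \<in> {1..n} \<Longrightarrow> \<rho> (\<sigma> (\<pi> y)) = row y"
  shows "(\<Sum>y\<in>{1..n}. \<rho> y * w y) = (\<Sum>y\<in>{1..n}. row y * w (\<pi> y))"
proof -
  have p: "\<pi> permutes {1..n}" "\<sigma> permutes {1..n}" using assms by (auto simp: col_stab stab_def)
  have "(\<Sum>y\<in>{1..n}. \<rho> y * w y) = (\<Sum>y\<in>{1..n}. ((\<lambda>y. \<rho> y * w y) \<circ> (\<sigma> \<circ> \<pi>)) y)"
    using sum.permute[OF permutes_compose[OF p], of "\<lambda>y. \<rho> y * w y"] by (simp add: o_def)
  also have "\<dots> = (\<Sum>y\<in>{1..n}. row y * w (\<pi> y))"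
  proof (intro sum.cong refl)
    fix y assume y: "y \<in> {1..n}"
    then have "\<pi> y \<in> {1..n}" using permutes_in_image[OF p(1)] by blast
    with assms(1) have "w (\<sigma> (\<pi> y)) = w (\<pi> y)" unfolding stab_def by blast
    with assms(3)[OF y] show "((\<lambda>y. \<rho> y * w y) \<circ> (\<sigma> \<circ> \<pi>)) y = row y * w (\<pi> y)" by simp
  qed
  finally show ?thesis .
qed

text \<open>Such a tabloid arises from a column permutation followed by an element of the Young
  subgroup. The latter preserves the pairing of rows with \<open>w\<close>, the former lowers it
  unless it is the identity; in that case the tabloid lies in the orbit of the original one.\<close>

lemma stab_sum_lookup_less:
  assumes strict: "\<forall>y\<in>{1..n}. \<forall>z\<in>{1..n}. col y = col z \<longrightarrow> row y < row z \<longrightarrow> w y < w z"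
    and nz: "lk (stab_sum n w (polytabloid n \<mu> t)) (tab (length \<mu>) n \<rho>) \<noteq> 0"
  shows "(\<Sum>y\<in>{1..n}. \<rho> y * w y) < (\<Sum>y\<in>{1..n}. row y * w y) \<or> mat n w \<rho> = mat n w row"
proof -
  obtain \<sigma> where \<sigma>: "\<sigma> \<in> stab n w" "lk (polytabloid n \<mu> t) (tab (length \<mu>) n (\<rho> \<circ> \<sigma>)) \<noteq> 0"
    using nz unfolding lookup_stab_sum by (meson sum.not_neutral_contains_not_neutral)
  then obtain \<pi> where \<pi>: "\<pi> \<in> C" "\<And>y. y \<in> {1..n} \<Longrightarrow> \<rho> (\<sigma> (\<pi> y)) = row y"
    unfolding lookup_polytabloid by (auto elim!: sum.not_neutral_contains_not_neutral)
  show ?thesis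
  proof (cases "\<pi> = id")
    case True
    with mat_comp_stab[OF \<sigma>(1), of \<rho> row] \<pi>(2) show ?thesis by simp
  next
    case False
    with row_pairing_max[OF strict \<pi>(1)] pairing_stab[OF \<sigma>(1) \<pi>] show ?thesis by simp
  qed
qed

text \<open>No cancellation can occur: equality of the pairings leaves only the identity among the
  column permutations, so each summand is 0 or 1, and the identity of the Young subgroup contributes
  1.\<close>

lemma stab_sum_lookup_row:
  assumes strict: "\<forall>y\<in>{1..n}. \<forall>z\<in>{1..n}. col y = col z \<longrightarrow> row y < row z \<longrightarrow> w y < w z"
  shows "lk (stab_sum n w (polytabloid n \<mu> t)) (tab (length \<mu>) n row) \<noteq> 0"
proof -
  have val: "lk (polytabloid n \<mu> t) (tab (length \<mu>) n (row \<circ> \<sigma>)) = (if \<forall>y\<in>{1..n}. row (\<sigma> y) = row y then 1 else 0)"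
    if \<sigma>: "\<sigma> \<in> stab n w" for \<sigma>
  proof -
    have "{\<pi>\<in>C. \<forall>y\<in>{1..n}. (row \<circ> \<sigma>) (\<pi> y) = row y} = (if \<forall>y\<in>{1..n}. row (\<sigma> y) = row y then {id} else {})"
    proof -
      have "\<pi> = id" if "\<pi> \<in> C" "\<forall>y\<in>{1..n}. row (\<sigma> (\<pi> y)) = row y" for \<pi>
      proof (rule ccontr)
        assume "\<pi> \<noteq> id"
        from row_pairing_max[OF strict that(1) this] pairing_stab[OF \<sigma> that(1), of row] that(2)
        show False by simp
      qed
      then have "\<pi> \<in> {\<pi>\<in>C. \<forall>y\<in>{1..n}. (row \<circ> \<sigma>) (\<pi> y) = row y} \<longleftrightarrow> \<pi> = id \<and> (\<forall>y\<in>{1..n}. row (\<sigma> y) = row y)" for \<pi>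
        unfolding mem_Collect_eq o_apply using id_in_C by (metis id_apply)
      then show ?thesis by (intro Set.set_eqI, simp only: singleton_iff empty_iff split: if_split) blast
    qed
    then show ?thesis unfolding lookup_polytabloid by (simp add: sign_id)
  qed
  have "lk (stab_sum n w (polytabloid n \<mu> t)) (tab (length \<mu>) n row) =
    (\<Sum>\<sigma>\<in>stab n w. if \<forall>y\<in>{1..n}. row (\<sigma> y) = row y then 1 else 0)"
    unfolding lookup_stab_sum by (intro sum.cong refl val)
  also have "\<dots> > 0"
    by (rule sum_pos2[OF finite_stab id_in_stab]) auto
  finally show ?thesis by simp
qed

end

section \<open>Semistandard tableaux and semistandard matrices\<close>

lemma mono_card_le_iff:
  fixes g :: "nat \<Rightarrow> nat"
  assumes "\<And>j. Suc j < p \<Longrightarrow> g j \<le> g (Suc j)" "j < p"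
  shows "g j \<le> a \<longleftrightarrow> j < card {j'. j' < p \<and> g j' \<le> a}"
proof -
  have mono: "g i \<le> g k" if "i \<le> k" "k < p" for i k
    using that by (induction k rule: dec_induct) (auto intro: order_trans assms(1))
  let ?S = "{j'. j' < p \<and> g j' \<le> a}"
  have fin: "finite ?S" by simp
  show ?thesis
  proof
    assume "g j \<le> a"
    then have "{..j} \<subseteq> ?S" using mono assms(2) by (auto intro: order_trans)
    from card_mono[OF fin this] show "j < card ?S" by simp
  next
    assume *: "j < card ?S"
    show "g j \<le> a"
    proof (rule ccontr)
      assume "\<not> g j \<le> a"
      then have "?S \<subseteq> {..<j}" using mono by (auto simp: not_le[symmetric]) (meson not_le order_trans)
      from card_mono[OF _ this] * show False by simp
    qed
  qed
qed

lemma row_fibre_card: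
  assumes "i < length \<mu>"
  shows "card {c\<in>cells \<mu>. fst c = i \<and> T c = a} = card {j. j < \<mu> ! i \<and> T (i, j) = a}"
proof -
  have "{c\<in>cells \<mu>. fst c = i \<and> T c = a} = {c\<in>cells \<mu>. fst c = i \<and> T (i, snd c) = a}" by auto
  then show ?thesis using card_row_cells[OF assms, of "\<lambda>j. T (i, j) = a"] by simp
qed

text \<open>A weakly increasing row is determined by the number of occurrences of each value; hence
  a semistandard tableau is determined by its matrix (\<open>ssyt_eqI\<close>).\<close>

lemma ssyt_row_le_iff:
  assumes "T \<in> ssyt \<mu>" "(i, j) \<in> cells \<mu>"
  shows "T (i, j) \<le> a \<longleftrightarrow> j < (\<Sum>b\<le>a. card {c\<in>cells \<mu>. fst c = i \<and> T c = b})"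
proof -
  have ij: "i < length \<mu>" "j < \<mu> ! i" using assms(2) by (auto simp: cells_def)
  have "T (i, j) \<le> a \<longleftrightarrow> j < card {j'. j' < \<mu> ! i \<and> T (i, j') \<le> a}"
    by (rule mono_card_le_iff) (use assms ij in \<open>auto simp: ssyt_def cells_def\<close>)
  also have "card {j'. j' < \<mu> ! i \<and> T (i, j') \<le> a} = (\<Sum>b\<le>a. card {j'\<in>{j'. j' < \<mu> ! i \<and> T (i, j') \<le> a}. T (i, j') = b})"
    by (rule card_fibre_sum) auto
  also have "\<dots> = (\<Sum>b\<le>a. card {c\<in>cells \<mu>. fst c = i \<and> T c = b})"
    unfolding row_fibre_card[OF ij(1)] by (intro sum.cong refl arg_cong[of _ _ card]) auto
  finally show ?thesis .
qed

lemma ssyt_eqI: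
  assumes "T \<in> ssyt \<mu>" "T' \<in> ssyt \<mu>"
    "\<And>i a. card {c\<in>cells \<mu>. fst c = i \<and> T c = a} = card {c\<in>cells \<mu>. fst c = i \<and> T' c = a}"
  shows "T = T'"
proof
  fix c
  show "T c = T' c"
  proof (cases "c \<in> cells \<mu>")
    case True
    obtain i j where c: "c = (i, j)" by (cases c)
    have "T c \<le> a \<longleftrightarrow> T' c \<le> a" for a
      using ssyt_row_le_iff[OF assms(1) True[unfolded c]] ssyt_row_le_iff[OF assms(2) True[unfolded c]] assms(3) c
      by simp
    then show ?thesis by (meson order_antisym order_refl)
  next
    case False
    then show ?thesis using assms(1,2) by (cases c) (simp add: ssyt_def)
  qed
qed

lemma ssyt_col_less:
  assumes "\<mu> \<in> partitions n" "T \<in> ssyt \<mu>" "i < i'" "(i', j) \<in> cells \<mu>"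
  shows "T (i, j) < T (i', j)"
proof -
  have "(k, j) \<in> cells \<mu> \<and> T (i, j) \<le> T (k, j) \<and> (i < k \<longrightarrow> T (i, j) < T (k, j))" if "i \<le> k" "k \<le> i'" for k
    using that
  proof (induction k rule: dec_induct)
    case base
    then show ?case
      using partitionsD(3)[OF assms(1), of i i'] assms(3,4) by (auto simp: cells_def)
  next
    case (step k)
    have "(Suc k, j) \<in> cells \<mu>"
      using partitionsD(3)[OF assms(1), of "Suc k" i'] assms(4) step.prems by (auto simp: cells_def)
    then have "T (k, j) < T (Suc k, j)" using assms(2) by (simp add: ssyt_def)
    with step \<open>(Suc k, j) \<in> cells \<mu>\<close> show ?case by auto
  qed
  from this[of i'] assms(3) show ?thesis by simp
qed

text \<open>The converse passage from a matrix to a tableau. It ensures that vanishing at the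
  tabloids of semistandard tableaux is enough to apply \<open>hw_vanish\<close>.\<close>

lemma ssyt_of_semistandard_matrix:
  assumes part: "\<mu> \<in> partitions n" and w: "\<And>a. card {y\<in>{1..n}. w y = a} = lk m a"
    and N: "\<And>y. y \<in> {1..n} \<Longrightarrow> w y < N"
    and ss: "semistandard_matrix (length \<mu>) N (mat n w \<rho>)" and tab: "tab (length \<mu>) n \<rho> \<in> tabloids n \<mu>"
  obtains T where "T \<in> ssyt \<mu>" "content \<mu> T = m"
    "\<And>i a. card {c\<in>cells \<mu>. fst c = i \<and> T c = a} = mat n w \<rho> i a"
proof -
  define A where "A = mat n w \<rho>"
  define cum where "cum = (\<lambda>i a. \<Sum>b<a. A i b)"
  have range: "\<And>y. y \<in> {1..n} \<Longrightarrow> \<rho> y < length \<mu>" and rows: "\<And>i. i < length \<mu> \<Longrightarrow> card {y\<in>{1..n}. \<rho> y = i} = \<mu> ! i"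
    using tab unfolding tab_in_tabloids_iff[OF partitionsD(1)[OF part]] by blast+
  have cumN: "cum i N = \<mu> ! i" if "i < length \<mu>" for i
    using mat_row_sum[of n w N \<rho> i] N rows[OF that] by (simp add: cum_def A_def)
  have cum_mono: "cum i a \<le> cum i b" if "a \<le> b" for i a b
    unfolding cum_def using that by (intro sum_mono2) auto
  have A0: "A i a = 0" if "N \<le> a" for i a
  proof -
    have "{y\<in>{1..n}. \<rho> y = i \<and> w y = a} = {}" using N that by force
    then show ?thesis unfolding A_def mat_def by (metis card.empty)
  qed
  have cum_le: "cum i a \<le> \<mu> ! i" if "i < length \<mu>" for i a
  proof -
    have "cum i a \<le> cum i (max a N)" by (rule cum_mono) simp
    also have "\<dots> = cum i N" unfolding cum_def by (rule sum.mono_neutral_right) (auto simp: A0)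
    finally show ?thesis using cumN[OF that] by simp
  qed
  \<comment> \<open>Each row is filled in increasing order: \<open>cum i (Suc a)\<close> counts its
    entries up to \<open>a\<close>, so column \<open>j\<close> receives the first \<open>a\<close>
    at which this count exceeds \<open>j\<close>.\<close>
  define T where "T = (\<lambda>(i, j). if (i, j) \<in> cells \<mu> then LEAST a. j < cum i (Suc a) else 0)"
  have T_le: "T (i, j) \<le> a \<longleftrightarrow> j < cum i (Suc a)" if c: "(i, j) \<in> cells \<mu>" for i j a
  proof -
    have ij: "i < length \<mu>" "j < \<mu> ! i" using c by (auto simp: cells_def)
    have ex: "j < cum i (Suc N)" using cumN[OF ij(1)] ij(2) cum_mono[of N "Suc N" i] by simp
    have T: "T (i, j) = (LEAST a. j < cum i (Suc a))" using c by (simp add: T_def)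
    show ?thesis
    proof
      assume "T (i, j) \<le> a"
      moreover have "j < cum i (Suc (T (i, j)))" unfolding T by (rule LeastI, rule ex)
      ultimately show "j < cum i (Suc a)" using cum_mono[of "Suc (T (i, j))" "Suc a" i] by simp
    next
      assume "j < cum i (Suc a)"
      then show "T (i, j) \<le> a" unfolding T by (rule Least_le)
    qed
  qed
  have T_less: "T (i, j) < a \<longleftrightarrow> j < cum i a" if "(i, j) \<in> cells \<mu>" for i j a
    using T_le[OF that, of "a - 1"] by (cases a) (auto simp: cum_def)
  have "T \<in> ssyt \<mu>"
    unfolding ssyt_def
  proof (intro CollectI conjI allI impI)
    fix c assume "c \<notin> cells \<mu>" then show "T c = 0" by (cases c) (simp add: T_def)
  next
    fix i j assume c: "(i, Suc j) \<in> cells \<mu>"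
    then have c': "(i, j) \<in> cells \<mu>" by (auto simp: cells_def)
    have "Suc j < cum i (Suc (T (i, Suc j)))" using T_le[OF c] by blast
    then show "T (i, j) \<le> T (i, Suc j)" unfolding T_le[OF c'] by simp
  next
    fix i j assume c: "(Suc i, j) \<in> cells \<mu>"
    then have i: "Suc i < length \<mu>" "j < \<mu> ! Suc i" by (auto simp: cells_def)
    then have c': "(i, j) \<in> cells \<mu>" using partitionsD(3)[OF part, of i "Suc i"] by (auto simp: cells_def)
    define a where "a = T (Suc i, j)"
    have "a < N" unfolding a_def T_less[OF c] using cumN[OF i(1)] i(2) by simp
    have "j < cum (Suc i) (Suc a)" using T_le[OF c] unfolding a_def by blast
    \<comment> \<open>The semistandard inequality says that cell \<open>j\<close> of row
      \<open>i\<close> is already filled by entries below \<open>a\<close>, which is strictness in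
      the column.\<close>
    also have "cum (Suc i) (Suc a) \<le> cum i a"
      using ss i(1) \<open>a < N\<close> unfolding semistandard_matrix_def cum_def A_def lessThan_Suc_atMost by blast
    finally show "T (i, j) < T (Suc i, j)" unfolding T_less[OF c'] a_def[symmetric] .
  qed
  moreover have counts: "card {c\<in>cells \<mu>. fst c = i \<and> T c = a} = mat n w \<rho> i a" for i a
  proof (cases "i < length \<mu>")
    case True
    have "{j. j < \<mu> ! i \<and> T (i, j) = a} = {cum i a..<cum i (Suc a)}"
    proof (intro Set.set_eqI iffI)
      fix j assume "j \<in> {j. j < \<mu> ! i \<and> T (i, j) = a}"
      then have c: "(i, j) \<in> cells \<mu>" "T (i, j) = a" using True by (auto simp: cells_def)
      then show "j \<in> {cum i a..<cum i (Suc a)}" using T_le[OF c(1), of a] T_less[OF c(1), of a] by auto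
    next
      fix j assume j: "j \<in> {cum i a..<cum i (Suc a)}"
      then have "j < \<mu> ! i" using cum_le[OF True, of "Suc a"] by simp
      then have c: "(i, j) \<in> cells \<mu>" using True by (auto simp: cells_def)
      show "j \<in> {j. j < \<mu> ! i \<and> T (i, j) = a}"
        using T_le[OF c, of a] T_less[OF c, of a] j \<open>j < \<mu> ! i\<close> by auto
    qed
    then show ?thesis unfolding row_fibre_card[OF True] by (simp add: cum_def A_def)
  next
    case False
    have "{c\<in>cells \<mu>. fst c = i \<and> T c = a} = {}" using False by (auto simp: cells_def)
    moreover have "{y\<in>{1..n}. \<rho> y = i \<and> w y = a} = {}" using False range by blast
    ultimately show ?thesis unfolding mat_def by (metis card.empty)
  qed
  moreover have "content \<mu> T = m"
  proof (rule poly_mapping_eqI)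
    fix a
    have "card {c\<in>cells \<mu>. T c = a} = (\<Sum>i<length \<mu>. card {c\<in>{c\<in>cells \<mu>. T c = a}. fst c = i})"
      by (rule card_fibre_sum) (use finite_cells in \<open>auto simp: cells_def\<close>)
    also have "\<dots> = (\<Sum>i<length \<mu>. mat n w \<rho> i a)"
      unfolding counts[symmetric] by (intro sum.cong refl arg_cong[of _ _ card]) auto
    also have "\<dots> = (\<Sum>i<length \<mu>. card {y\<in>{y\<in>{1..n}. w y = a}. \<rho> y = i})"
      unfolding mat_def by (intro sum.cong refl arg_cong[of _ _ card]) auto
    also have "\<dots> = card {y\<in>{1..n}. w y = a}"
      by (rule card_fibre_sum[symmetric]) (use range in auto)
    finally show "lk (content \<mu> T) a = lk m a" by (simp only: lookup_content w)
  qed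
  ultimately show ?thesis by (intro that)
qed

abbreviation ssyt_with_content :: "nat list \<Rightarrow> (nat \<Rightarrow>\<^sub>0 nat) \<Rightarrow> (nat \<times> nat \<Rightarrow> nat) set" where
  "ssyt_with_content \<mu> m \<equiv> {T \<in> ssyt \<mu>. content \<mu> T = m}"

lemma finite_ssyt_with_content: "finite (ssyt_with_content \<mu> m)"
proof (rule finite_subset)
  show "finite {f. \<forall>x. (x \<in> cells \<mu> \<longrightarrow> f x \<in> ks m) \<and> (x \<notin> cells \<mu> \<longrightarrow> f x = 0)}"
    by (rule finite_set_of_finite_funs) (simp_all add: finite_cells)
  have "T c \<in> ks (content \<mu> T)" if "c \<in> cells \<mu>" for T c
  proof -
    have "c \<in> {c'\<in>cells \<mu>. T c' = T c}" using that by simp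
    then have "card {c'\<in>cells \<mu>. T c' = T c} \<noteq> 0"
      using finite_cells[of \<mu>] by (subst card_0_eq) (simp, blast)
    then show ?thesis by (simp add: in_keys_iff lookup_content)
  qed
  then show "ssyt_with_content \<mu> m \<subseteq> {f. \<forall>x. (x \<in> cells \<mu> \<longrightarrow> f x \<in> ks m) \<and> (x \<notin> cells \<mu> \<longrightarrow> f x = 0)}"
    by (auto simp: ssyt_def)
qed

abbreviation specht_space :: "nat \<Rightarrow> nat list \<Rightarrow> (nat set list \<Rightarrow>\<^sub>0 rat) set" where
  "specht_space n \<mu> \<equiv> PM.span (polytabloid n \<mu> ` {t. bij_betw t (cells \<mu>) {1..n}})"

text \<open>Triangularity with respect to the pairing \<open>W\<close> gives independence. For
  spanning, a combination is subtracted so that the remainder has coefficient 0 at every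
  semistandard tabloid; invariance spreads this over orbits and \<open>hw_vanish\<close> applies.
  The claim concerns \<open>hw\<close>, since its equality with the Specht module is a consequence.
  Coefficient families avoid assuming that different tableaux give different vectors.\<close>

theorem hw_invariants_basis:
  assumes part: "\<mu> \<in> partitions n" and w: "\<And>a. card {y\<in>{1..n}. w y = a} = lk m a"
  shows "\<exists>t. (\<forall>T\<in>ssyt_with_content \<mu> m. bij_betw (t T) (cells \<mu>) {1..n}) \<and>
    (\<forall>v\<in>hw n \<mu>. (\<forall>\<sigma>\<in>stab n w. sact \<sigma> v = v) \<longrightarrow>
      (\<exists>c. v = (\<Sum>T\<in>ssyt_with_content \<mu> m. scl (c T) (stab_sum n w (polytabloid n \<mu> (t T)))))) \<and>
    (\<forall>c. (\<Sum>T\<in>ssyt_with_content \<mu> m. scl (c T) (stab_sum n w (polytabloid n \<mu> (t T)))) = 0 \<longrightarrow>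
      (\<forall>T\<in>ssyt_with_content \<mu> m. c T = 0))"
proof -
  let ?J = "ssyt_with_content \<mu> m" and ?l = "length \<mu>"
  \<comment> \<open>\<open>T\<close> and \<open>w\<close> take each value equally often, so the
    cells can be numbered by letters that \<open>w\<close> sends to their entries.\<close>
  have "\<exists>t. bij_betw t (cells \<mu>) {1..n} \<and> (\<forall>c\<in>cells \<mu>. w (t c) = T c)" if "T \<in> ?J" for T
  proof -
    have "content \<mu> T = m" using that by simp
    then have "card {c\<in>cells \<mu>. T c = a} = card {y\<in>{1..n}. w y = a}" for a
      unfolding w using lookup_content[of \<mu> T a] by simp
    from bij_betw_fibres[OF finite_cells finite_atLeastAtMost this] show ?thesis by metis
  qed
  then have "\<exists>t. \<forall>T\<in>?J. bij_betw (t T) (cells \<mu>) {1..n} \<and> (\<forall>c\<in>cells \<mu>. w (t T c) = T c)"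
    by (intro bchoice ballI)
  then obtain t where t: "\<And>T. T \<in> ?J \<Longrightarrow> bij_betw (t T) (cells \<mu>) {1..n}"
    "\<And>T c. T \<in> ?J \<Longrightarrow> c \<in> cells \<mu> \<Longrightarrow> w (t T c) = T c" by blast
  have tb: "tableau n \<mu> (t T)" if "T \<in> ?J" for T
    using part t(1)[OF that] by unfold_locales
  define rw where "rw = (\<lambda>T. tableau.row \<mu> (t T))"
  define a where "a = (\<lambda>T. stab_sum n w (polytabloid n \<mu> (t T)))"
  define b where "b = (\<lambda>T. tab ?l n (rw T))"
  define W where "W = (\<lambda>T. \<Sum>y\<in>{1..n}. rw T y * w y)"
  have strict': "w y < w z" if T: "T \<in> ?J" and yz: "y \<in> {1..n}" "z \<in> {1..n}"
    "tableau.col \<mu> (t T) y = tableau.col \<mu> (t T) z" "tableau.row \<mu> (t T) y < tableau.row \<mu> (t T) z" for T y z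
  proof -
    interpret tableau n \<mu> "t T" by (rule tb[OF T])
    have "T (cell y) < T (cell z)"
      using ssyt_col_less[OF part _ yz(4)] T cell_in[OF yz(2)] yz(3) unfolding cell_eq[OF yz(1)] cell_eq[OF yz(2)]
      by simp
    then show ?thesis using t(2)[OF T] cell_in t_cell yz(1,2) by metis
  qed
  have strict: "\<forall>y\<in>{1..n}. \<forall>z\<in>{1..n}. tableau.col \<mu> (t T) y = tableau.col \<mu> (t T) z \<longrightarrow>
      tableau.row \<mu> (t T) y < tableau.row \<mu> (t T) z \<longrightarrow> w y < w z" if "T \<in> ?J" for T
    using strict'[OF that] by blast
  have matrow: "mat n w (rw T) i x = card {c\<in>cells \<mu>. fst c = i \<and> T c = x}" if T: "T \<in> ?J" for T i x
  proof -
    interpret tableau n \<mu> "t T" by (rule tb[OF T])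
    have "{y\<in>{1..n}. rw T y = i \<and> w y = x} = {y\<in>{1..n}. fst (cell y) = i \<and> T (cell y) = x}"
      using t(2)[OF T cell_in] t_cell by (auto simp: rw_def row_def simp del: atLeastAtMost_iff)
    then show ?thesis unfolding mat_def using card_filter[of "\<lambda>c. fst c = i \<and> T c = x"] by simp
  qed
  have diag: "lk (a T) (b T) \<noteq> 0" if "T \<in> ?J" for T
    unfolding a_def b_def rw_def
    by (rule tableau.stab_sum_lookup_row[OF tb[OF that]]) (rule strict[OF that])
  have tri: "W T' < W T" if "T \<in> ?J" "T' \<in> ?J" "T \<noteq> T'" "lk (a T) (b T') \<noteq> 0" for T T'
  proof -
    have "W T' < W T \<or> mat n w (rw T') = mat n w (rw T)"
      using tableau.stab_sum_lookup_less[OF tb[OF that(1)] strict[OF that(1)]] that(4)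
      unfolding a_def b_def W_def rw_def by blast
    moreover have "mat n w (rw T') \<noteq> mat n w (rw T)"
      using ssyt_eqI[of T \<mu> T'] that(1-3) matrow[OF that(1)] matrow[OF that(2)] by auto
    ultimately show ?thesis by blast
  qed
  have a_hw: "a T \<in> hw n \<mu>" if "T \<in> ?J" for T
    unfolding a_def using tableau.polytabloid_hw[OF tb[OF that]] by (rule stab_sum_hw)
  \<comment> \<open>A strict bound for the values of \<open>w\<close>; the inserted 0 keeps the
    maximum meaningful when \<open>m = 0\<close>.\<close>
  define N where "N = Suc (Max (insert 0 (ks m)))"
  have N: "w y < N" if "y \<in> {1..n}" for y
  proof -
    have "{z\<in>{1..n}. w z = w y} \<noteq> {}" using that by blast
    then have "lk m (w y) \<noteq> 0" unfolding w[symmetric] by (subst card_eq_0_iff) auto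
    then show ?thesis unfolding N_def less_Suc_eq_le by (intro Max_ge) (auto simp: in_keys_iff)
  qed
  have span: "\<exists>c. v = (\<Sum>T\<in>?J. scl (c T) (a T))" if v: "v \<in> hw n \<mu>" and inv: "\<And>\<sigma>. \<sigma> \<in> stab n w \<Longrightarrow> sact \<sigma> v = v" for v
  proof -
    have "\<exists>c. \<forall>T\<in>?J. lk (v - (\<Sum>T\<in>?J. scl (c T) (a T))) (b T) = 0"
      by (rule triangular_solve[of ?J a b W]) (fact finite_ssyt_with_content diag tri)+
    then obtain c where c: "\<forall>T\<in>?J. lk (v - (\<Sum>T\<in>?J. scl (c T) (a T))) (b T) = 0" by blast
    define u where "u = v - (\<Sum>T\<in>?J. scl (c T) (a T))"
    have u_hw: "u \<in> hw n \<mu>" unfolding u_def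
      by (intro PM.subspace_diff[OF subspace_hw] PM.subspace_sum[OF subspace_hw] PM.subspace_scale[OF subspace_hw] v a_hw)
    have u_inv: "sact \<sigma> u = u" if "\<sigma> \<in> stab n w" for \<sigma>
      unfolding u_def by (simp add: sact_diff sact_sum sact_scl inv that a_def sact_stab_sum)
    have "u = 0"
    proof (rule hw_vanish[OF u_hw _ partitionsD(1)[OF part]])
      show "\<And>\<sigma>. \<sigma> \<in> stab n w \<Longrightarrow> sact \<sigma> u = u" "\<And>y. y \<in> {1..n} \<Longrightarrow> w y < N" by fact+
    next
      fix \<rho> assume r: "semistandard_matrix ?l N (mat n w \<rho>)" "tab ?l n \<rho> \<in> tabloids n \<mu>"
      obtain T where T: "T \<in> ?J"
        "\<And>i x. card {c\<in>cells \<mu>. fst c = i \<and> T c = x} = mat n w \<rho> i x"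
        by (rule ssyt_of_semistandard_matrix[of \<mu> n w m N \<rho>]) (use part w N r in auto)
      then have "mat n w (rw T) = mat n w \<rho>" using matrow by (intro ext) simp
      from mat_eq_imp_stab[OF this] obtain \<sigma> where \<sigma>: "\<sigma> \<in> stab n w" "\<And>y. y \<in> {1..n} \<Longrightarrow> \<rho> (\<sigma> y) = rw T y" by metis
      have "lk u (tab ?l n \<rho>) = lk (sact \<sigma> u) (tab ?l n \<rho>)" using u_inv[OF \<sigma>(1)] by simp
      also have "\<dots> = lk u (tab ?l n (\<rho> \<circ> \<sigma>))" using \<sigma>(1) by (intro lookup_sact_tab) (simp add: stab_def)
      also have "tab ?l n (\<rho> \<circ> \<sigma>) = b T" unfolding b_def by (rule tab_cong) (use \<sigma>(2) in simp)
      also have "lk u (b T) = 0" using c T(1) by (simp add: u_def)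
      finally show "lk u (tab ?l n \<rho>) = 0" .
    qed
    then show ?thesis unfolding u_def by auto
  qed
  show ?thesis
  proof (intro exI[of _ t] conjI ballI allI impI)
    fix c T assume "(\<Sum>T\<in>?J. scl (c T) (stab_sum n w (polytabloid n \<mu> (t T)))) = 0" "T \<in> ?J"
    then have z: "(\<Sum>T\<in>?J. scl (c T) (a T)) = 0" "T \<in> ?J" by (simp_all add: a_def)
    show "c T = 0"
      by (rule triangular_independent[of ?J a b W c T]) (fact finite_ssyt_with_content diag tri z)+
  qed (use t(1) span in \<open>auto simp: a_def\<close>)
qed

text \<open>For \<open>w = id\<close> the Young subgroup is trivial: every highest weight vector is
  invariant and the symmetrized polytabloids are the polytabloids themselves, so
  \<open>hw_invariants_basis\<close> yields the hard inclusion.\<close>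

theorem specht_space_eq_hw:
  assumes part: "\<mu> \<in> partitions n" shows "specht_space n \<mu> = hw n \<mu>"
proof
  show "specht_space n \<mu> \<subseteq> hw n \<mu>"
  proof (rule PM.span_minimal[OF _ subspace_hw])
    show "polytabloid n \<mu> ` {t. bij_betw t (cells \<mu>) {1..n}} \<subseteq> hw n \<mu>"
      using tableau.polytabloid_hw[OF tableau.intro[OF part]] by blast
  qed
  define m where "m = (\<Sum>y\<in>{1..n}. sng y (1::nat))"
  have "card {y\<in>{1..n}. id y = a} = lk m a" for a
  proof -
    have "{y\<in>{1..n}. id y = a} = (if a \<in> {1..n} then {a} else {})" by auto
    moreover have "lk m a = (\<Sum>y\<in>{1..n}. if y = a then 1 else 0)"
      unfolding m_def lookup_sum by (intro sum.cong refl) (simp add: lookup_single when_def)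
    ultimately show ?thesis by simp
  qed
  from hw_invariants_basis[OF part this] obtain t where
    t: "\<forall>T\<in>ssyt_with_content \<mu> m. bij_betw (t T) (cells \<mu>) {1..n}"
    "\<forall>v\<in>hw n \<mu>. (\<forall>\<sigma>\<in>stab n id. sact \<sigma> v = v) \<longrightarrow>
      (\<exists>c. v = (\<Sum>T\<in>ssyt_with_content \<mu> m. scl (c T) (stab_sum n id (polytabloid n \<mu> (t T)))))"
    by (elim exE conjE) (rule that)
  have "stab_sum n id v = v" for v by (simp add: stab_sum_def stab_id_eq)
  show "hw n \<mu> \<subseteq> specht_space n \<mu>"
  proof
    fix v assume "v \<in> hw n \<mu>"
    moreover have "sact \<sigma> v = v" if "\<sigma> \<in> stab n id" for \<sigma> using that by (simp add: stab_id_eq)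
    ultimately obtain c where
      "v = (\<Sum>T\<in>ssyt_with_content \<mu> m. scl (c T) (stab_sum n id (polytabloid n \<mu> (t T))))" using t(2) by blast
    then have v: "v = (\<Sum>T\<in>ssyt_with_content \<mu> m. scl (c T) (polytabloid n \<mu> (t T)))"
      unfolding \<open>\<And>v. stab_sum n id v = v\<close> .
    show "v \<in> specht_space n \<mu>"
      unfolding v by (intro PM.span_sum PM.span_scale PM.span_base imageI CollectI) (use t(1) in blast)
  qed
qed

section \<open>Specht modules as quotients\<close>

definition stable :: "nat \<Rightarrow> (nat set list \<Rightarrow>\<^sub>0 rat) set \<Rightarrow> bool" where
  "stable n U \<longleftrightarrow> PM.subspace U \<and> (\<forall>\<pi>. \<pi> permutes {1..n} \<longrightarrow> (\<forall>v\<in>U. sact \<pi> v \<in> U))"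

definition equivariant :: "nat \<Rightarrow> (nat set list \<Rightarrow>\<^sub>0 rat) set \<Rightarrow>
    ((nat set list \<Rightarrow>\<^sub>0 rat) \<Rightarrow> (nat set list \<Rightarrow>\<^sub>0 rat)) \<Rightarrow> bool" where
  "equivariant n U f \<longleftrightarrow> (\<forall>x\<in>U. \<forall>y\<in>U. f (x + y) = f x + f y) \<and> (\<forall>c. \<forall>x\<in>U. f (scl c x) = scl c (f x)) \<and>
     (\<forall>\<pi>. \<pi> permutes {1..n} \<longrightarrow> (\<forall>x\<in>U. f (sact \<pi> x) = sact \<pi> (f x)))"

lemma stableD:
  assumes "stable n U"
  shows "PM.subspace U" "0 \<in> U" "x \<in> U \<Longrightarrow> y \<in> U \<Longrightarrow> x + y \<in> U" "x \<in> U \<Longrightarrow> y \<in> U \<Longrightarrow> x - y \<in> U"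
    "x \<in> U \<Longrightarrow> scl c x \<in> U" "\<pi> permutes {1..n} \<Longrightarrow> x \<in> U \<Longrightarrow> sact \<pi> x \<in> U"
  using assms PM.subspace_0 PM.subspace_add PM.subspace_diff PM.subspace_scale
  unfolding stable_def by auto

lemma stable_sum: "stable n U \<Longrightarrow> (\<And>a. a \<in> A \<Longrightarrow> f a \<in> U) \<Longrightarrow> sum f A \<in> U"
  by (rule PM.subspace_sum) (rule stableD(1))

lemma equivariantD:
  assumes "equivariant n U f"
  shows "x \<in> U \<Longrightarrow> y \<in> U \<Longrightarrow> f (x + y) = f x + f y" "x \<in> U \<Longrightarrow> f (scl c x) = scl c (f x)"
    "\<pi> permutes {1..n} \<Longrightarrow> x \<in> U \<Longrightarrow> f (sact \<pi> x) = sact \<pi> (f x)"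
  using assms unfolding equivariant_def by auto

lemma equivariant_diff:
  assumes "equivariant n U f" "stable n U" "x \<in> U" "y \<in> U"
  shows "f (x - y) = f x - f y"
  using equivariantD(1)[OF assms(1) stableD(4)[OF assms(2-4)] assms(4)] by simp

lemma equivariant_0: "equivariant n U f \<Longrightarrow> stable n U \<Longrightarrow> f 0 = 0"
  using equivariantD(2)[of n U f 0 0] stableD(2)[of n U] by simp

lemma stable_hw: "stable n (hw n \<mu>)"
  unfolding stable_def using subspace_hw sact_hw by blast

lemma stable_image:
  assumes "equivariant n U f" "stable n U" shows "stable n (f ` U)"
  unfolding stable_def
proof (intro conjI allI impI ballI PM.subspaceI)
  show "0 \<in> f ` U" using equivariant_0[OF assms] stableD(2)[OF assms(2)] by force
next
  fix x y assume "x \<in> f ` U" "y \<in> f ` U"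
  then obtain a b where "x = f a" "y = f b" "a \<in> U" "b \<in> U" by auto
  then show "x + y \<in> f ` U" using equivariantD(1)[OF assms(1)] stableD(3)[OF assms(2)] by (metis imageI)
next
  fix c x assume "x \<in> f ` U"
  then obtain a where "x = f a" "a \<in> U" by auto
  then show "scl c x \<in> f ` U" using equivariantD(2)[OF assms(1)] stableD(5)[OF assms(2)] by (metis imageI)
next
  fix \<pi> x assume "\<pi> permutes {1..n}" "x \<in> f ` U"
  then obtain a where "x = f a" "a \<in> U" by auto
  then show "sact \<pi> x \<in> f ` U"
    using equivariantD(3)[OF assms(1) \<open>\<pi> permutes _\<close>] stableD(6)[OF assms(2) \<open>\<pi> permutes _\<close>] by (metis imageI)
qed

lemma sum_by_fibres:
  fixes n :: nat
  assumes "\<And>y. y \<in> {1..n} \<Longrightarrow> \<rho> y < l"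
  shows "(\<Sum>y\<in>{1..n}. \<rho> y) = (\<Sum>i<l. i * card {y\<in>{1..n}. \<rho> y = i})"
proof -
  have "(\<Sum>y\<in>{1..n}. \<rho> y) = (\<Sum>i<l. \<Sum>y\<in>{y\<in>{1..n}. \<rho> y = i}. \<rho> y)"
    using assms by (intro sum.group[symmetric]) auto
  also have "\<dots> = (\<Sum>i<l. \<Sum>y\<in>{y\<in>{1..n}. \<rho> y = i}. i)" by (intro sum.cong refl) auto
  also have "\<dots> = (\<Sum>i<l. i * card {y\<in>{1..n}. \<rho> y = i})" by (simp add: mult.commute)
  finally show ?thesis .
qed

lemma tabloid_row_sum:
  assumes "0 \<notin> set \<mu>" "tab (length \<mu>) n \<rho> \<in> tabloids n \<mu>"
  shows "(\<Sum>y\<in>{1..n}. \<rho> y) = (\<Sum>i<length \<mu>. i * \<mu> ! i)"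
proof -
  have *: "\<And>y. y \<in> {1..n} \<Longrightarrow> \<rho> y < length \<mu>" "\<And>i. i < length \<mu> \<Longrightarrow> card {y\<in>{1..n}. \<rho> y = i} = \<mu> ! i"
    using assms(2) unfolding tab_in_tabloids_iff[OF assms(1)] by blast+
  have "(\<Sum>y\<in>{1..n}. \<rho> y) = (\<Sum>i<length \<mu>. i * card {y\<in>{1..n}. \<rho> y = i})"
    by (rule sum_by_fibres) (rule *(1))
  also have "\<dots> = (\<Sum>i<length \<mu>. i * \<mu> ! i)" by (intro sum.cong refl) (simp only: * lessThan_iff)
  finally show ?thesis .
qed

text \<open>There is only one semistandard tableau whose content is its shape, so the invariants in question are one-dimensional.\<close>

lemma hw_stab_one_dim:
  assumes part: "\<mu> \<in> partitions n" and w: "tab (length \<mu>) n w \<in> tabloids n \<mu>"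
    and v: "v \<in> hw n \<mu>" and inv: "\<And>\<sigma>. \<sigma> \<in> stab n w \<Longrightarrow> sact \<sigma> v = v"
    and zero: "lk v (tab (length \<mu>) n w) = 0"
  shows "v = 0"
proof (rule hw_vanish[OF v _ partitionsD(1)[OF part], where w = w and N = "length \<mu>"])
  let ?l = "length \<mu>"
  show "sact \<sigma> v = v" if "\<sigma> \<in> stab n w" for \<sigma> by (rule inv[OF that])
  show wl: "w y < ?l" if "y \<in> {1..n}" for y
    using w that unfolding tab_in_tabloids_iff[OF partitionsD(1)[OF part]] by blast
  fix \<rho> assume ss: "semistandard_matrix ?l ?l (mat n w \<rho>)" and \<rho>: "tab ?l n \<rho> \<in> tabloids n \<mu>"
  have \<rho>l: "\<rho> y < ?l" if "y \<in> {1..n}" for y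
    using \<rho> that unfolding tab_in_tabloids_iff[OF partitionsD(1)[OF part]] by blast
  \<comment> \<open>As in a semistandard tableau, row \<open>i\<close> has no entry below
    \<open>i\<close>. Hence \<open>\<rho> \<le> w\<close> at every letter, and since both have row
    lengths \<open>\<mu>\<close> their sums agree, so they coincide.\<close>
  have tri: "i < ?l \<Longrightarrow> a < i \<Longrightarrow> mat n w \<rho> i a = 0" for i a
  proof (induction i arbitrary: a)
    case (Suc i)
    have "mat n w \<rho> (Suc i) a \<le> (\<Sum>b\<le>a. mat n w \<rho> (Suc i) b)" by (rule member_le_sum) auto
    also have "\<dots> \<le> (\<Sum>b<a. mat n w \<rho> i b)"
      using ss Suc.prems unfolding semistandard_matrix_def by simp
    also have "\<dots> = 0" using Suc by (intro sum.neutral) auto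
    finally show ?case by simp
  qed simp
  have le: "\<rho> y \<le> w y" if y: "y \<in> {1..n}" for y
  proof (rule ccontr)
    assume "\<not> \<rho> y \<le> w y"
    then have "mat n w \<rho> (\<rho> y) (w y) = 0" using tri \<rho>l[OF y] by simp
    then have "{z\<in>{1..n}. \<rho> z = \<rho> y \<and> w z = w y} = {}" unfolding mat_def by (subst (asm) card_eq_0_iff) auto
    with y show False by blast
  qed
  have "\<rho> y = w y" if "y \<in> {1..n}" for y
    by (rule sum_mono_inv[OF _ le that])
      (simp_all only: tabloid_row_sum[OF partitionsD(1)[OF part] \<rho>] tabloid_row_sum[OF partitionsD(1)[OF part] w] finite_atLeastAtMost)
  then have "tab ?l n \<rho> = tab ?l n w" by (rule tab_cong)
  with zero show "lk v (tab ?l n \<rho>) = 0" by simp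
qed

lemma stab_fix_tab:
  assumes "\<sigma> \<in> stab n w" shows "tab l n (w \<circ> \<sigma>) = tab l n w"
  by (rule tab_cong) (use assms in \<open>auto simp: stab_def\<close>)

lemma lookup_stab_sum_self:
  "lk (stab_sum n w v) (tab l n w) = of_nat (card (stab n w)) * lk v (tab l n w)"
  by (simp add: lookup_stab_sum stab_fix_tab)

lemma tabloids_transitive:
  assumes "0 \<notin> set \<mu>" "tab (length \<mu>) n w \<in> tabloids n \<mu>" "B \<in> tabloids n \<mu>"
  obtains \<sigma> where "\<sigma> permutes {1..n}" "B = permute_blocks \<sigma> (tab (length \<mu>) n w)"
proof -
  obtain \<rho> where B: "B = tab (length \<mu>) n \<rho>" using tabloids_tab[OF assms(3)] .
  have *: "(\<forall>y\<in>{1..n}. w y < length \<mu>) \<and> (\<forall>i<length \<mu>. card {y\<in>{1..n}. w y = i} = \<mu> ! i)"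
    "(\<forall>y\<in>{1..n}. \<rho> y < length \<mu>) \<and> (\<forall>i<length \<mu>. card {y\<in>{1..n}. \<rho> y = i} = \<mu> ! i)"
    using assms(2,3) unfolding B tab_in_tabloids_iff[OF assms(1)] by blast+
  \<comment> \<open>With the constant function the stabilizer is the full symmetric group and the
    matrix records just the row lengths.\<close>
  have "mat n (\<lambda>_. 0) w = mat n (\<lambda>_. 0) \<rho>"
  proof (intro ext)
    fix i a
    have "card {y\<in>{1..n}. w y = i} = card {y\<in>{1..n}. \<rho> y = i}"
    proof (cases "i < length \<mu>")
      case False
      then have "{y\<in>{1..n}. w y = i} = {}" "{y\<in>{1..n}. \<rho> y = i} = {}" using * by blast+
      then show ?thesis by (simp only:)
    qed (use * in simp)
    then show "mat n (\<lambda>_. 0) w i a = mat n (\<lambda>_. 0) \<rho> i a" by (cases "a = 0") (simp_all add: mat_def)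
  qed
  from mat_eq_imp_stab[OF this] obtain \<sigma> where
    \<sigma>: "\<sigma> \<in> stab n (\<lambda>_. 0)" "\<And>y. y \<in> {1..n} \<Longrightarrow> \<rho> (\<sigma> y) = w y" by metis
  then have p: "\<sigma> permutes {1..n}" by (simp add: stab_def)
  have "B = permute_blocks \<sigma> (tab (length \<mu>) n w)"
    unfolding B permute_blocks_tab[OF p]
  proof (rule tab_cong)
    fix y assume "y \<in> {1..n}"
    then have "pinv \<sigma> y \<in> {1..n}" using permutes_in_image[OF permutes_inv[OF p]] by blast
    from \<sigma>(2)[OF this] show "\<rho> y = (w \<circ> pinv \<sigma>) y" by (simp add: permutes_inverses[OF p])
  qed
  with p that show ?thesis by blast
qed

text \<open>Irreducibility in the form required. Let \<open>s'\<close> be the part of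
  \<open>s\<close> orthogonal to \<open>Y\<close>. Symmetrizing any translate of \<open>s'\<close>
  gives a multiple of \<open>z\<close>, by one-dimensionality, which is also orthogonal to
  \<open>z\<close> and so is 0. Thus every translate has coefficient 0 at one tabloid, and by
  transitivity \<open>s' = 0\<close>.\<close>

lemma hw_submodule_full:
  assumes part: "\<mu> \<in> partitions n" and w: "tab (length \<mu>) n w \<in> tabloids n \<mu>"
    and Y: "stable n Y" "Y \<subseteq> hw n \<mu>"
    and z: "z \<in> Y" "\<And>\<sigma>. \<sigma> \<in> stab n w \<Longrightarrow> sact \<sigma> z = z" "lk z (tab (length \<mu>) n w) \<noteq> 0"
  shows "Y = hw n \<mu>"
proof (rule subset_antisym[OF Y(2)], rule subsetI)
  fix s assume s: "s \<in> hw n \<mu>"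
  let ?b = "tab (length \<mu>) n w"
  have "Y \<subseteq> {f. ks f \<subseteq> tabloids n \<mu>}" using Y(2) by (auto simp: hw_def)
  from orth_proj[OF stableD(1)[OF Y(1)] finite_tabloids this] obtain y where
    y: "y \<in> Y" "\<And>t. t \<in> Y \<Longrightarrow> ip (s - y) t = 0" by metis
  define s' where "s' = s - y"
  have s': "s' \<in> hw n \<mu>" unfolding s'_def using s y(1) Y(2) by (intro stableD(4)[OF stable_hw]) auto
  have orth: "ip (sact \<tau> s') t = 0" if "\<tau> permutes {1..n}" "t \<in> Y" for \<tau> t
    unfolding ip_sact_left[OF that(1)] s'_def
    by (rule y(2)) (rule stableD(6)[OF Y(1) permutes_inv[OF that(1)] that(2)])
  have "lk (sact \<tau> s') ?b = 0" if \<tau>: "\<tau> permutes {1..n}" for \<tau>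
  proof -
    define a where "a = stab_sum n w (sact \<tau> s')"
    define k where "k = lk a ?b / lk z ?b"
    have "a \<in> hw n \<mu>" unfolding a_def by (intro stab_sum_hw sact_hw \<tau> s')
    have "a - scl k z = 0"
    proof (rule hw_stab_one_dim[OF part w])
      show "a - scl k z \<in> hw n \<mu>"
        using \<open>a \<in> hw n \<mu>\<close> z(1) Y(2) by (intro stableD(4)[OF stable_hw] stableD(5)[OF stable_hw]) auto
      show "sact \<sigma> (a - scl k z) = a - scl k z" if "\<sigma> \<in> stab n w" for \<sigma>
        by (simp add: sact_diff sact_scl z(2)[OF that] a_def sact_stab_sum[OF that])
      show "lk (a - scl k z) ?b = 0" using z(3) by (simp add: lookup_minus k_def)
    qed
    then have a: "a = scl k z" by simp
    have "ip a z = 0"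
      unfolding a_def stab_sum_def ip_sum_left sact_sact
      by (intro sum.neutral ballI orth z(1) permutes_compose \<tau>) (simp add: stab_def)
    then have "k = 0" using z(3) unfolding a ip_scl_left by auto
    then have "lk a ?b = 0" by (simp add: a)
    moreover have "stab n w \<noteq> {}" using id_in_stab by blast
    ultimately show ?thesis unfolding a_def lookup_stab_sum_self by (simp add: card_eq_0_iff finite_stab)
  qed
  then have van: "lk s' (permute_blocks (pinv \<tau>) ?b) = 0" if "\<tau> permutes {1..n}" for \<tau>
    using that lookup_sact_permute[OF permutes_inv[OF that], of "sact \<tau> s'" ?b] by (simp add: sact_inv)
  have "s' = 0"
  proof (rule poly_mapping_eqI)
    fix B show "lk s' B = lk 0 B"
    proof (cases "B \<in> tabloids n \<mu>")
      case True
      obtain \<sigma> where \<sigma>: "\<sigma> permutes {1..n}" "B = permute_blocks \<sigma> ?b"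
        using tabloids_transitive[OF partitionsD(1)[OF part] w True] .
      show ?thesis using van[OF permutes_inv[OF \<sigma>(1)]] unfolding \<sigma>(2) by (simp add: permutes_inv_inv[OF \<sigma>(1)])
    next
      case False
      then show ?thesis using s' by (auto simp: hw_def in_keys_iff)
    qed
  qed
  with y(1) show "s \<in> Y" by (simp add: s'_def)
qed

text \<open>Choose a row function with the least sum of row indices whose stabilizer fixes a nonzero vector \<open>u\<close>
  of \<open>U\<close>. Minimality makes the row lengths a partition \<open>\<mu>\<close>, and the adjoint of the map
  from the permutation module to \<open>U\<close> given by \<open>u\<close> takes values in the highest weight vectors.\<close>

lemma ex_specht_quotient:
  assumes U: "stable n U" and "x0 \<in> U" "x0 \<noteq> 0"
  obtains \<mu> \<psi> u where "\<mu> \<in> partitions n" "equivariant n U \<psi>" "\<psi> ` U = hw n \<mu>" "u \<in> U" "\<psi> u \<noteq> 0"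
proof -
  define P where "P = (\<lambda>\<rho>. \<exists>u\<in>U. u \<noteq> 0 \<and> (\<forall>\<sigma>\<in>stab n \<rho>. sact \<sigma> u = u))"
  define h where "h = (\<lambda>\<rho>. \<Sum>y\<in>{1..n}. \<rho> y :: nat)"
  have "P id" unfolding P_def stab_id_eq using assms by (intro bexI[of _ x0]) auto
  then obtain \<rho> where \<rho>: "P \<rho>" "\<And>\<rho>'. P \<rho>' \<Longrightarrow> h \<rho> \<le> h \<rho>'"
    using arg_min_nat_lemma[of P id h] by blast
  then obtain u where u: "u \<in> U" "u \<noteq> 0" "\<And>\<sigma>. \<sigma> \<in> stab n \<rho> \<Longrightarrow> sact \<sigma> u = u" unfolding P_def by blast
  define cf where "cf = (\<lambda>i. card {y\<in>{1..n}. \<rho> y = i})"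
  have anti_step: "cf (Suc i) \<le> cf i" for i
  proof -
    \<comment> \<open>Exchanging two adjacent rows keeps the stabilizer and changes the sum of row
      indices by \<open>cf i - cf (Suc i)\<close>, so minimality forces the row lengths to decrease
      weakly.\<close>
    define \<rho>' where "\<rho>' = transpose i (Suc i) \<circ> \<rho>"
    have "stab n \<rho>' = stab n \<rho>"
      unfolding stab_def \<rho>'_def o_apply by (simp add: inj_eq)
    then have "h \<rho> \<le> h \<rho>'" using \<rho> unfolding P_def by metis
    moreover have "h \<rho>' + cf (Suc i) = h \<rho> + cf i"
    proof -
      have c: "cf j = (\<Sum>y\<in>{1..n}. if \<rho> y = j then 1 else 0)" for j
        unfolding cf_def by (simp only: card_eq_sum sum.inter_filter[OF finite_atLeastAtMost])
      show ?thesis unfolding h_def c sum.distrib[symmetric]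
        by (intro sum.cong refl) (auto simp: \<rho>'_def transpose_def)
    qed
    ultimately show ?thesis by simp
  qed
  have anti: "i \<le> j \<Longrightarrow> cf j \<le> cf i" for i j
    by (rule lift_Suc_antimono_le[of cf, OF anti_step])
  have "\<exists>i. cf i = 0"
  proof
    have "{y\<in>{1..n}. \<rho> y = Suc (Max (\<rho> ` {1..n}))} = {}" using Max_ge[of "\<rho> ` {1..n}"] by fastforce
    then show "cf (Suc (Max (\<rho> ` {1..n}))) = 0" unfolding cf_def by (metis card.empty)
  qed
  define l where "l = (LEAST i. cf i = 0)"
  have l0: "cf l = 0" unfolding l_def using \<open>\<exists>i. cf i = 0\<close> by (rule LeastI_ex)
  have cf_pos: "cf i \<noteq> 0 \<longleftrightarrow> i < l" for i
    using anti[of l i] l0 not_less_Least[of i "\<lambda>i. cf i = 0"] unfolding l_def[symmetric] by (metis le_zero_eq not_le)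
  define \<mu> where "\<mu> = map cf [0..<l]"
  have len: "length \<mu> = l" and nth: "\<And>i. i < l \<Longrightarrow> \<mu> ! i = cf i" by (simp_all add: \<mu>_def)
  have rl: "\<rho> y < l" if "y \<in> {1..n}" for y
  proof -
    have "{z\<in>{1..n}. \<rho> z = \<rho> y} \<noteq> {}" using that by blast
    then have "cf (\<rho> y) \<noteq> 0" unfolding cf_def by (subst card_eq_0_iff) auto
    then show ?thesis by (simp only: cf_pos)
  qed
  have pos: "0 \<notin> set \<mu>"
  proof
    assume "0 \<in> set \<mu>"
    then obtain i where "i < l" "cf i = 0" unfolding \<mu>_def by fastforce
    with cf_pos[of i] show False by simp
  qed
  have part: "\<mu> \<in> partitions n"
    unfolding partitions_def
  proof (intro CollectI conjI pos)
    show "sorted_wrt (\<ge>) \<mu>" unfolding sorted_wrt_iff_nth_less len using nth anti by simp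
    have "card {1..n} = (\<Sum>i<l. card {y\<in>{1..n}. \<rho> y = i})"
      by (rule card_fibre_sum) (use rl in auto)
    then show "sum_list \<mu> = n" by (simp add: \<mu>_def interv_sum_list_conv_sum_set_nat atLeast0LessThan cf_def)
  qed
  define b where "b = tab (length \<mu>) n \<rho>"
  have b: "b \<in> tabloids n \<mu>"
    unfolding b_def tab_in_tabloids_iff[OF pos] using rl nth by (auto simp: len cf_def)
  have same: "sact \<sigma> u = sact \<tau> u"
    if \<sigma>: "\<sigma> permutes {1..n}" and \<tau>: "\<tau> permutes {1..n}" and eq: "permute_blocks \<sigma> b = permute_blocks \<tau> b" for \<sigma> \<tau>
  proof -
    define \<kappa> where "\<kappa> = pinv \<tau> \<circ> \<sigma>"
    have \<kappa>: "\<kappa> permutes {1..n}" unfolding \<kappa>_def by (intro permutes_compose permutes_inv \<sigma> \<tau>)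
    have "permute_blocks (pinv \<kappa>) (permute_blocks \<kappa> b) = b" using \<kappa> by (simp add: permute_blocks_comp permutes_inv_o)
    moreover have "permute_blocks \<kappa> b = b"
      unfolding \<kappa>_def permute_blocks_comp[symmetric] eq
      using \<tau> by (simp add: permute_blocks_comp permutes_inv_o)
    ultimately have "permute_blocks (pinv \<kappa>) b = b" by simp
    then have "tab (length \<mu>) n (\<rho> \<circ> \<kappa>) = tab (length \<mu>) n \<rho>"
      unfolding b_def permute_blocks_tab[OF permutes_inv[OF \<kappa>]] by (simp add: permutes_inv_inv[OF \<kappa>])
    from tab_eqD[OF this[symmetric]] rl len have "\<kappa> \<in> stab n \<rho>" using \<kappa> by (simp add: stab_def)
    then have "sact \<kappa> u = u" by (rule u(3))
    then have "sact \<tau> (sact \<kappa> u) = sact \<tau> u" by simp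
    then show ?thesis unfolding \<kappa>_def sact_sact using \<tau> by (simp add: comp_assoc[symmetric] permutes_inv_o)
  qed
  define sel where "sel = (\<lambda>B. SOME \<sigma>. \<sigma> permutes {1..n} \<and> B = permute_blocks \<sigma> b)"
  \<comment> \<open>The equivariant extension of \<open>b \<mapsto> u\<close> to all tabloids. It
    does not depend on the permutation chosen by \<open>sel\<close>, because the stabilizer of
    \<open>b\<close> fixes \<open>u\<close>.\<close>
  define us where "us = (\<lambda>B. if B \<in> tabloids n \<mu> then sact (sel B) u else 0)"
  have sel: "sel B permutes {1..n} \<and> B = permute_blocks (sel B) b" if "B \<in> tabloids n \<mu>" for B
  proof -
    have "\<exists>\<sigma>. \<sigma> permutes {1..n} \<and> B = permute_blocks \<sigma> b"
      using tabloids_transitive[OF pos b[unfolded b_def] that] unfolding b_def by metis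
    then show ?thesis unfolding sel_def by (rule someI_ex)
  qed
  have us: "us (permute_blocks \<sigma> b) = sact \<sigma> u" if "\<sigma> permutes {1..n}" for \<sigma>
  proof -
    have "permute_blocks \<sigma> b \<in> tabloids n \<mu>" by (rule permute_blocks_tabloids[OF that b])
    with same[OF _ that] sel[OF this] show ?thesis unfolding us_def by metis
  qed
  have us_sact: "us (permute_blocks \<tau> B) = sact \<tau> (us B)" if \<tau>: "\<tau> permutes {1..n}" for \<tau> B
  proof (cases "B \<in> tabloids n \<mu>")
    case True
    obtain \<sigma> where \<sigma>: "\<sigma> permutes {1..n}" "B = permute_blocks \<sigma> b" using sel[OF True] by blast
    show ?thesis unfolding \<sigma>(2) permute_blocks_comp us[OF permutes_compose[OF \<sigma>(1) \<tau>]] us[OF \<sigma>(1)] sact_sact ..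
  next
    case False
    have "permute_blocks \<tau> B \<notin> tabloids n \<mu>"
    proof
      assume "permute_blocks \<tau> B \<in> tabloids n \<mu>"
      from permute_blocks_tabloids[OF permutes_inv[OF \<tau>] this] False show False
        using \<tau> by (simp add: permute_blocks_comp permutes_inv_o)
    qed
    with False show ?thesis by (simp add: us_def)
  qed
  have us_U: "us B \<in> U" for B
    unfolding us_def using sel stableD(2,6)[OF U] u(1) by auto
  \<comment> \<open>The adjoint of the linear map that sends each tabloid \<open>B\<close> to
    \<open>us B\<close>.\<close>
  define \<psi> where "\<psi> = (\<lambda>x. \<Sum>B\<in>tabloids n \<mu>. sng B (ip x (us B)))"
  have lk\<psi>: "lk (\<psi> x) B = ip x (us B)" for x B
  proof -
    have "lk (\<psi> x) B = (\<Sum>B'\<in>tabloids n \<mu>. if B' = B then ip x (us B') else 0)"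
      unfolding \<psi>_def lookup_sum by (intro sum.cong refl) (simp add: lookup_single when_def)
    also have "\<dots> = ip x (us B)" using finite_tabloids[of n \<mu>] by (simp add: us_def)
    finally show ?thesis .
  qed
  have eqv: "equivariant n U \<psi>"
    unfolding equivariant_def
  proof (intro conjI ballI allI impI; rule poly_mapping_eqI)
    fix \<pi> x B assume \<pi>: "\<pi> permutes {1..n}"
    have "lk (sact \<pi> (\<psi> x)) (permute_blocks \<pi> (permute_blocks (pinv \<pi>) B)) = lk (\<psi> x) (permute_blocks (pinv \<pi>) B)"
      by (rule lookup_sact_permute[OF \<pi>])
    then show "lk (\<psi> (sact \<pi> x)) B = lk (sact \<pi> (\<psi> x)) B"
      using \<pi> us_sact[OF permutes_inv[OF \<pi>]] by (simp add: permute_blocks_comp permutes_inv_o lk\<psi> ip_sact_left[OF \<pi>])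
  qed (simp_all add: lk\<psi> lookup_add ip_add_left ip_scl_left)
  have \<psi>_hw: "\<psi> x \<in> hw n \<mu>" for x
    unfolding hw_def
  proof (intro CollectI conjI allI impI)
    show "ks (\<psi> x) \<subseteq> tabloids n \<mu>" by (auto simp: in_keys_iff lk\<psi> us_def split: if_splits)
  next
    fix i \<theta> assume i: "Suc i < length \<mu>"
    define Y where "Y = {y\<in>{1..n}. \<theta> y = i}"
    \<comment> \<open>Pairing \<open>x\<close> with \<open>u'\<close> gives the left side of the
      highest weight equation. The vector \<open>u'\<close> lies in \<open>U\<close> and is fixed by
      the stabilizer of \<open>\<theta>\<close>, whose row sum is one less than the minimum unless
      all summands are 0 anyway; hence \<open>u' = 0\<close>.\<close>
    define u' where "u' = (\<Sum>y\<in>Y. us (tab (length \<mu>) n (\<theta>(y := Suc i))))"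
    have "u' = 0"
    proof (cases "\<exists>y\<in>Y. tab (length \<mu>) n (\<theta>(y := Suc i)) \<in> tabloids n \<mu>")
      case True
      then obtain y where y: "y \<in> Y" "tab (length \<mu>) n (\<theta>(y := Suc i)) \<in> tabloids n \<mu>" by blast
      then have yn: "y \<in> {1..n}" "\<theta> y = i" by (auto simp: Y_def)
      have "h \<rho> = h (\<theta>(y := Suc i))"
        unfolding h_def tabloid_row_sum[OF pos y(2)] tabloid_row_sum[OF pos b[unfolded b_def]] ..
      also have "\<dots> = Suc (h \<theta>)"
      proof -
        have "sum (\<theta>(y := Suc i)) {1..n} = (\<theta>(y := Suc i)) y + sum (\<theta>(y := Suc i)) ({1..n} - {y})"
          "sum \<theta> {1..n} = \<theta> y + sum \<theta> ({1..n} - {y})" by (intro sum.remove finite_atLeastAtMost yn)+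
        moreover have "sum (\<theta>(y := Suc i)) ({1..n} - {y}) = sum \<theta> ({1..n} - {y})"
          by (rule sum.cong) auto
        ultimately show ?thesis unfolding h_def using yn(2) by simp
      qed
      finally have "\<not> P \<theta>" using \<rho>(2) by fastforce
      moreover have "u' \<in> U" unfolding u'_def by (intro stable_sum[OF U] us_U)
      moreover have "sact \<tau> u' = u'" if \<tau>: "\<tau> \<in> stab n \<theta>" for \<tau>
      proof -
        have p: "\<tau> permutes {1..n}" and fx: "\<And>y. y \<in> {1..n} \<Longrightarrow> \<theta> (\<tau> y) = \<theta> y" using \<tau> by (auto simp: stab_def)
        have pfx: "\<theta> (pinv \<tau> y) = \<theta> y" if "y \<in> {1..n}" for y
          using stab_inv[OF \<tau>] that unfolding stab_def by blast
        have "sact \<tau> u' = (\<Sum>y\<in>Y. us (tab (length \<mu>) n (\<theta>(y := Suc i) \<circ> pinv \<tau>)))"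
          unfolding u'_def sact_sum us_sact[OF p, symmetric] permute_blocks_tab[OF p] ..
        also have "\<dots> = u'" unfolding u'_def
        proof (rule sum.reindex_bij_witness[of _ "pinv \<tau>" \<tau>])
          fix y assume "y \<in> Y"
          then have yn: "y \<in> {1..n}" "\<theta> y = i" by (auto simp: Y_def)
          then show "pinv \<tau> (\<tau> y) = y" "\<tau> (pinv \<tau> y) = y" by (simp_all add: permutes_inverses[OF p])
          show "\<tau> y \<in> Y" "pinv \<tau> y \<in> Y" using fx[OF yn(1)] pfx[OF yn(1)] yn
              permutes_in_image[OF p, of y] permutes_in_image[OF permutes_inv[OF p], of y] unfolding Y_def by auto
          have "tab (length \<mu>) n (\<theta>(\<tau> y := Suc i)) = tab (length \<mu>) n (\<theta>(y := Suc i) \<circ> pinv \<tau>)"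
          proof (rule tab_cong)
            fix z assume z: "z \<in> {1..n}"
            have "pinv \<tau> z = y \<longleftrightarrow> z = \<tau> y" using permutes_inverses[OF p] by metis
            with pfx[OF z] show "(\<theta>(\<tau> y := Suc i)) z = (\<theta>(y := Suc i) \<circ> pinv \<tau>) z" by simp
          qed
          then show "us (tab (length \<mu>) n (\<theta>(\<tau> y := Suc i))) = us (tab (length \<mu>) n (\<theta>(y := Suc i) \<circ> pinv \<tau>))"
            by simp
        qed
        finally show ?thesis .
      qed
      ultimately show ?thesis unfolding P_def by blast
    next
      case False
      then show ?thesis unfolding u'_def by (intro sum.neutral) (auto simp: us_def)
    qed
    then show "(\<Sum>y\<in>{y\<in>{1..n}. \<theta> y = i}. lk (\<psi> x) (tab (length \<mu>) n (\<theta>(y := Suc i)))) = 0"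
      unfolding lk\<psi> ip_sum_right[symmetric] u'_def Y_def by simp
  qed
  have usb: "us b = u" using us[OF permutes_id] by simp
  have nz: "lk (\<psi> u) (tab (length \<mu>) n \<rho>) \<noteq> 0" using u(2) by (simp add: lk\<psi> b_def[symmetric] usb)
  have "\<psi> ` U = hw n \<mu>"
  proof (rule hw_submodule_full[OF part b[unfolded b_def] stable_image[OF eqv U]])
    show "\<psi> ` U \<subseteq> hw n \<mu>" using \<psi>_hw by blast
    show "\<psi> u \<in> \<psi> ` U" using u(1) by blast
    show "sact \<sigma> (\<psi> u) = \<psi> u" if "\<sigma> \<in> stab n \<rho>" for \<sigma>
      using equivariantD(3)[OF eqv _ u(1), of \<sigma>] u(3)[OF that] that by (simp add: stab_def)
    show "lk (\<psi> u) (tab (length \<mu>) n \<rho>) \<noteq> 0" by (rule nz)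
  qed
  moreover have "\<psi> u \<noteq> 0" using nz by auto
  ultimately show ?thesis using part eqv u(1) that by blast
qed

section \<open>Decomposition into Specht modules\<close>

abbreviation specht_index :: "nat \<Rightarrow> (nat list \<Rightarrow> nat) \<Rightarrow> (nat list \<times> nat) set" where
  "specht_index n c \<equiv> {(\<mu>, j). \<mu> \<in> partitions n \<and> j < c \<mu>}"

lemma stable_kernel:
  assumes "equivariant n U f" "stable n U" shows "stable n {x\<in>U. f x = 0}"
  unfolding stable_def
proof (intro conjI allI impI ballI PM.subspaceI)
  show "0 \<in> {x\<in>U. f x = 0}" using equivariant_0[OF assms] stableD(2)[OF assms(2)] by simp
qed (use stableD(3,5,6)[OF assms(2)] equivariantD[OF assms(1)] in auto)

lemma stable_orthogonal:
  assumes "stable n U" "stable n K" shows "stable n {x\<in>U. \<forall>s\<in>K. ip x s = 0}"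
  unfolding stable_def
proof (intro conjI allI impI ballI PM.subspaceI)
  fix \<pi> x assume p: "\<pi> permutes {1..n}" and "x \<in> {x\<in>U. \<forall>s\<in>K. ip x s = 0}"
  then show "sact \<pi> x \<in> {x\<in>U. \<forall>s\<in>K. ip x s = 0}"
    using stableD(6)[OF assms(1) p] stableD(6)[OF assms(2) permutes_inv[OF p]] by (auto simp: ip_sact_left[OF p])
qed (use stableD(2,3,5)[OF assms(1)] in \<open>auto simp: ip_add_left ip_scl_left\<close>)

lemma equivariant_inv_into:
  assumes f: "equivariant n V f" "stable n V" "bij_betw f V W"
  shows "equivariant n W (inv_into V f)"
proof -
  have inj: "inj_on f V" and im: "f ` V = W" using f(3) by (auto simp: bij_betw_def)
  let ?g = "inv_into V f"
  have g: "?g x \<in> V" "f (?g x) = x" if "x \<in> W" for x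
    using that im by (auto intro: inv_into_into f_inv_into_f)
  have eq: "?g x = a" if "a \<in> V" "f a = x" for a x using inj that by (auto intro: inv_into_f_eq)
  show ?thesis unfolding equivariant_def
  proof (intro conjI ballI allI impI)
    fix x y assume "x \<in> W" "y \<in> W"
    then show "?g (x + y) = ?g x + ?g y"
      by (intro eq) (simp_all add: g stableD(3)[OF f(2)] equivariantD(1)[OF f(1)])
  next
    fix c x assume "x \<in> W"
    then show "?g (scl c x) = scl c (?g x)"
      by (intro eq) (simp_all add: g stableD(5)[OF f(2)] equivariantD(2)[OF f(1)])
  next
    fix \<pi> x assume "\<pi> permutes {1..n}" "x \<in> W"
    then show "?g (sact \<pi> x) = sact \<pi> (?g x)"
      by (intro eq) (simp_all add: g stableD(6)[OF f(2)] equivariantD(3)[OF f(1)])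
  qed
qed

text \<open>The isomorphism is recorded as a sum of maps into \<open>U\<close>, the direction in
  which a further summand is easily added; \<open>OP_rep_decomposes\<close> inverts it.\<close>

definition specht_decomposition :: "nat \<Rightarrow> (nat set list \<Rightarrow>\<^sub>0 rat) set \<Rightarrow> (nat list \<Rightarrow> nat) \<Rightarrow>
    (nat list \<times> nat \<Rightarrow> (nat set list \<Rightarrow>\<^sub>0 rat) \<Rightarrow> nat set list \<Rightarrow>\<^sub>0 rat) \<Rightarrow> bool" where
  "specht_decomposition n U c G \<longleftrightarrow> finite (specht_index n c) \<and>
     (\<forall>p\<in>specht_index n c. equivariant n (hw n (fst p)) (G p)) \<and>
     bij_betw (\<lambda>x. \<Sum>p\<in>specht_index n c. G p (x p)) (\<Pi>\<^sub>E p\<in>specht_index n c. hw n (fst p)) U"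

text \<open>The orthogonal complement \<open>K'\<close> of the kernel is stable, and
  \<open>\<psi>\<close> maps it bijectively onto \<open>hw n \<mu>\<close>. The inverse of this
  restriction embeds the new summand.\<close>

lemma specht_decomposition_extend:
  assumes U: "stable n U" and fin: "U \<subseteq> {v. ks v \<subseteq> S}" "finite S"
    and \<mu>: "\<mu> \<in> partitions n" and \<psi>: "equivariant n U \<psi>" "\<psi> ` U = hw n \<mu>"
    and dec: "specht_decomposition n {x\<in>U. \<psi> x = 0} c G"
  shows "\<exists>c G. specht_decomposition n U c G"
proof -
  define K where "K = {x\<in>U. \<psi> x = 0}"
  have K: "stable n K" unfolding K_def by (rule stable_kernel[OF \<psi>(1) U])
  define K' where "K' = {x\<in>U. \<forall>s\<in>K. ip x s = 0}"
  have K': "stable n K'" unfolding K'_def by (rule stable_orthogonal[OF U K])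
  have split: "\<exists>s\<in>K. v - s \<in> K'" if v: "v \<in> U" for v
  proof -
    have "K \<subseteq> {f. ks f \<subseteq> S}" using fin(1) by (auto simp: K_def)
    from orth_proj[OF stableD(1)[OF K] fin(2) this] obtain s where s: "s \<in> K" "\<And>t. t \<in> K \<Longrightarrow> ip (v - s) t = 0"
      by metis
    moreover have "v - s \<in> U" using s(1) v by (intro stableD(4)[OF U]) (auto simp: K_def)
    ultimately show ?thesis by (auto simp: K'_def)
  qed
  have "bij_betw \<psi> K' (hw n \<mu>)"
    unfolding bij_betw_def
  proof
    show "inj_on \<psi> K'"
    proof (rule inj_onI)
      fix x y assume xy: "x \<in> K'" "y \<in> K'" "\<psi> x = \<psi> y"
      then have U': "x \<in> U" "y \<in> U" by (auto simp: K'_def)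
      have "x - y \<in> K" unfolding K_def using equivariant_diff[OF \<psi>(1) U U'] xy(3) stableD(4)[OF U U'] by simp
      moreover have "x - y \<in> K'" using xy by (intro stableD(4)[OF K'])
      ultimately have "ip (x - y) (x - y) = 0" unfolding K'_def by blast
      then show "x = y" by simp
    qed
    show "\<psi> ` K' = hw n \<mu>"
    proof
      show "\<psi> ` K' \<subseteq> hw n \<mu>" using \<psi>(2) by (auto simp: K'_def)
      show "hw n \<mu> \<subseteq> \<psi> ` K'"
      proof
        fix z assume "z \<in> hw n \<mu>"
        then obtain v where v: "v \<in> U" "z = \<psi> v" using \<psi>(2) by auto
        obtain s where s: "s \<in> K" "v - s \<in> K'" using split[OF v(1)] by blast
        then have "\<psi> (v - s) = z" using equivariant_diff[OF \<psi>(1) U v(1)] v(2) by (simp add: K_def)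
        with s(2) show "z \<in> \<psi> ` K'" by blast
      qed
    qed
  qed
  define \<gamma> where "\<gamma> = inv_into K' \<psi>"
  have eqK': "equivariant n K' \<psi>" using \<psi>(1) unfolding equivariant_def K'_def by blast
  have \<gamma>: "equivariant n (hw n \<mu>) \<gamma>"
    unfolding \<gamma>_def by (rule equivariant_inv_into[OF eqK' K' \<open>bij_betw \<psi> K' (hw n \<mu>)\<close>])
  have \<gamma>K': "\<gamma> z \<in> K'" "\<psi> (\<gamma> z) = z" if "z \<in> hw n \<mu>" for z
    using that \<open>bij_betw \<psi> K' (hw n \<mu>)\<close> unfolding \<gamma>_def bij_betw_def
    by (auto intro: inv_into_into f_inv_into_f)
  have \<gamma>\<psi>: "\<gamma> (\<psi> x) = x" if "x \<in> K'" for x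
    using that \<open>bij_betw \<psi> K' (hw n \<mu>)\<close> unfolding \<gamma>_def bij_betw_def by (auto intro: inv_into_f_f)
  let ?I = "specht_index n c"
  \<comment> \<open>The first index that is not yet taken by a copy of the Specht module of
    \<open>\<mu>\<close>.\<close>
  define p where "p = (\<mu>, c \<mu>)"
  define c' where "c' = c(\<mu> := Suc (c \<mu>))"
  define G' where "G' = G(p := \<gamma>)"
  have p: "p \<notin> ?I" by (simp add: p_def)
  have I': "specht_index n c' = insert p ?I"
    using \<mu> by (auto simp: c'_def p_def less_Suc_eq split: if_splits)
  have finI: "finite ?I" and Geq: "\<And>q. q \<in> ?I \<Longrightarrow> equivariant n (hw n (fst q)) (G q)"
    and bijK: "bij_betw (\<lambda>x. \<Sum>q\<in>?I. G q (x q)) (\<Pi>\<^sub>E q\<in>?I. hw n (fst q)) K"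
    using dec unfolding specht_decomposition_def K_def by blast+
  have val: "(\<Sum>q\<in>insert p ?I. G' q (x q)) = \<gamma> (x p) + (\<Sum>q\<in>?I. G q (restrict x ?I q))" for x
  proof -
    have "(\<Sum>q\<in>?I. G' q (x q)) = (\<Sum>q\<in>?I. G q (restrict x ?I q))"
      using p by (intro sum.cong refl) (auto simp: G'_def)
    then show ?thesis using p finI by (simp add: G'_def)
  qed
  have restr: "restrict x ?I \<in> (\<Pi>\<^sub>E q\<in>?I. hw n (fst q))" if "x \<in> (\<Pi>\<^sub>E q\<in>insert p ?I. hw n (fst q))" for x
    using that by (intro restrict_PiE_iff[THEN iffD2]) blast
  have sumK: "(\<Sum>q\<in>?I. G q (z q)) \<in> K" if "z \<in> (\<Pi>\<^sub>E q\<in>?I. hw n (fst q))" for z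
    using bij_betwE[OF bijK] that by blast
  have \<psi>val: "\<psi> (\<Sum>q\<in>insert p ?I. G' q (x q)) = x p \<and> (\<Sum>q\<in>insert p ?I. G' q (x q)) \<in> U"
    if x: "x \<in> (\<Pi>\<^sub>E q\<in>insert p ?I. hw n (fst q))" for x
  proof -
    have xp: "x p \<in> hw n \<mu>" using x by (auto simp: PiE_def Pi_def p_def)
    have s: "(\<Sum>q\<in>?I. G q (restrict x ?I q)) \<in> U" "\<psi> (\<Sum>q\<in>?I. G q (restrict x ?I q)) = 0"
      using sumK[OF restr[OF x]] by (simp_all add: K_def)
    have "\<gamma> (x p) \<in> U" using \<gamma>K'(1)[OF xp] by (simp add: K'_def)
    then show ?thesis unfolding val
      using equivariantD(1)[OF \<psi>(1) _ s(1)] s \<gamma>K'(2)[OF xp] stableD(3)[OF U _ s(1)] by simp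
  qed
  have "bij_betw (\<lambda>x. \<Sum>q\<in>insert p ?I. G' q (x q)) (\<Pi>\<^sub>E q\<in>insert p ?I. hw n (fst q)) U"
    unfolding bij_betw_def
  proof
    show "inj_on (\<lambda>x. \<Sum>q\<in>insert p ?I. G' q (x q)) (\<Pi>\<^sub>E q\<in>insert p ?I. hw n (fst q))"
    proof (rule inj_onI)
      fix x y assume x: "x \<in> (\<Pi>\<^sub>E q\<in>insert p ?I. hw n (fst q))" and y: "y \<in> (\<Pi>\<^sub>E q\<in>insert p ?I. hw n (fst q))"
        and eq: "(\<Sum>q\<in>insert p ?I. G' q (x q)) = (\<Sum>q\<in>insert p ?I. G' q (y q))"
      have xp: "x p = y p" using \<psi>val[OF x] \<psi>val[OF y] eq by simp
      then have e: "(\<Sum>q\<in>?I. G q (restrict x ?I q)) = (\<Sum>q\<in>?I. G q (restrict y ?I q))"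
        using eq unfolding val by simp
      have r: "restrict x ?I = restrict y ?I"
        by (rule inj_onD[OF bij_betw_imp_inj_on[OF bijK] e restr[OF x] restr[OF y]])
      show "x = y"
      proof (rule PiE_ext[OF x y])
        fix q assume "q \<in> insert p ?I"
        then show "x q = y q" using xp fun_cong[OF r, of q] by (cases "q = p") (simp_all only: restrict_apply insert_iff if_True simp_thms)
      qed
    qed
    show "(\<lambda>x. \<Sum>q\<in>insert p ?I. G' q (x q)) ` (\<Pi>\<^sub>E q\<in>insert p ?I. hw n (fst q)) = U"
    proof
      show "(\<lambda>x. \<Sum>q\<in>insert p ?I. G' q (x q)) ` (\<Pi>\<^sub>E q\<in>insert p ?I. hw n (fst q)) \<subseteq> U" using \<psi>val by blast
      show "U \<subseteq> (\<lambda>x. \<Sum>q\<in>insert p ?I. G' q (x q)) ` (\<Pi>\<^sub>E q\<in>insert p ?I. hw n (fst q))"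
      proof
        fix v assume v: "v \<in> U"
        obtain s where s: "s \<in> K" "v - s \<in> K'" using split[OF v] by blast
        obtain z where z: "z \<in> (\<Pi>\<^sub>E q\<in>?I. hw n (fst q))" "s = (\<Sum>q\<in>?I. G q (z q))"
          using bij_betw_imp_surj_on[OF bijK] s(1) by blast
        define x where "x = z(p := \<psi> (v - s))"
        have "v - s \<in> U" using s(2) by (simp add: K'_def)
        then have "\<psi> (v - s) \<in> hw n (fst p)" using \<psi>(2) by (auto simp: p_def)
        then have x: "x \<in> (\<Pi>\<^sub>E q\<in>insert p ?I. hw n (fst q))"
          unfolding x_def using z(1) by (intro PiE_fun_upd)
        have "restrict x ?I = z"
          using z(1) p by (auto simp: x_def fun_eq_iff restrict_def PiE_def extensional_def)
        then have "(\<Sum>q\<in>insert p ?I. G' q (x q)) = \<gamma> (x p) + s"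
          unfolding val z(2) by (simp only:)
        also have "x p = \<psi> (v - s)" by (simp add: x_def)
        finally have "(\<Sum>q\<in>insert p ?I. G' q (x q)) = v" using \<gamma>\<psi>[OF s(2)] by simp
        with x show "v \<in> (\<lambda>x. \<Sum>q\<in>insert p ?I. G' q (x q)) ` (\<Pi>\<^sub>E q\<in>insert p ?I. hw n (fst q))" by (intro image_eqI[of _ _ x]) simp_all
      qed
    qed
  qed
  moreover have "equivariant n (hw n (fst q)) (G' q)" if "q \<in> insert p ?I" for q
    using that Geq[of q] \<gamma> by (cases "q = p") (auto simp: G'_def p_def)
  ultimately have "specht_decomposition n U c' G'"
    unfolding specht_decomposition_def I' using finI by blast
  then show ?thesis by blast
qed

text \<open>Induction on a bound for the size of independent subsets. A vector outside the kernel of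
  \<open>\<psi>\<close> extends every independent subset of the kernel, so the bound drops by at
  least one.\<close>

theorem ex_specht_decomposition:
  assumes "stable n U" "U \<subseteq> {v. ks v \<subseteq> S}" "finite S"
  shows "\<exists>c G. specht_decomposition n U c G"
proof -
  have "\<exists>c G. specht_decomposition n U c G"
    if "stable n U" "U \<subseteq> {v. ks v \<subseteq> S}" "\<And>B. B \<subseteq> U \<Longrightarrow> PM.independent B \<Longrightarrow> card B \<le> d" for d U
    using that
  proof (induction d arbitrary: U rule: less_induct)
    case (less d)
    show ?case
    proof (cases "U = {0}")
      case True
      have "specht_decomposition n U (\<lambda>_. 0) (\<lambda>_ v. v)"
        unfolding specht_decomposition_def True by (auto simp: bij_betw_def)
      then show ?thesis by blast
    next
      case False
      with stableD(2)[OF less.prems(1)] obtain x0 where x0: "x0 \<in> U" "x0 \<noteq> 0" by blast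
      obtain \<mu> \<psi> x where \<psi>: "\<mu> \<in> partitions n" "equivariant n U \<psi>" "\<psi> ` U = hw n \<mu>"
        and x: "x \<in> U" "\<psi> x \<noteq> 0"
        using ex_specht_quotient[OF less.prems(1) x0] .
      define K where "K = {x\<in>U. \<psi> x = 0}"
      have K: "stable n K" unfolding K_def by (rule stable_kernel[OF \<psi>(2) less.prems(1)])
      have xK: "x \<notin> K" using x(2) by (simp add: K_def)
      have bound: "Suc (card B) \<le> d" if B: "B \<subseteq> K" "PM.independent B" for B
      proof -
        have BU: "B \<subseteq> U" using B(1) by (auto simp: K_def)
        have "B \<subseteq> PM.span ((\<lambda>x. sng x 1) ` S)" using BU less.prems(2) span_keys[OF assms(3)] by blast
        then have "finite B"
          using PM.independent_span_bound[OF finite_imageI[OF assms(3)] B(2)] by blast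
        have "PM.span B \<subseteq> K" using B(1) stableD(1)[OF K] by (rule PM.span_minimal)
        then have "x \<notin> PM.span B" using xK by blast
        then have "PM.independent (insert x B)" using B(2) by (rule PM.independent_insertI)
        then have "card (insert x B) \<le> d" using BU x(1) by (intro less.prems(3)) auto
        moreover have "x \<notin> B" using B(1) xK by blast
        ultimately show ?thesis using \<open>finite B\<close> by simp
      qed
      have "d \<noteq> 0" using bound[OF empty_subsetI PM.independent_empty] by simp
      have "\<exists>c G. specht_decomposition n K c G"
      proof (rule less.IH[of "d - 1" K])
        show "d - 1 < d" using \<open>d \<noteq> 0\<close> by simp
        show "K \<subseteq> {v. ks v \<subseteq> S}" using less.prems(2) by (auto simp: K_def)
        show "card B \<le> d - 1" if "B \<subseteq> K" "PM.independent B" for B using bound[OF that] by simp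
      qed (rule K)
      then show ?thesis
        using specht_decomposition_extend[OF less.prems(1,2) assms(3) \<psi>] unfolding K_def by blast
    qed
  qed
  moreover have "card B \<le> card ((\<lambda>x. sng x (1::rat)) ` S)" if "B \<subseteq> U" "PM.independent B" for B
  proof -
    have "B \<subseteq> PM.span ((\<lambda>x. sng x 1) ` S)" using that(1) assms(2) span_keys[OF assms(3)] by blast
    then show ?thesis using PM.independent_span_bound[OF finite_imageI[OF assms(3)] that(2)] by blast
  qed
  ultimately show ?thesis using assms(1,2) by blast
qed

section \<open>The polynomial ring and its ideals\<close>

definition Pn :: "nat \<Rightarrow> mpoly set" where
  "Pn n = {p. \<forall>m\<in>ks p. ks m \<subseteq> {1..n}}"

lemma poly_sum_single: "p = (\<Sum>m\<in>ks p. sng m (lk p m))"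
  by (rule poly_mapping_sum_single) auto

lemma Pn_zero [simp]: "0 \<in> Pn n"
  and Pn_one [simp]: "1 \<in> Pn n"
  by (auto simp: Pn_def)

lemma Pn_add: "p \<in> Pn n \<Longrightarrow> q \<in> Pn n \<Longrightarrow> p + q \<in> Pn n"
  unfolding Pn_def using keys_add[of p q] by blast

lemma Pn_diff: "p \<in> Pn n \<Longrightarrow> q \<in> Pn n \<Longrightarrow> p - (q::mpoly) \<in> Pn n"
  unfolding Pn_def using keys_diff[of p q] by blast

lemma Pn_uminus: "p \<in> Pn n \<Longrightarrow> - p \<in> Pn n"
  using Pn_diff[OF Pn_zero] by simp

lemma Pn_mult: "p \<in> Pn n \<Longrightarrow> q \<in> Pn n \<Longrightarrow> p * q \<in> Pn n"
proof -
  assume pq: "p \<in> Pn n" "q \<in> Pn n"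
  show ?thesis unfolding Pn_def
  proof (intro CollectI ballI)
    fix m assume "m \<in> ks (p * q)"
    then obtain a b where "m = a + b" "a \<in> ks p" "b \<in> ks q" using keys_mult[of p q] by blast
    with pq keys_add[of a b] show "ks m \<subseteq> {1..n}" unfolding Pn_def by blast
  qed
qed

lemma Pn_sum: "(\<And>a. a \<in> A \<Longrightarrow> f a \<in> Pn n) \<Longrightarrow> sum f A \<in> Pn n"
  by (induction A rule: infinite_finite_induct) (simp_all add: Pn_add)

lemma Pn_prod: "(\<And>a. a \<in> A \<Longrightarrow> f a \<in> Pn n) \<Longrightarrow> prod f A \<in> Pn n"
  by (induction A rule: infinite_finite_induct) (simp_all add: Pn_mult)

lemma Pn_power: "p \<in> Pn n \<Longrightarrow> p ^ j \<in> Pn n"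
  by (induction j) (simp_all add: Pn_mult)

lemma Pn_single: "ks m \<subseteq> {1..n} \<Longrightarrow> sng m c \<in> Pn n"
  by (auto simp: Pn_def)

lemma Pn_pvar: "i \<in> {1..n} \<Longrightarrow> pvar i \<in> Pn n"
  by (auto simp: pvar_def Pn_def)

lemma Pn_pconst: "pconst c \<in> Pn n"
  by (auto simp: pconst_def Pn_def)

lemma pconst_mult: "pconst c * p = scl c p"
  unfolding pconst_def mult_map_scale_conv_mult ..

lemma Pn_scl: "p \<in> Pn n \<Longrightarrow> scl c p \<in> Pn n"
  unfolding pconst_mult[symmetric] by (rule Pn_mult[OF Pn_pconst])

lemma Pn_induct [consumes 1, case_names zero add single]:
  assumes "p \<in> Pn n" "Q 0" "\<And>p q. Q p \<Longrightarrow> Q q \<Longrightarrow> Q (p + q)" "\<And>m c. ks m \<subseteq> {1..n} \<Longrightarrow> Q (sng m c)"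
  shows "Q p"
proof -
  have "Q (\<Sum>m\<in>A. sng m (lk p m))" if "finite A" "A \<subseteq> ks p" for A
    using that
  proof (induction A rule: finite_induct)
    case (insert x F)
    then show ?case using assms by (auto simp: Pn_def)
  qed (simp add: assms)
  from this[of "ks p"] show ?thesis unfolding poly_sum_single[symmetric] by simp
qed

lemma mpoly_ring_simps [simp]:
  "carrier (mpoly_ring n) = Pn n" "monoid.mult (mpoly_ring n) = (*)" "monoid.one (mpoly_ring n) = 1"
  "ring.zero (mpoly_ring n) = 0" "ring.add (mpoly_ring n) = (+)"
  by (simp_all add: mpoly_ring_def Pn_def)

lemma cring_mpoly_ring: "cring (mpoly_ring n)"
proof (rule cringI)
  show "abelian_group (mpoly_ring n)"
  proof (rule abelian_groupI)
    fix x assume "x \<in> carrier (mpoly_ring n)"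
    then show "\<exists>y\<in>carrier (mpoly_ring n). y \<oplus>\<^bsub>mpoly_ring n\<^esub> x = \<zero>\<^bsub>mpoly_ring n\<^esub>"
      by (intro bexI[of _ "- x"]) (simp_all add: Pn_uminus)
  qed (simp_all add: Pn_add algebra_simps)
  show "comm_monoid (mpoly_ring n)"
    by (rule comm_monoidI) (simp_all add: Pn_mult algebra_simps)
qed (simp add: algebra_simps)

text \<open>Ideals in terms of the operations of the polynomial type, where algebraic simplification
  works directly; \<open>ideal_isid\<close> and \<open>isid_ideal\<close> translate from and to the
  ring record.\<close>

definition poly_ideal :: "nat \<Rightarrow> mpoly set \<Rightarrow> bool" where
  "poly_ideal n J \<longleftrightarrow> J \<subseteq> Pn n \<and> 0 \<in> J \<and> (\<forall>x\<in>J. \<forall>y\<in>J. x + y \<in> J) \<and> (\<forall>r\<in>Pn n. \<forall>x\<in>J. r * x \<in> J)"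

lemma poly_idealD:
  assumes "poly_ideal n J"
  shows "x \<in> J \<Longrightarrow> x \<in> Pn n" "0 \<in> J" "x \<in> J \<Longrightarrow> y \<in> J \<Longrightarrow> x + y \<in> J" "r \<in> Pn n \<Longrightarrow> x \<in> J \<Longrightarrow> r * x \<in> J"
    "x \<in> J \<Longrightarrow> scl c x \<in> J" "x \<in> J \<Longrightarrow> - x \<in> J" "x \<in> J \<Longrightarrow> y \<in> J \<Longrightarrow> x - y \<in> J"
proof -
  show 1: "x \<in> J \<Longrightarrow> x \<in> Pn n" "0 \<in> J" and add: "\<And>x y. x \<in> J \<Longrightarrow> y \<in> J \<Longrightarrow> x + y \<in> J"
    and mult: "\<And>r x. r \<in> Pn n \<Longrightarrow> x \<in> J \<Longrightarrow> r * x \<in> J"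
    using assms unfolding poly_ideal_def by blast+
  show "x \<in> J \<Longrightarrow> scl c x \<in> J" unfolding pconst_mult[symmetric] by (rule mult[OF Pn_pconst])
  show neg: "x \<in> J \<Longrightarrow> - x \<in> J" for x using mult[of "-1" x] Pn_uminus[OF Pn_one] by simp
  show "x \<in> J \<Longrightarrow> y \<in> J \<Longrightarrow> x - y \<in> J" using add[of x "- y"] neg by simp
qed

lemma ideal_isid:
  assumes "ideal J (mpoly_ring n)" shows "poly_ideal n J"
proof -
  interpret ideal J "mpoly_ring n" by (rule assms)
  show ?thesis unfolding poly_ideal_def
    using a_subset I_l_closed additive_subgroup.zero_closed[OF additive_subgroup_axioms]
      additive_subgroup.a_closed[OF additive_subgroup_axioms] by auto
qed

lemma isid_ideal:
  assumes "poly_ideal n J" shows "ideal J (mpoly_ring n)"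
proof -
  interpret R: cring "mpoly_ring n" by (rule cring_mpoly_ring)
  have minus: "\<ominus>\<^bsub>mpoly_ring n\<^esub> x = - x" if "x \<in> Pn n" for x
    using that Pn_uminus[OF that] by (intro R.minus_equality) auto
  show ?thesis
  proof (rule idealI[OF R.ring_axioms])
    show "subgroup J (add_monoid (mpoly_ring n))"
    proof (rule subgroup.intro)
      fix x assume "x \<in> J"
      then show "inv\<^bsub>add_monoid (mpoly_ring n)\<^esub> x \<in> J"
        using minus[OF poly_idealD(1)[OF assms]] poly_idealD(6)[OF assms] by (simp add: a_inv_def)
    next
      show "J \<subseteq> carrier (add_monoid (mpoly_ring n))" using poly_idealD(1)[OF assms] by auto
    qed (simp_all add: poly_idealD(2,3)[OF assms])
  next
    fix a x assume "a \<in> J" "x \<in> carrier (mpoly_ring n)"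
    then have "x * a \<in> J" using poly_idealD(4)[OF assms] by simp
    then show "x \<otimes>\<^bsub>mpoly_ring n\<^esub> a \<in> J" "a \<otimes>\<^bsub>mpoly_ring n\<^esub> x \<in> J" by (simp_all add: mult.commute)
  qed
qed

section \<open>Generators of the ideal and elementary symmetric polynomials\<close>

abbreviation ideal_gens :: "nat \<Rightarrow> nat \<Rightarrow> mpoly set" where
  "ideal_gens n k \<equiv> (\<lambda>i. pvar i ^ k) ` {1..n} \<union> elem_sym n ` {n - k + 1..n}"

text \<open>General in the ring and the index set because it is applied to the variables, to the
  coordinates of a point, and to the coordinates that remain after some are removed.\<close>

definition esym :: "('i \<Rightarrow> 'a::comm_ring_1) \<Rightarrow> 'i set \<Rightarrow> nat \<Rightarrow> 'a" where
  "esym f S d = (\<Sum>T | T \<subseteq> S \<and> card T = d. \<Prod>i\<in>T. f i)"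

lemma elem_sym_esym: "elem_sym n d = esym pvar {1..n} d"
  by (simp add: elem_sym_def esym_def)

lemma esym_zero: "finite S \<Longrightarrow> esym f S 0 = 1"
proof -
  assume "finite S"
  then have "{T. T \<subseteq> S \<and> card T = 0} = {{}}" by (auto simp: finite_subset)
  then show ?thesis by (simp add: esym_def)
qed

lemma esym_gt:
  assumes "finite S" "card S < d" shows "esym f S d = 0"
proof -
  have "\<not> (T \<subseteq> S \<and> card T = d)" for T using card_mono[OF assms(1), of T] assms(2) by auto
  then have "{T. T \<subseteq> S \<and> card T = d} = {}" by blast
  then show ?thesis unfolding esym_def by (simp only: sum.empty)
qed

lemma esym_insert:
  assumes "finite S" "y \<notin> S"
  shows "esym f (insert y S) (Suc d) = esym f S (Suc d) + f y * esym f S d"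
proof -
  let ?A = "{T. T \<subseteq> S \<and> card T = Suc d}" and ?B = "{T. T \<subseteq> S \<and> card T = d}"
  have eq: "{T. T \<subseteq> insert y S \<and> card T = Suc d} = ?A \<union> insert y ` ?B"
  proof (intro Set.set_eqI iffI)
    fix T assume T: "T \<in> {T. T \<subseteq> insert y S \<and> card T = Suc d}"
    show "T \<in> ?A \<union> insert y ` ?B"
    proof (cases "y \<in> T")
      case True
      then have "T - {y} \<in> ?B" "T = insert y (T - {y})" using T by auto
      then show ?thesis by blast
    qed (use T in auto)
  next
    fix T assume "T \<in> ?A \<union> insert y ` ?B"
    then show "T \<in> {T. T \<subseteq> insert y S \<and> card T = Suc d}"
      using assms by (auto simp: card_insert_if finite_subset)
  qed
  have fin: "finite ?A" "finite ?B" using assms(1) by auto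
  have "inj_on (insert y) ?B" using assms(2) by (auto simp: inj_on_def)
  have "esym f (insert y S) (Suc d) = (\<Sum>T\<in>?A. \<Prod>i\<in>T. f i) + (\<Sum>T\<in>insert y ` ?B. \<Prod>i\<in>T. f i)"
    unfolding esym_def eq using fin assms(2) by (intro sum.union_disjoint) auto
  also have "(\<Sum>T\<in>insert y ` ?B. \<Prod>i\<in>T. f i) = (\<Sum>T\<in>?B. f y * (\<Prod>i\<in>T. f i))"
    unfolding sum.reindex[OF \<open>inj_on (insert y) ?B\<close>] o_def
    using assms by (intro sum.cong refl prod.insert) (auto simp: finite_subset)
  finally show ?thesis by (simp add: esym_def sum_distrib_left)
qed

lemma Pn_esym: "S \<subseteq> {1..n} \<Longrightarrow> esym pvar S d \<in> Pn n"
  unfolding esym_def by (intro Pn_sum Pn_prod Pn_pvar) blast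

lemma gens_Pn: "ideal_gens n k \<subseteq> Pn n"
proof -
  have "pvar i ^ k \<in> Pn n" if "i \<in> {1..n}" for i by (rule Pn_power[OF Pn_pvar[OF that]])
  moreover have "elem_sym n d \<in> Pn n" for d unfolding elem_sym_esym by (rule Pn_esym) simp
  ultimately show ?thesis by blast
qed

lemma isid_I_ideal: "poly_ideal n (I_ideal n k)" and gens_I_ideal: "ideal_gens n k \<subseteq> I_ideal n k"
  and I_ideal_minimal: "poly_ideal n J \<Longrightarrow> ideal_gens n k \<subseteq> J \<Longrightarrow> I_ideal n k \<subseteq> J"
proof -
  interpret R: cring "mpoly_ring n" by (rule cring_mpoly_ring)
  show "poly_ideal n (I_ideal n k)"
    unfolding I_ideal_def by (intro ideal_isid R.genideal_ideal) (simp only: mpoly_ring_simps gens_Pn)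
  show "ideal_gens n k \<subseteq> I_ideal n k"
    unfolding I_ideal_def by (intro R.genideal_self) (simp only: mpoly_ring_simps gens_Pn)
  show "poly_ideal n J \<Longrightarrow> ideal_gens n k \<subseteq> J \<Longrightarrow> I_ideal n k \<subseteq> J"
    unfolding I_ideal_def by (intro R.genideal_minimal isid_ideal)
qed

section \<open>An upper bound for the dimension of the quotient\<close>

text \<open>For \<open>A = {..<k}\<close> these are the surjections, that is, the ordered set
  partitions. General \<open>A\<close> is what the recursion on the last point produces;
  extensionality makes the set finite.\<close>

definition hitting :: "nat \<Rightarrow> nat \<Rightarrow> nat set \<Rightarrow> (nat \<Rightarrow> nat) set" where
  "hitting n k A = {\<rho> \<in> {1..n} \<rightarrow>\<^sub>E {..<k}. A \<subseteq> \<rho> ` {1..n}}"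

lemma finite_hitting: "finite (hitting n k A)"
  unfolding hitting_def by (rule finite_subset[of _ "{1..n} \<rightarrow>\<^sub>E {..<k}"]) (auto intro: finite_PiE)

text \<open>A map extended by the value \<open>v\<close> at the new point hits \<open>v\<close>
  there, so before the extension it has to hit only the rest of \<open>A\<close>.\<close>

lemma card_hitting_Suc: "(\<Sum>v<k. card (hitting n k (A - {v}))) \<le> card (hitting (Suc n) k A)"
proof -
  let ?S = "SIGMA v:{..<k}. hitting n k (A - {v})"
  have inj: "inj_on (\<lambda>(v, \<rho>). \<rho>(Suc n := v)) ?S"
  proof (rule inj_onI, clarify)
    fix v \<rho> v' \<rho>' assume 1: "\<rho> \<in> hitting n k (A - {v})" "\<rho>' \<in> hitting n k (A - {v'})"
      and eq: "\<rho>(Suc n := v) = \<rho>'(Suc n := v')"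
    have v: "v = v'" using fun_cong[OF eq, of "Suc n"] by simp
    have "\<rho> = \<rho>'"
    proof
      fix y
      have "\<rho> (Suc n) = undefined" "\<rho>' (Suc n) = undefined" using 1 by (auto simp: hitting_def PiE_def extensional_def)
      with fun_cong[OF eq, of y] show "\<rho> y = \<rho>' y" by (cases "y = Suc n") auto
    qed
    with v show "v = v' \<and> \<rho> = \<rho>'" by simp
  qed
  have sub: "(\<lambda>(v, \<rho>). \<rho>(Suc n := v)) ` ?S \<subseteq> hitting (Suc n) k A"
  proof clarify
    fix v \<rho> assume v: "v < k" and \<rho>: "\<rho> \<in> hitting n k (A - {v})"
    have ins: "{1..Suc n} = insert (Suc n) {1..n}" by auto
    have "\<rho>(Suc n := v) \<in> {1..Suc n} \<rightarrow>\<^sub>E {..<k}"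
      unfolding ins using \<rho> v by (intro PiE_fun_upd) (auto simp: hitting_def)
    moreover have "A \<subseteq> (\<rho>(Suc n := v)) ` {1..Suc n}"
    proof
      fix a assume a: "a \<in> A"
      show "a \<in> (\<rho>(Suc n := v)) ` {1..Suc n}"
      proof (cases "a = v")
        case True
        then show ?thesis by (intro image_eqI[of _ _ "Suc n"]) auto
      next
        case False
        then obtain y where "y \<in> {1..n}" "\<rho> y = a" using a \<rho> by (auto simp: hitting_def)
        then show ?thesis by (intro image_eqI[of _ _ y]) auto
      qed
    qed
    ultimately show "\<rho>(Suc n := v) \<in> hitting (Suc n) k A" by (simp add: hitting_def)
  qed
  have "card ?S \<le> card (hitting (Suc n) k A)" by (rule card_inj_on_le[OF inj sub finite_hitting])
  then show ?thesis by (simp add: finite_hitting)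
qed

lemma Pn_Suc_split:
  assumes "p \<in> Pn (Suc n)"
  obtains p' r where "p' \<in> Pn n" "r \<in> Pn (Suc n)" "p = p' + pvar (Suc n) * r"
proof -
  have "\<exists>p' r. p' \<in> Pn n \<and> r \<in> Pn (Suc n) \<and> p = p' + pvar (Suc n) * r"
    using assms
  proof (induction p rule: Pn_induct)
    case zero
    show ?case by (intro exI[of _ 0]) simp
  next
    case (add p q)
    then obtain p' r q' s where "p' \<in> Pn n" "r \<in> Pn (Suc n)" "p = p' + pvar (Suc n) * r"
      "q' \<in> Pn n" "s \<in> Pn (Suc n)" "q = q' + pvar (Suc n) * s" by blast
    then show ?case
      by (intro exI[of _ "p' + q'"] exI[of _ "r + s"]) (simp add: Pn_add algebra_simps)
  next
    case (single m c)
    show ?case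
    proof (cases "lk m (Suc n) = 0")
      case True
      then have "ks m \<subseteq> {1..n}" using single by (auto simp: in_keys_iff le_Suc_eq subset_iff) (metis le_SucE neq0_conv)
      then show ?thesis by (intro exI[of _ "sng m c"] exI[of _ 0]) (auto simp: Pn_def)
    next
      case False
      define m' where "m' = m - sng (Suc n) 1"
      have m: "m = sng (Suc n) 1 + m'"
        using False by (intro poly_mapping_eqI) (auto simp: m'_def lookup_add lookup_minus lookup_single when_def)
      have "ks m' \<subseteq> {1..Suc n}" using single m'_def
        by (auto simp: in_keys_iff lookup_minus subset_iff)
      then show ?thesis
        by (intro exI[of _ 0] exI[of _ "sng m' c"]) (auto simp: pvar_def mult_single m Pn_def)
    qed
  qed
  then show ?thesis using that by blast
qed

lemma Pn_mono: "p \<in> Pn n \<Longrightarrow> p \<in> Pn (Suc n)"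
  unfolding Pn_def by fastforce

text \<open>Filter by powers of the last variable \<open>x\<close>. Each of the first \<open>s\<close> layers is a quotient of the ring in fewer
  variables with parameter \<open>s - 1\<close>; since \<open>x\<^sup>s\<close> times the elementary symmetric polynomial of degree \<open>n + 1 - s\<close> in the
  other variables lies in the ideal, each of the other layers is one with parameter \<open>s\<close>. The same recursion counts the maps
  that hit a given set of \<open>s\<close> values, by the value at the last point.\<close>

theorem quotient_spanning:
  assumes "poly_ideal n I" "A \<subseteq> {..<k}"
    "\<And>i. i \<in> {1..n} \<Longrightarrow> pvar i ^ k \<in> I"
    "\<And>d. n < d + card A \<Longrightarrow> esym pvar {1..n} d \<in> I"
  shows "\<exists>B. finite B \<and> B \<subseteq> Pn n \<and> card B \<le> card (hitting n k A) \<and> (\<forall>p\<in>Pn n. \<exists>b\<in>PM.span B. p - b \<in> I)"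
  using assms
proof (induction n arbitrary: I A)
  case 0
  have P0: "p = scl (lk p 0) 1" if "p \<in> Pn 0" for p :: mpoly
  proof (rule poly_mapping_eqI)
    fix m show "lk p m = lk (scl (lk p 0) 1) m"
      using that by (cases "m = 0") (auto simp: lookup_one in_keys_iff Pn_def)
  qed
  show ?case
  proof (cases "A = {}")
    case True
    have "hitting 0 k A = {\<lambda>_. undefined}" by (simp add: hitting_def True)
    moreover have "\<exists>b\<in>PM.span {1}. p - b \<in> I" if "p \<in> Pn 0" for p
      using P0[OF that] poly_idealD(2)[OF 0(1)] by (intro bexI[of _ p]) (auto simp: PM.span_singleton)
    ultimately show ?thesis by (intro exI[of _ "{1}"]) auto
  next
    case False
    \<comment> \<open>Without variables nothing can be hit. Accordingly the elementary symmetric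
      polynomial of degree 0, which is 1, lies in the ideal, and the quotient is zero.\<close>
    then have "card A > 0" using 0(2) finite_subset card_gt_0_iff by blast
    then have "esym pvar {1..0} 0 \<in> I" by (intro 0(4)) simp
    then have "1 \<in> I" by (simp add: esym_zero)
    then have "p \<in> I" if "p \<in> Pn 0" for p using poly_idealD(4)[OF 0(1) that] by fastforce
    then show ?thesis by (intro exI[of _ "{}"]) auto
  qed
next
  case (Suc n)
  define x where "x = pvar (Suc n)"
  have xP: "x \<in> Pn (Suc n)" unfolding x_def by (rule Pn_pvar) simp
  define s where "s = card A"
  have finA: "finite A" using Suc.prems(2) finite_subset by blast
  let ?e = "esym pvar {1..Suc n}" and ?e' = "esym pvar {1..n}"
  have e0: "?e 0 = 1" "?e' 0 = 1" by (simp_all add: esym_zero)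
  have eS: "?e (Suc d) = ?e' (Suc d) + x * ?e' d" for d
    using esym_insert[of "{1..n}" "Suc n" pvar d] by (simp add: x_def atLeastAtMostSuc_conv)
  have e'P: "?e' d \<in> Pn n" for d by (rule Pn_esym) simp
  \<comment> \<open>Lowest coefficients: those \<open>p\<close> in fewer variables for which
    \<open>x ^ j * p\<close> lies in the ideal up to a multiple of the next power of
    \<open>x\<close>. The \<open>j\<close>-th layer of the filtration is spanned by the quotient by
    \<open>I' j\<close>.\<close>
  define I' where "I' = (\<lambda>j. {p \<in> Pn n. \<exists>r\<in>Pn (Suc n). x ^ j * p + x ^ Suc j * r \<in> I})"
  have I': "poly_ideal n (I' j)" for j
    unfolding poly_ideal_def
  proof (intro conjI ballI)
    show "I' j \<subseteq> Pn n" by (auto simp: I'_def)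
    show "0 \<in> I' j" unfolding I'_def using poly_idealD(2)[OF Suc.prems(1)] by (auto intro!: bexI[of _ 0])
  next
    fix p q assume "p \<in> I' j" "q \<in> I' j"
    then obtain r t where pq: "p \<in> Pn n" "q \<in> Pn n" "r \<in> Pn (Suc n)" "t \<in> Pn (Suc n)"
      "x ^ j * p + x ^ Suc j * r \<in> I" "x ^ j * q + x ^ Suc j * t \<in> I" unfolding I'_def by blast
    have "(x ^ j * p + x ^ Suc j * r) + (x ^ j * q + x ^ Suc j * t) \<in> I"
      by (rule poly_idealD(3)[OF Suc.prems(1) pq(5,6)])
    then have "x ^ j * (p + q) + x ^ Suc j * (r + t) \<in> I" by (simp add: algebra_simps)
    with pq(1-4) show "p + q \<in> I' j" unfolding I'_def by (blast intro: Pn_add)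
  next
    fix u p assume u: "u \<in> Pn n" and "p \<in> I' j"
    then obtain r where r: "p \<in> Pn n" "r \<in> Pn (Suc n)" "x ^ j * p + x ^ Suc j * r \<in> I" unfolding I'_def by blast
    then have "u * (x ^ j * p + x ^ Suc j * r) \<in> I" by (intro poly_idealD(4)[OF Suc.prems(1)] Pn_mono u)
    then have "x ^ j * (u * p) + x ^ Suc j * (u * r) \<in> I" by (simp add: algebra_simps)
    with r u show "u * p \<in> I' j" unfolding I'_def by (blast intro: Pn_mult Pn_mono)
  qed
  have sub_I': "p \<in> I' j" if "p \<in> Pn n" "x ^ j * p \<in> I" for p j
    using that unfolding I'_def by (auto intro!: bexI[of _ 0])
  \<comment> \<open>By \<open>eS\<close>, the coefficient of \<open>x ^ j\<close> in
    \<open>x ^ j * ?e d\<close> is \<open>?e' d\<close>, and the rest is divisible by the next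
    power.\<close>
  have I'_high: "?e' d \<in> I' j" if d: "Suc n < d + s" for d j
  proof (cases d)
    case 0
    have "x ^ j * ?e 0 \<in> I" using d 0 by (intro poly_idealD(4)[OF Suc.prems(1)] Pn_power xP Suc.prems(4)) (simp add: s_def)
    then show ?thesis unfolding 0 e0 using sub_I' e'P[of 0] e0 by metis
  next
    case (Suc d')
    have "x ^ j * ?e d \<in> I" using d by (intro poly_idealD(4)[OF Suc.prems(1)] Pn_power xP Suc.prems(4)) (simp add: s_def)
    then have "x ^ j * ?e' d + x ^ Suc j * ?e' d' \<in> I" unfolding Suc eS by (simp add: algebra_simps)
    then show ?thesis unfolding I'_def using e'P Pn_mono[OF e'P] by blast
  qed
  \<comment> \<open>The start is 0, since \<open>n\<close> variables have no elementary symmetric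
    polynomial of degree n + 1. Each step subtracts the previous member from
    \<open>x ^ i * ?e (Suc (n - i))\<close>, which \<open>eS\<close> turns into the next member;
    this generator is available as long as i < s.\<close>
  have chain: "i \<le> s \<Longrightarrow> i \<le> Suc n \<Longrightarrow> x ^ i * ?e' (Suc n - i) \<in> I" for i
  proof (induction i)
    case 0
    show ?case using poly_idealD(2)[OF Suc.prems(1)] by (simp add: esym_gt)
  next
    case (Suc i)
    have "x ^ i * ?e (Suc (n - i)) \<in> I"
      using Suc.prems by (intro poly_idealD(4)[OF \<open>poly_ideal (Suc n) I\<close>] Pn_power xP \<open>\<And>d. Suc n < d + card A \<Longrightarrow> ?e d \<in> I\<close>) (simp add: s_def)
    moreover have "x ^ i * ?e' (Suc (n - i)) \<in> I" using Suc by (simp add: Suc_diff_le)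
    ultimately have "x ^ i * ?e (Suc (n - i)) - x ^ i * ?e' (Suc (n - i)) \<in> I" by (rule poly_idealD(7)[OF \<open>poly_ideal (Suc n) I\<close>])
    then show ?case unfolding eS by (simp add: algebra_simps)
  qed
  have I'_mid: "?e' d \<in> I' j" if "d + s = Suc n" "s \<le> j" for d j
  proof (rule sub_I'[OF e'P])
    have "d = Suc n - s" "s \<le> Suc n" using that(1) by auto
    then have "x ^ s * ?e' d \<in> I" using chain[of s] by simp
    then have "x ^ (j - s) * (x ^ s * ?e' d) \<in> I" by (rule poly_idealD(4)[OF Suc.prems(1) Pn_power[OF xP]])
    moreover have "x ^ (j - s) * (x ^ s * ?e' d) = x ^ j * ?e' d"
      using that(2) by (simp add: mult.assoc[symmetric] power_add[symmetric])
    ultimately show "x ^ j * ?e' d \<in> I" by (simp only:)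
  qed
  have "s \<le> k" unfolding s_def using card_mono[OF _ Suc.prems(2)] by simp
  obtain f1 where f1: "bij_betw f1 {..<s} A" using finA finite_same_card_bij[of "{..<s}" A] by (auto simp: s_def)
  have "card {s..<k} = card ({..<k} - A)" using card_Diff_subset[OF finA Suc.prems(2)] by (simp add: s_def)
  then obtain f2 where f2: "bij_betw f2 {s..<k} ({..<k} - A)" using finite_same_card_bij[of "{s..<k}" "{..<k} - A"] by auto
  \<comment> \<open>The first \<open>s\<close> layers are matched with the elements of
    \<open>A\<close>, the others with the remaining values, so that layer \<open>j\<close>
    corresponds to \<open>A - {\<beta> j}\<close>, of size s - 1 or s. As a bijection of
    \<open>{..<k}\<close>, \<open>\<beta>\<close> turns the sum over layers into the sum over values
    at the last point.\<close>
  define \<beta> where "\<beta> = (\<lambda>j. if j < s then f1 j else f2 j)"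
  have \<beta>A: "\<beta> j \<in> A" if "j < s" for j using f1 that by (auto simp: \<beta>_def bij_betw_def)
  have \<beta>nA: "\<beta> j \<notin> A" if "\<not> j < s" "j < k" for j using f2 that by (auto simp: \<beta>_def bij_betw_def)
  have "bij_betw \<beta> ({..<s} \<union> {s..<k}) (A \<union> ({..<k} - A))"
  proof (rule bij_betw_combine)
    show "bij_betw \<beta> {..<s} A" using f1 by (rule bij_betw_cong[THEN iffD1, rotated]) (simp add: \<beta>_def)
    show "bij_betw \<beta> {s..<k} ({..<k} - A)" using f2 by (rule bij_betw_cong[THEN iffD1, rotated]) (simp add: \<beta>_def)
  qed auto
  moreover have "{..<s} \<union> {s..<k} = {..<k}" "A \<union> ({..<k} - A) = {..<k}" using \<open>s \<le> k\<close> Suc.prems(2) by auto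
  ultimately have \<beta>: "bij_betw \<beta> {..<k} {..<k}" by simp
  have "\<exists>B. finite B \<and> B \<subseteq> Pn n \<and> card B \<le> card (hitting n k (A - {\<beta> j})) \<and> (\<forall>p\<in>Pn n. \<exists>b\<in>PM.span B. p - b \<in> I' j)"
    if j: "j < k" for j
  proof (rule Suc.IH[OF I'])
    show "A - {\<beta> j} \<subseteq> {..<k}" using Suc.prems(2) by auto
    show "pvar i ^ k \<in> I' j" if i: "i \<in> {1..n}" for i
    proof (rule sub_I')
      show "pvar i ^ k \<in> Pn n" by (intro Pn_power Pn_pvar i)
      show "x ^ j * pvar i ^ k \<in> I" using i by (intro poly_idealD(4)[OF Suc.prems(1)] Pn_power xP Suc.prems(3)) simp
    qed
    show "?e' d \<in> I' j" if d: "n < d + card (A - {\<beta> j})" for d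
    proof (cases "j < s")
      case True
      then have "Suc (card (A - {\<beta> j})) = s" unfolding s_def using card_Suc_Diff1[OF finA \<beta>A[OF True]] by simp
      with d show ?thesis by (intro I'_high) simp
    next
      case False
      then have "card (A - {\<beta> j}) = s" using \<beta>nA[OF False j] by (simp add: s_def)
      with d False I'_high[of d j] I'_mid[of d j] show ?thesis by (cases "d + s = Suc n") auto
    qed
  qed
  then have "\<exists>B. \<forall>j\<in>{..<k}. finite (B j) \<and> B j \<subseteq> Pn n \<and> card (B j) \<le> card (hitting n k (A - {\<beta> j})) \<and>
      (\<forall>p\<in>Pn n. \<exists>b\<in>PM.span (B j). p - b \<in> I' j)"
    by (intro bchoice ballI) simp
  then obtain Bs where Bs: "\<And>j. j < k \<Longrightarrow> finite (Bs j)" "\<And>j. j < k \<Longrightarrow> Bs j \<subseteq> Pn n"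
    "\<And>j. j < k \<Longrightarrow> card (Bs j) \<le> card (hitting n k (A - {\<beta> j}))"
    "\<And>j p. j < k \<Longrightarrow> p \<in> Pn n \<Longrightarrow> \<exists>b\<in>PM.span (Bs j). p - b \<in> I' j" by blast
  define B where "B = (\<Union>j<k. (\<lambda>b. x ^ j * b) ` Bs j)"
  have span_mult: "x ^ j * b \<in> PM.span B" if "j < k" "b \<in> PM.span (Bs j)" for j b
    using that(2)
  proof (induction b rule: PM.span_induct)
    case base
    show ?case
    proof (intro PM.subspaceI CollectI)
      show "x ^ j * 0 \<in> PM.span B" by (simp add: PM.span_zero)
    next
      fix a b assume "a \<in> {b. x ^ j * b \<in> PM.span B}" "b \<in> {b. x ^ j * b \<in> PM.span B}"
      then show "x ^ j * (a + b) \<in> PM.span B" by (simp add: distrib_left PM.span_add)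
    next
      fix c b assume "b \<in> {b. x ^ j * b \<in> PM.span B}"
      then have "scl c (x ^ j * b) \<in> PM.span B" by (simp add: PM.span_scale)
      then show "x ^ j * scl c b \<in> PM.span B" unfolding pconst_mult[symmetric] by (simp add: mult.left_commute)
    qed
  next
    case (step b)
    then show ?case using that(1) by (intro PM.span_base) (auto simp: B_def)
  qed
  \<comment> \<open>Descending induction, from \<open>x ^ k\<close>, whose multiples lie in the
    ideal, to the whole ring at \<open>j = 0\<close>.\<close>
  have red: "\<forall>p\<in>Pn (Suc n). \<exists>b\<in>PM.span B. x ^ j * p - b \<in> I" if "j \<le> k" for j
    using that
  proof (induction j rule: inc_induct)
    case base
    show ?case
    proof
      fix p assume p: "p \<in> Pn (Suc n)"
      have "p * x ^ k \<in> I" unfolding x_def by (intro poly_idealD(4)[OF Suc.prems(1) p] Suc.prems(3)) simp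
      then show "\<exists>b\<in>PM.span B. x ^ k * p - b \<in> I" by (intro bexI[of _ 0]) (simp_all add: mult.commute PM.span_zero)
    qed
  next
    case (step j)
    show ?case
    proof
      fix p assume "p \<in> Pn (Suc n)"
      then obtain p' r0 where p: "p' \<in> Pn n" "r0 \<in> Pn (Suc n)" "p = p' + x * r0"
        unfolding x_def by (rule Pn_Suc_split)
      obtain b' where b': "b' \<in> PM.span (Bs j)" "p' - b' \<in> I' j" using Bs(4)[OF step.hyps(2) p(1)] by blast
      then obtain r where r: "r \<in> Pn (Suc n)" "x ^ j * (p' - b') + x ^ Suc j * r \<in> I" unfolding I'_def by blast
      \<comment> \<open>The tail \<open>r\<close> of the witness is charged to the next layer, which
        therefore reduces \<open>r0 - r\<close> in place of \<open>r0\<close>.\<close>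
      have "r0 - r \<in> Pn (Suc n)" using p(2) r(1) by (rule Pn_diff)
      then obtain b'' where b'': "b'' \<in> PM.span B" "x ^ Suc j * (r0 - r) - b'' \<in> I" using step.IH by blast
      have "x ^ j * b' + b'' \<in> PM.span B" using span_mult[OF step.hyps(2) b'(1)] b''(1) by (rule PM.span_add)
      moreover have "x ^ j * p - (x ^ j * b' + b'') = (x ^ j * (p' - b') + x ^ Suc j * r) + (x ^ Suc j * (r0 - r) - b'')"
        unfolding p(3) by (simp add: algebra_simps)
      ultimately show "\<exists>b\<in>PM.span B. x ^ j * p - b \<in> I"
        using poly_idealD(3)[OF Suc.prems(1) r(2) b''(2)] by metis
    qed
  qed
  have "finite B" unfolding B_def using Bs(1) by auto
  moreover have "B \<subseteq> Pn (Suc n)"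
  proof
    fix c assume "c \<in> B"
    then obtain j b where "j < k" "b \<in> Bs j" "c = x ^ j * b" by (auto simp: B_def)
    then show "c \<in> Pn (Suc n)" using Bs(2)[of j] Pn_mult[OF Pn_power[OF xP] Pn_mono] by blast
  qed
  moreover have "card B \<le> card (hitting (Suc n) k A)"
  proof -
    have "card B \<le> (\<Sum>j<k. card ((\<lambda>b. x ^ j * b) ` Bs j))" unfolding B_def by (rule card_UN_le) simp
    also have "\<dots> \<le> (\<Sum>j<k. card (hitting n k (A - {\<beta> j})))"
      by (intro sum_mono order_trans[OF card_image_le]) (use Bs(1,3) in auto)
    also have "\<dots> = (\<Sum>v<k. card (hitting n k (A - {v})))"
      by (rule sum.reindex_bij_betw[OF \<beta>])
    also have "\<dots> \<le> card (hitting (Suc n) k A)" by (rule card_hitting_Suc)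
    finally show ?thesis .
  qed
  ultimately show ?case using red[of 0] by (intro exI[of _ B]) simp
qed

section \<open>Degrees and evaluation\<close>

lemma mpoly_induct [case_names zero add single]:
  fixes p :: "'a \<Rightarrow>\<^sub>0 'b::comm_monoid_add"
  assumes "Q 0" "\<And>p q. Q p \<Longrightarrow> Q q \<Longrightarrow> Q (p + q)" "\<And>m c. Q (sng m c)"
  shows "Q p"
proof -
  have "Q (\<Sum>m\<in>A. sng m (lk p m))" if "finite A" for A
    using that by (induction A rule: finite_induct) (auto simp: assms)
  from this[of "ks p"] show ?thesis by (simp add: poly_mapping_sum_single[symmetric])
qed

definition mdeg :: "(nat \<Rightarrow>\<^sub>0 nat) \<Rightarrow> nat" where
  "mdeg m = (\<Sum>i\<in>ks m. lk m i)"

lemma mdeg_superset: "finite A \<Longrightarrow> ks m \<subseteq> A \<Longrightarrow> mdeg m = (\<Sum>i\<in>A. lk m i)"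
  unfolding mdeg_def by (rule sum.mono_neutral_left) (auto simp: in_keys_iff)

lemma mdeg_add: "mdeg (a + b) = mdeg a + mdeg b"
proof -
  let ?A = "ks a \<union> ks b"
  have "mdeg (a + b) = (\<Sum>i\<in>?A. lk (a + b) i)" by (rule mdeg_superset) (use keys_add[of a b] in auto)
  also have "\<dots> = (\<Sum>i\<in>?A. lk a i) + (\<Sum>i\<in>?A. lk b i)" by (simp add: lookup_add sum.distrib)
  also have "\<dots> = mdeg a + mdeg b" by (intro arg_cong2[where f = "(+)"] mdeg_superset[symmetric]) auto
  finally show ?thesis .
qed

lemma mdeg_0 [simp]: "mdeg 0 = 0" by (simp add: mdeg_def)
lemma mdeg_single [simp]: "mdeg (sng i c) = c" by (cases "c = 0") (simp_all add: mdeg_def)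
lemma mdeg_sum: "mdeg (sum f A) = (\<Sum>a\<in>A. mdeg (f a))"
  by (induction A rule: infinite_finite_induct) (simp_all add: mdeg_add)

lemma lookup_le_mdeg: "lk m i \<le> mdeg m"
proof (cases "i \<in> ks m")
  case True then show ?thesis unfolding mdeg_def by (intro member_le_sum) auto
qed (simp add: in_keys_iff)

lemma finite_monomials:
  assumes "finite A" shows "finite {m. ks m \<subseteq> A \<and> mdeg m < d}"
proof (rule inj_on_finite[where f = "lk"])
  show "inj_on lk {m. ks m \<subseteq> A \<and> mdeg m < d}" by (rule inj_onI) (metis poly_mapping_eqI)
  show "lk ` {m. ks m \<subseteq> A \<and> mdeg m < d} \<subseteq> {f. \<forall>x. (x \<in> A \<longrightarrow> f x \<in> {..<d}) \<and> (x \<notin> A \<longrightarrow> f x = 0)}"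
  proof clarify
    fix m i assume m: "ks m \<subseteq> A" "mdeg m < d"
    have "lk m i < d" using lookup_le_mdeg[of m i] m(2) by simp
    moreover have "lk m i = 0" if "i \<notin> A" using m(1) that by (auto simp: in_keys_iff)
    ultimately show "(i \<in> A \<longrightarrow> lk m i \<in> {..<d}) \<and> (i \<notin> A \<longrightarrow> lk m i = 0)" by blast
  qed
  show "finite {f. \<forall>x. (x \<in> A \<longrightarrow> f x \<in> {..<d}) \<and> (x \<notin> A \<longrightarrow> f x = 0)}"
    by (rule finite_set_of_finite_funs) (auto simp: assms)
qed

text \<open>A strict bound, so that \<open>lowdeg 0\<close> holds for the zero polynomial alone and
  inductions on \<open>d\<close> can start there.\<close>

definition lowdeg :: "nat \<Rightarrow> mpoly \<Rightarrow> bool" where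
  "lowdeg d p \<longleftrightarrow> (\<forall>m\<in>ks p. mdeg m < d)"

lemma lowdeg_0 [simp]: "lowdeg d 0" by (simp add: lowdeg_def)
lemma lowdeg_add: "lowdeg d p \<Longrightarrow> lowdeg d q \<Longrightarrow> lowdeg d (p + q)"
  unfolding lowdeg_def using keys_add[of p q] by blast
lemma lowdeg_diff: "lowdeg d p \<Longrightarrow> lowdeg d q \<Longrightarrow> lowdeg d (p - q)"
  unfolding lowdeg_def using keys_diff[of p q] by blast
lemma lowdeg_mono: "lowdeg d p \<Longrightarrow> d \<le> e \<Longrightarrow> lowdeg e p"
  unfolding lowdeg_def by force
lemma lowdeg_mult: "lowdeg d p \<Longrightarrow> lowdeg (Suc e) q \<Longrightarrow> lowdeg (d + e) (p * q)"
  unfolding lowdeg_def using keys_mult[of p q] by (fastforce simp: mdeg_add)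
lemma lowdeg_scl: "lowdeg d p \<Longrightarrow> lowdeg d (scl c p)"
  unfolding lowdeg_def by (auto simp: in_keys_iff)
lemma lowdeg_single: "mdeg m < d \<Longrightarrow> lowdeg d (sng m c)"
  by (simp add: lowdeg_def)
lemma lowdeg_pvar: "lowdeg 2 (pvar i)" and lowdeg_pconst: "lowdeg 1 (pconst c)"
  by (simp_all add: pvar_def pconst_def lowdeg_single)

lemma ex_lowdeg: "\<exists>d. lowdeg d p"
proof
  have "mdeg m \<le> (\<Sum>m\<in>ks p. mdeg m)" if "m \<in> ks p" for m using that by (intro member_le_sum) auto
  then show "lowdeg (Suc (\<Sum>m\<in>ks p. mdeg m)) p" by (auto simp: lowdeg_def less_Suc_eq_le)
qed

definition homog :: "nat \<Rightarrow> mpoly \<Rightarrow> bool" where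
  "homog d p \<longleftrightarrow> (\<forall>m\<in>ks p. mdeg m = d)"

lemma homog_lowdeg: "homog d p \<Longrightarrow> lowdeg (Suc d) p"
  by (simp add: homog_def lowdeg_def)

definition hom_comp :: "nat \<Rightarrow> mpoly \<Rightarrow> mpoly" where
  "hom_comp d p = (\<Sum>m\<in>{m\<in>ks p. mdeg m = d}. sng m (lk p m))"

lemma lookup_hc: "lk (hom_comp d p) m = (if mdeg m = d then lk p m else 0)"
proof -
  have "lk (hom_comp d p) m = (\<Sum>m'\<in>{m\<in>ks p. mdeg m = d}. if m' = m then lk p m' else 0)"
    unfolding hom_comp_def lookup_sum by (intro sum.cong refl) (simp add: lookup_single when_def)
  then show ?thesis by (auto simp: in_keys_iff)
qed

lemma hc_add: "hom_comp d (p + q) = hom_comp d p + hom_comp d q"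
  by (rule poly_mapping_eqI) (simp add: lookup_hc lookup_add)
lemma hc_0 [simp]: "hom_comp d 0 = 0"
  by (rule poly_mapping_eqI) (simp add: lookup_hc)
lemma hc_single: "hom_comp d (sng m c) = (if mdeg m = d then sng m c else 0)"
  by (rule poly_mapping_eqI) (simp add: lookup_hc lookup_single when_def)
lemma hc_homog: "homog e p \<Longrightarrow> hom_comp d p = (if d = e then p else 0)"
  by (rule poly_mapping_eqI) (auto simp: lookup_hc homog_def in_keys_iff)
lemma homog_hc: "homog d (hom_comp d p)"
  by (auto simp: homog_def lookup_hc in_keys_iff split: if_splits)

lemma hc_single_mult:
  "hom_comp d (sng a c * p) = (if mdeg a \<le> d then sng a c * hom_comp (d - mdeg a) p else 0)"
proof (induction p rule: mpoly_induct)
  case (single m e)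
  show ?case by (auto simp: mult_single hc_single mdeg_add)
qed (auto simp: hc_add distrib_left)

section \<open>Evaluation of polynomials at a point\<close>

definition meval :: "(nat \<Rightarrow> rat) \<Rightarrow> (nat \<Rightarrow>\<^sub>0 nat) \<Rightarrow> rat" where
  "meval a m = (\<Prod>i\<in>ks m. a i ^ lk m i)"

definition eval :: "(nat \<Rightarrow> rat) \<Rightarrow> mpoly \<Rightarrow> rat" where
  "eval a p = (\<Sum>m\<in>ks p. lk p m * meval a m)"

lemma meval_superset: "finite A \<Longrightarrow> ks m \<subseteq> A \<Longrightarrow> meval a m = (\<Prod>i\<in>A. a i ^ lk m i)"
  unfolding meval_def by (rule prod.mono_neutral_left) (auto simp: in_keys_iff)

lemma meval_add: "meval a (m + m') = meval a m * meval a m'"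
proof -
  let ?A = "ks m \<union> ks m'"
  have "meval a (m + m') = (\<Prod>i\<in>?A. a i ^ lk (m + m') i)" by (rule meval_superset) (use keys_add[of m m'] in auto)
  also have "\<dots> = (\<Prod>i\<in>?A. a i ^ lk m i) * (\<Prod>i\<in>?A. a i ^ lk m' i)" by (simp add: lookup_add power_add prod.distrib)
  also have "\<dots> = meval a m * meval a m'" by (intro arg_cong2[where f = "(*)"] meval_superset[symmetric]) auto
  finally show ?thesis .
qed

lemma eval_superset: "finite A \<Longrightarrow> ks p \<subseteq> A \<Longrightarrow> eval a p = (\<Sum>m\<in>A. lk p m * meval a m)"
  unfolding eval_def by (rule sum.mono_neutral_left) (auto simp: in_keys_iff)

lemma eval_0 [simp]: "eval a 0 = 0" by (simp add: eval_def)

lemma eval_add: "eval a (p + q) = eval a p + eval a q"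
proof -
  let ?A = "ks p \<union> ks q"
  have "eval a (p + q) = (\<Sum>m\<in>?A. lk (p + q) m * meval a m)" by (rule eval_superset) (use keys_add[of p q] in auto)
  also have "\<dots> = (\<Sum>m\<in>?A. lk p m * meval a m) + (\<Sum>m\<in>?A. lk q m * meval a m)"
    by (simp add: lookup_add distrib_right sum.distrib)
  also have "\<dots> = eval a p + eval a q" by (intro arg_cong2[where f = "(+)"] eval_superset[symmetric]) auto
  finally show ?thesis .
qed

lemma eval_single: "eval a (sng m c) = c * meval a m"
  by (cases "c = 0") (simp_all add: eval_def)

lemma eval_mult: "eval a (p * q) = eval a p * eval a q"
proof (induction p rule: mpoly_induct)
  case (single m c)
  show ?case
  proof (induction q rule: mpoly_induct)
    case (single m' c')
    show ?case by (simp add: mult_single eval_single meval_add)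
  qed (simp_all add: distrib_left eval_add)
qed (simp_all add: distrib_right eval_add)

lemma eval_pvar [simp]: "eval a (pvar i) = a i"
  by (simp add: pvar_def eval_single meval_def)
lemma eval_pconst [simp]: "eval a (pconst c) = c"
  by (simp add: pconst_def eval_single meval_def)
lemma eval_scl: "eval a (scl c p) = c * eval a p"
  unfolding pconst_mult[symmetric] eval_mult eval_pconst ..
lemma eval_diff: "eval a (p - q) = eval a p - eval a q"
  using eval_add[of a "p - q" q] by simp
lemma eval_sum: "eval a (sum f A) = (\<Sum>x\<in>A. eval a (f x))"
  by (induction A rule: infinite_finite_induct) (simp_all add: eval_add)
lemma eval_1 [simp]: "eval a 1 = 1"
  using eval_pconst[of a 1] by (simp add: pconst_def)
lemma eval_prod: "eval a (prod f A) = (\<Prod>x\<in>A. eval a (f x))"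
  by (induction A rule: infinite_finite_induct) (simp_all add: eval_mult)

lemma eval_cong:
  assumes "p \<in> Pn n" "\<And>i. i \<in> {1..n} \<Longrightarrow> a i = b i" shows "eval a p = eval b p"
  unfolding eval_def
proof (intro sum.cong refl arg_cong2[where f = "(*)"])
  fix m assume "m \<in> ks p"
  then have "ks m \<subseteq> {1..n}" using assms(1) by (auto simp: Pn_def)
  then show "meval a m = meval b m" unfolding meval_def using assms(2) by (intro prod.cong) auto
qed

lemma eval_esym: "eval a (esym f S d) = esym (\<lambda>i. eval a (f i)) S d"
  by (simp add: esym_def eval_sum eval_prod)

lemma pvar_prod: "finite T \<Longrightarrow> (\<Prod>i\<in>T. pvar i) = sng (\<Sum>i\<in>T. sng i 1) 1"
  by (induction T rule: finite_induct) (simp_all add: pvar_def mult_single)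

lemma homog_esym: "finite S \<Longrightarrow> homog d (esym pvar S d)"
  unfolding homog_def
proof
  fix m assume S: "finite S" and m: "m \<in> ks (esym pvar S d)"
  obtain T where T: "T \<subseteq> S" "card T = d" "m \<in> ks (\<Prod>i\<in>T. pvar i)"
    using m unfolding esym_def using keys_sum[of "\<lambda>T. \<Prod>i\<in>T. pvar i" "{T. T \<subseteq> S \<and> card T = d}"] by blast
  then have "m = (\<Sum>i\<in>T. sng i 1)" unfolding pvar_prod[OF finite_subset[OF T(1) S]] by (simp only: keys_single one_neq_zero if_False singleton_iff)
  then show "mdeg m = d" using T(2) by (simp add: mdeg_sum)
qed

lemma pvar_power: "pvar i ^ k = sng (sng i k) 1"
proof (induction k)
  case (Suc k)
  then show ?case by (simp add: pvar_def mult_single flip: single_add)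
qed simp

lemma homog_pvar_power: "homog k (pvar i ^ k)"
  by (simp add: pvar_power homog_def)

section \<open>The point locus\<close>

definition locus_point :: "(nat \<Rightarrow> nat) \<Rightarrow> nat \<Rightarrow> rat" where
  "locus_point \<rho> i = of_nat (\<rho> i)"

definition vanishing :: "nat \<Rightarrow> nat \<Rightarrow> mpoly set" where
  "vanishing n k = {q \<in> Pn n. \<forall>\<rho>. \<rho> ` {1..n} = {..<k} \<longrightarrow> eval (locus_point \<rho>) q = 0}"

text \<open>For \<open>g\<close> homogeneous of degree \<open>d\<close> this says that
  \<open>g\<close> is zero or the leading form of a polynomial vanishing on the locus. Admitting
  zero keeps the property additive when leading forms cancel.\<close>

definition is_lead :: "nat \<Rightarrow> nat \<Rightarrow> nat \<Rightarrow> mpoly \<Rightarrow> bool" where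
  "is_lead n k d g \<longleftrightarrow> (\<exists>q\<in>vanishing n k. lowdeg d (q - g))"

lemma is_lead_0: "is_lead n k d 0"
  unfolding is_lead_def by (intro bexI[of _ 0]) (simp_all add: vanishing_def)

lemma is_lead_add: "is_lead n k d g \<Longrightarrow> is_lead n k d h \<Longrightarrow> is_lead n k d (g + h)"
proof -
  assume "is_lead n k d g" "is_lead n k d h"
  then obtain q r where *: "q \<in> vanishing n k" "r \<in> vanishing n k" "lowdeg d (q - g)" "lowdeg d (r - h)"
    unfolding is_lead_def by blast
  have "q + r \<in> vanishing n k" using *(1,2) by (simp add: vanishing_def eval_add Pn_add)
  moreover have "lowdeg d ((q + r) - (g + h))" using lowdeg_add[OF *(3,4)] by (simp add: algebra_simps)
  ultimately show ?thesis unfolding is_lead_def by blast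
qed

lemma is_lead_single_mult:
  assumes "is_lead n k d g" "ks a \<subseteq> {1..n}"
  shows "is_lead n k (mdeg a + d) (sng a c * g)"
proof -
  obtain q where q: "q \<in> vanishing n k" "lowdeg d (q - g)" using assms(1) unfolding is_lead_def by blast
  have "sng a c * q \<in> vanishing n k" using q(1) Pn_mult[OF Pn_single[OF assms(2)]] by (simp add: vanishing_def eval_mult)
  moreover have "lowdeg (d + mdeg a) ((q - g) * sng a c)" by (rule lowdeg_mult[OF q(2) lowdeg_single]) simp
  then have "lowdeg (mdeg a + d) (sng a c * q - sng a c * g)" by (simp add: algebra_simps)
  ultimately show ?thesis unfolding is_lead_def by blast
qed

text \<open>The coordinates of the points lie in 0, ..., k - 1, so the product of the factors
  \<open>pvar i - pconst (of_nat j)\<close> over these \<open>j\<close> vanishes on the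
  locus.\<close>

lemma lead_pvar_power:
  assumes "i \<in> {1..n}" shows "is_lead n k k (pvar i ^ k)"
proof -
  define q where "q = (\<lambda>k. \<Prod>j<k. pvar i - pconst (of_nat j))"
  have "lowdeg k (q k - pvar i ^ k)" for k
  proof (induction k)
    case (Suc k)
    have x: "lowdeg 2 (pvar i - pconst (of_nat k))"
      by (intro lowdeg_diff lowdeg_pvar lowdeg_mono[OF lowdeg_pconst]) simp
    have "lowdeg (k + 1) ((q k - pvar i ^ k) * (pvar i - pconst (of_nat k)))"
      by (rule lowdeg_mult[OF Suc.IH]) (use x in \<open>simp add: numeral_2_eq_2\<close>)
    moreover have "lowdeg (Suc k + 0) (pvar i ^ k * pconst (of_nat k))"
      by (rule lowdeg_mult[OF homog_lowdeg[OF homog_pvar_power]]) (use lowdeg_pconst in simp)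
    ultimately have "lowdeg (Suc k) ((q k - pvar i ^ k) * (pvar i - pconst (of_nat k)) - pvar i ^ k * pconst (of_nat k))"
      by (intro lowdeg_diff) simp_all
    then show ?case by (simp add: q_def algebra_simps)
  qed (simp add: q_def)
  moreover have "q k \<in> vanishing n k"
    unfolding vanishing_def
  proof (intro CollectI conjI allI impI)
    show "q k \<in> Pn n" unfolding q_def by (intro Pn_prod Pn_diff Pn_pvar Pn_pconst assms)
    fix \<rho> assume "\<rho> ` {1..n} = {..<k}"
    then have "\<rho> i \<in> {..<k}" using assms by blast
    then show "eval (locus_point \<rho>) (q k) = 0"
      unfolding q_def eval_prod by (intro prod_zero) (auto simp: eval_diff locus_point_def)
  qed
  ultimately show ?thesis unfolding is_lead_def by blast
qed

text \<open>The generating function of the elementary symmetric polynomials is divided by \<open>1 + j t\<close> for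
  \<open>j = 0, \<dots>, i - 1\<close>; at a point of the locus only \<open>n - i\<close> factors remain.\<close>

fun esym_red :: "nat \<Rightarrow> nat \<Rightarrow> nat \<Rightarrow> mpoly" where
  "esym_red n 0 d = esym pvar {1..n} d"
| "esym_red n (Suc i) 0 = 1"
| "esym_red n (Suc i) (Suc d) = esym_red n i (Suc d) - pconst (of_nat i) * esym_red n (Suc i) d"

lemma esym_red_Pn: "esym_red n i d \<in> Pn n"
proof (induction n i d rule: esym_red.induct)
  case (1 n d)
  show ?case by (simp add: Pn_esym)
next
  case (3 n i d)
  then show ?case by (simp add: Pn_diff Pn_mult Pn_pconst)
qed simp

lemma esym_red_lowdeg: "lowdeg d (esym_red n i d - esym pvar {1..n} d)"
proof (induction n i d rule: esym_red.induct)
  case (2 n i)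
  show ?case by (simp add: esym_zero)
next
  case (3 n i d)
  have "lowdeg (Suc d) (esym_red n (Suc i) d - esym pvar {1..n} d + esym pvar {1..n} d)"
    by (intro lowdeg_add lowdeg_mono[OF 3(2)] homog_lowdeg homog_esym) simp_all
  then have "lowdeg (Suc d + 0) (esym_red n (Suc i) d * pconst (of_nat i))"
    by (intro lowdeg_mult) (use lowdeg_pconst in simp_all)
  then have "lowdeg (Suc d) (pconst (of_nat i) * esym_red n (Suc i) d)" by (simp add: mult.commute)
  from lowdeg_diff[OF 3(1) this] show ?case by (simp add: algebra_simps)
qed simp

text \<open>\<open>y j\<close> is a coordinate with value \<open>j\<close>. Solving
  \<open>esym_insert\<close> for the smaller index set gives exactly the recursion of
  \<open>esym_red\<close>, so each division removes one such coordinate.\<close>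

lemma eval_esym_red:
  assumes y: "inj_on y {..<k}" "y ` {..<k} \<subseteq> {1..n}" "\<And>j. j < k \<Longrightarrow> a (y j) = of_nat j"
  shows "i \<le> k \<Longrightarrow> eval a (esym_red n i d) = esym a ({1..n} - y ` {..<i}) d"
proof (induction i arbitrary: d)
  case 0
  show ?case by (simp add: eval_esym)
next
  case (Suc i)
  note IH = Suc.IH and le = Suc.prems
  show ?case
  proof (induction d)
    case 0
    show ?case by (simp add: esym_zero)
  next
    case (Suc d)
    let ?S = "{1..n} - y ` {..<Suc i}"
    have "y i \<notin> y ` {..<i}"
    proof
      assume "y i \<in> y ` {..<i}"
      then obtain x where "x < i" "y x = y i" by auto
      with inj_onD[OF y(1), of x i] le show False by simp
    qed
    moreover have "y i \<in> {1..n}" using subsetD[OF y(2) imageI[of i]] le by simp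
    ultimately have "{1..n} - y ` {..<i} = insert (y i) ?S" by (auto simp: lessThan_Suc)
    then have "esym a ({1..n} - y ` {..<i}) (Suc d) = esym a ?S (Suc d) + of_nat i * esym a ?S d"
      using esym_insert[of ?S "y i" a d] y(3)[of i] le by simp
    then show ?case using Suc.IH IH[of "Suc d"] le
      by (simp add: eval_diff eval_mult)
  qed
qed

text \<open>After removal of one coordinate for each of the \<open>k\<close> values only n - k
  remain, too few for degree \<open>d\<close>.\<close>

lemma lead_elem_sym:
  assumes "k \<le> n" "d \<in> {n - k + 1..n}" shows "is_lead n k d (elem_sym n d)"
proof -
  have "esym_red n k d \<in> vanishing n k"
    unfolding vanishing_def
  proof (intro CollectI conjI allI impI esym_red_Pn)
    fix \<rho> assume \<rho>: "\<rho> ` {1..n} = {..<k}"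
    define y where "y = (\<lambda>j. SOME i. i \<in> {1..n} \<and> \<rho> i = j)"
    have y: "y j \<in> {1..n} \<and> \<rho> (y j) = j" if "j < k" for j
    proof -
      have "j \<in> \<rho> ` {1..n}" using \<rho> that by simp
      then have "\<exists>i. i \<in> {1..n} \<and> \<rho> i = j" by blast
      then show ?thesis unfolding y_def by (rule someI_ex)
    qed
    have inj: "inj_on y {..<k}" using y by (metis inj_onI lessThan_iff)
    have "eval (locus_point \<rho>) (esym_red n k d) = esym (locus_point \<rho>) ({1..n} - y ` {..<k}) d"
      by (rule eval_esym_red[OF inj]) (use y in \<open>auto simp: locus_point_def\<close>)
    also have "\<dots> = 0"
    proof (rule esym_gt)
      have "card ({1..n} - y ` {..<k}) = n - k"
        using y by (subst card_Diff_subset) (auto simp: card_image[OF inj])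
      then show "card ({1..n} - y ` {..<k}) < d" using assms by simp
    qed simp
    finally show "eval (locus_point \<rho>) (esym_red n k d) = 0" .
  qed
  with esym_red_lowdeg show ?thesis unfolding is_lead_def elem_sym_esym by blast
qed

text \<open>The elements of the ideal all of whose homogeneous components are in the ideal and
  satisfy \<open>is_lead\<close> form an ideal \<open>J\<close>; it suffices that multiplication by
  a monomial shifts components. Since \<open>J\<close> contains the homogeneous generators, it is
  everything.\<close>

lemma I_ideal_graded:
  assumes "k \<le> n" "p \<in> I_ideal n k"
  shows "hom_comp d p \<in> I_ideal n k" "is_lead n k d (hom_comp d p)"
proof -
  let ?I = "I_ideal n k"
  define J where "J = {p\<in>?I. \<forall>d. hom_comp d p \<in> ?I \<and> is_lead n k d (hom_comp d p)}"
  note I = poly_idealD[OF isid_I_ideal[of n k]]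
  have single: "sng a c * x \<in> J" if "x \<in> J" "ks a \<subseteq> {1..n}" for a c x
    unfolding J_def
  proof (intro CollectI conjI allI)
    show "sng a c * x \<in> ?I" using that by (intro I(4) Pn_single) (simp_all add: J_def)
    fix d
    show "hom_comp d (sng a c * x) \<in> ?I" unfolding hc_single_mult
      using that I(2) by (auto intro!: I(4) Pn_single simp: J_def)
    show "is_lead n k d (hom_comp d (sng a c * x))"
    proof (cases "mdeg a \<le> d")
      case True
      have "is_lead n k (mdeg a + (d - mdeg a)) (sng a c * hom_comp (d - mdeg a) x)"
        using that by (intro is_lead_single_mult) (simp_all add: J_def)
      with True show ?thesis by (simp add: hc_single_mult)
    qed (simp add: hc_single_mult is_lead_0)
  qed
  have add: "x + y \<in> J" if "x \<in> J" "y \<in> J" for x y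
    using that by (simp add: J_def hc_add I(3) is_lead_add)
  have zero: "0 \<in> J" by (simp add: J_def I(2) is_lead_0)
  have "poly_ideal n J"
    unfolding poly_ideal_def
  proof (intro conjI ballI)
    show "J \<subseteq> Pn n" using I(1) by (auto simp: J_def)
    fix r x assume "r \<in> Pn n" "x \<in> J"
    then show "r * x \<in> J"
      by (induction r rule: Pn_induct) (simp_all add: zero add single distrib_right)
  qed (use zero add in auto)
  moreover have gen: "g \<in> J" if g: "g \<in> ?I" "homog e g" "is_lead n k e g" for g e
    unfolding J_def using g by (simp add: hc_homog I(2) is_lead_0)
  have "ideal_gens n k \<subseteq> J"
  proof
    fix g assume g: "g \<in> ideal_gens n k"
    then have "g \<in> ?I" using gens_I_ideal by blast
    from g consider i where "i \<in> {1..n}" "g = pvar i ^ k" | d where "d \<in> {n - k + 1..n}" "g = elem_sym n d" by blast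
    then show "g \<in> J"
    proof cases
      case 1
      with \<open>g \<in> ?I\<close> show ?thesis using gen[of g k] lead_pvar_power homog_pvar_power by simp
    next
      case 2
      with \<open>g \<in> ?I\<close> show ?thesis
        using gen[of g d] lead_elem_sym[OF assms(1) 2(1)] homog_esym[of "{1..n}" d] by (simp add: elem_sym_esym)
    qed
  qed
  ultimately have "?I \<subseteq> J" by (rule I_ideal_minimal)
  with assms(2) show "hom_comp d p \<in> ?I" "is_lead n k d (hom_comp d p)" by (auto simp: J_def)
qed

section \<open>The quotient ring as a permutation module\<close>

definition pact :: "(nat \<Rightarrow> nat) \<Rightarrow> mpoly \<Rightarrow> mpoly" where
  "pact \<pi> = push (push \<pi>)"

lemma push_mult_hom:
  fixes p q :: "'a::monoid_add \<Rightarrow>\<^sub>0 'c::semiring_0"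
  assumes "\<And>a b. \<phi> (a + b) = \<phi> a + (\<phi> b :: 'b::monoid_add)"
  shows "push \<phi> (p * q) = push \<phi> p * push \<phi> q"
proof (induction p rule: mpoly_induct)
  case (single m c)
  show ?case
  proof (induction q rule: mpoly_induct)
    case (single m' c')
    show ?case by (simp add: mult_single assms)
  qed (simp_all add: distrib_left push_add)
qed (simp_all add: distrib_right push_add)

lemma pact_add: "pact \<pi> (p + q) = pact \<pi> p + pact \<pi> q"
  and pact_diff: "pact \<pi> (p - q) = pact \<pi> p - pact \<pi> q"
  and pact_0 [simp]: "pact \<pi> 0 = 0"
  and pact_sum: "pact \<pi> (sum f A) = (\<Sum>a\<in>A. pact \<pi> (f a))"
  and pact_single [simp]: "pact \<pi> (sng m c) = sng (push \<pi> m) c"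
  by (simp_all add: pact_def push_add push_diff push_sum)

lemma pact_mult: "pact \<pi> (p * q) = pact \<pi> p * pact \<pi> q"
  unfolding pact_def by (rule push_mult_hom) (rule push_add)

lemma pact_1 [simp]: "pact \<pi> 1 = 1"
  using pact_single[of \<pi> 0 1] by simp

lemma pact_prod: "pact \<pi> (prod f A) = (\<Prod>a\<in>A. pact \<pi> (f a))"
  by (induction A rule: infinite_finite_induct) (simp_all add: pact_mult)

lemma pact_power: "pact \<pi> (p ^ j) = pact \<pi> p ^ j"
  by (induction j) (simp_all add: pact_mult)

lemma pact_pvar [simp]: "pact \<pi> (pvar i) = pvar (\<pi> i)"
  by (simp add: pvar_def)

lemma pact_pact: "pact \<sigma> (pact \<tau> p) = pact (\<sigma> \<circ> \<tau>) p"
proof -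
  have "push \<sigma> \<circ> push \<tau> = (push (\<sigma> \<circ> \<tau>) :: (nat \<Rightarrow>\<^sub>0 nat) \<Rightarrow> _)" by (rule ext) (simp add: push_push)
  then show ?thesis by (simp add: pact_def push_push)
qed

lemma pact_id [simp]: "pact id p = p"
  by (simp add: pact_def push_id_on)

lemma pact_Pn: "\<pi> permutes {1..n} \<Longrightarrow> p \<in> Pn n \<Longrightarrow> pact \<pi> p \<in> Pn n"
proof -
  assume \<pi>: "\<pi> permutes {1..n}" and p: "p \<in> Pn n"
  show ?thesis using p
  proof (induction p rule: Pn_induct)
    case (single m c)
    have "ks (push \<pi> m) \<subseteq> \<pi> ` {1..n}" using keys_push[of \<pi> m] single by blast
    then show ?case unfolding permutes_image[OF \<pi>] pact_single by (rule Pn_single)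
  qed (simp_all add: pact_add Pn_add)
qed

lemma ip_pact:
  assumes "\<pi> permutes S" shows "ip (pact \<pi> p) (pact \<pi> q) = ip p q"
proof -
  have "inj (push \<pi> :: (nat \<Rightarrow>\<^sub>0 nat) \<Rightarrow> _)"
    by (rule inj_on_inverseI[of _ "push (pinv \<pi>)"]) (simp add: push_push permutes_inv_o[OF assms] push_id_on)
  then show ?thesis unfolding pact_def by (rule ip_push) auto
qed

text \<open>The preimage of the ideal under the ring map \<open>pact \<pi>\<close> is an ideal. It
  contains the generators because \<open>\<pi>\<close> permutes the powers and fixes the elementary
  symmetric polynomials.\<close>

lemma pact_I_ideal:
  assumes \<pi>: "\<pi> permutes {1..n}" and x: "x \<in> I_ideal n k"
  shows "pact \<pi> x \<in> I_ideal n k"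
proof -
  note I = poly_idealD[OF isid_I_ideal[of n k]]
  define J where "J = {p \<in> Pn n. pact \<pi> p \<in> I_ideal n k}"
  have "poly_ideal n J"
    unfolding poly_ideal_def J_def using I(2,3,4) pact_Pn[OF \<pi>]
    by (auto simp: pact_add pact_mult Pn_add Pn_mult)
  moreover have "ideal_gens n k \<subseteq> J"
  proof
    fix g assume g: "g \<in> ideal_gens n k"
    then have gP: "g \<in> Pn n" using gens_Pn by blast
    have "pact \<pi> g \<in> ideal_gens n k"
    proof -
      from g consider i where "i \<in> {1..n}" "g = pvar i ^ k" | d where "d \<in> {n - k + 1..n}" "g = elem_sym n d" by blast
      then show ?thesis
      proof cases
        case 1
        then have "\<pi> i \<in> {1..n}" using permutes_in_image[OF \<pi>] by blast
        then show ?thesis using 1 by (simp add: pact_power)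
      next
        case 2
        have "pact \<pi> (esym pvar {1..n} d) = esym pvar {1..n} d"
          unfolding esym_def pact_sum pact_prod pact_pvar
        proof (rule sum.reindex_bij_witness[of _ "image (pinv \<pi>)" "image \<pi>"])
          fix T assume T: "T \<in> {T. T \<subseteq> {1..n} \<and> card T = d}"
          show "pinv \<pi> ` \<pi> ` T = T" "\<pi> ` pinv \<pi> ` T = T"
            using permutes_inv_o[OF \<pi>] by (simp_all add: image_comp)
          show "\<pi> ` T \<in> {T. T \<subseteq> {1..n} \<and> card T = d}"
            using T permutes_image[OF \<pi>] by (auto simp: card_image[OF permutes_inj_on[OF \<pi>]])
          show "pinv \<pi> ` T \<in> {T. T \<subseteq> {1..n} \<and> card T = d}"
            using T permutes_image[OF permutes_inv[OF \<pi>]] by (auto simp: card_image[OF permutes_inj_on[OF permutes_inv[OF \<pi>]]])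
          show "(\<Prod>i\<in>\<pi> ` T. pvar i) = (\<Prod>i\<in>T. pvar (\<pi> i))"
            using prod.reindex[OF permutes_inj_on[OF \<pi>, of T], of pvar] by (simp add: o_def)
        qed
        with 2 g show ?thesis by (simp add: elem_sym_esym)
      qed
    qed
    with gens_I_ideal gP show "g \<in> J" unfolding J_def by blast
  qed
  ultimately have "I_ideal n k \<subseteq> J" by (rule I_ideal_minimal)
  with x show ?thesis by (auto simp: J_def)
qed

text \<open>Permutations of the variables permute the orthonormal monomials and preserve the ideal,
  so this complement is stable (\<open>pact_harmonics\<close>).\<close>

definition harmonics :: "nat \<Rightarrow> nat \<Rightarrow> mpoly set" where
  "harmonics n k = {c \<in> Pn n. \<forall>j\<in>I_ideal n k. ip c j = 0}"

lemma harmonics_Pn: "c \<in> harmonics n k \<Longrightarrow> c \<in> Pn n"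
  by (simp add: harmonics_def)

lemma subspace_harmonics: "PM.subspace (harmonics n k)"
  by (rule PM.subspaceI) (auto simp: harmonics_def Pn_add Pn_scl ip_add_left ip_scl_left)

lemma harmonics_I_ideal: "c \<in> harmonics n k \<Longrightarrow> c \<in> I_ideal n k \<Longrightarrow> c = 0"
  unfolding harmonics_def using ip_self_eq_0[of c] by blast

lemma pact_harmonics:
  assumes \<pi>: "\<pi> permutes {1..n}" and c: "c \<in> harmonics n k"
  shows "pact \<pi> c \<in> harmonics n k"
  unfolding harmonics_def
proof (intro CollectI conjI ballI)
  show "pact \<pi> c \<in> Pn n" by (rule pact_Pn[OF \<pi> harmonics_Pn[OF c]])
  fix j assume j: "j \<in> I_ideal n k"
  have "pact \<pi> (pact (pinv \<pi>) j) = j" by (simp add: pact_pact permutes_inv_o[OF \<pi>])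
  then have "ip (pact \<pi> c) j = ip c (pact (pinv \<pi>) j)" using ip_pact[OF \<pi>] by metis
  also have "\<dots> = 0" using c pact_I_ideal[OF permutes_inv[OF \<pi>] j] by (simp add: harmonics_def)
  finally show "ip (pact \<pi> c) j = 0" .
qed

text \<open>The polynomial ring has infinite dimension, so the projection takes place among
  polynomials of degree below \<open>d\<close>. Because the ideal is graded, orthogonality to its
  elements of low degree implies orthogonality to all of it.\<close>

lemma harmonic_part:
  assumes "k \<le> n" "p \<in> Pn n" "lowdeg d p"
  obtains c where "c \<in> harmonics n k" "p - c \<in> I_ideal n k" "lowdeg d (p - c)"
proof -
  note I = poly_idealD[OF isid_I_ideal[of n k]]
  define Y where "Y = {x \<in> I_ideal n k. lowdeg d x}"
  have Y: "PM.subspace Y" unfolding Y_def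
    by (rule PM.subspaceI) (auto simp: I lowdeg_add lowdeg_scl)
  have "Y \<subseteq> {f. ks f \<subseteq> {m. ks m \<subseteq> {1..n} \<and> mdeg m < d}}"
    using I(1) unfolding Y_def lowdeg_def Pn_def by blast
  from orth_proj[OF Y finite_monomials[OF finite_atLeastAtMost] this] obtain y where
    y: "y \<in> Y" "\<And>s. s \<in> Y \<Longrightarrow> ip (p - y) s = 0" by metis
  have low: "lowdeg d (p - y)" using assms(3) y(1) by (intro lowdeg_diff) (auto simp: Y_def)
  have "ip (p - y) j = 0" if j: "j \<in> I_ideal n k" for j
  proof -
    \<comment> \<open>The truncation of \<open>j\<close> to degrees below \<open>d\<close>: it stays
      in the ideal and has the same inner product with \<open>p - y\<close>, which has no monomial
      of higher degree.\<close>
    define j' where "j' = (\<Sum>e<d. hom_comp e j)"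
    have "j' \<in> Y" unfolding j'_def
    proof (rule PM.subspace_sum[OF Y])
      fix e assume "e \<in> {..<d}"
      then show "hom_comp e j \<in> Y"
        using I_ideal_graded(1)[OF assms(1) j] lowdeg_mono[OF homog_lowdeg[OF homog_hc], of e d] by (simp add: Y_def)
    qed
    then have "ip (p - y) j' = 0" by (rule y(2))
    moreover have "ip (p - y) j' = ip (p - y) j"
      unfolding ip_def
    proof (intro sum.cong refl arg_cong2[where f = "(*)"])
      fix m assume "m \<in> ks (p - y)"
      then have "mdeg m < d" using low by (simp add: lowdeg_def)
      then show "lk j' m = lk j m" by (simp add: j'_def lookup_sum lookup_hc)
    qed
    ultimately show ?thesis by simp
  qed
  then have "p - y \<in> harmonics n k"
    using assms(2) y(1) I(1) by (auto simp: harmonics_def Y_def intro: Pn_diff)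
  then show ?thesis using that[of "p - y"] y(1) by (simp add: Y_def)
qed

text \<open>Split \<open>p\<close> into a harmonic part and an element \<open>i\<close> of the
  ideal. The top component of \<open>i\<close> is matched by some \<open>q\<close> vanishing on the
  locus, so \<open>i - q\<close> has the values of \<open>i\<close> but lower degree, and the
  induction continues with it.\<close>

lemma harmonic_eval:
  assumes kn: "k \<le> n"
  shows "p \<in> Pn n \<Longrightarrow> lowdeg d p \<Longrightarrow>
    \<exists>c\<in>harmonics n k. \<forall>\<rho>. \<rho> ` {1..n} = {..<k} \<longrightarrow> eval (locus_point \<rho>) c = eval (locus_point \<rho>) p"
proof (induction d arbitrary: p)
  case 0
  then have "p = 0" by (auto simp: lowdeg_def simp flip: keys_eq_empty)
  then show ?case using PM.subspace_0[OF subspace_harmonics] by (intro bexI[of _ 0]) simp_all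
next
  case (Suc d)
  obtain c where c: "c \<in> harmonics n k" "p - c \<in> I_ideal n k" "lowdeg (Suc d) (p - c)"
    using harmonic_part[OF kn Suc.prems] .
  define i where "i = p - c"
  obtain q where q: "q \<in> vanishing n k" "lowdeg d (q - hom_comp d i)"
    using I_ideal_graded(2)[OF kn c(2), of d] unfolding is_lead_def i_def by blast
  have "lowdeg d (i - hom_comp d i)"
    using c(3) by (auto simp: i_def[symmetric] lowdeg_def in_keys_iff lookup_minus lookup_hc less_Suc_eq split: if_splits)
  from lowdeg_diff[OF this q(2)] have low: "lowdeg d (i - q)" by simp
  have qP: "q \<in> Pn n" using q(1) by (simp add: vanishing_def)
  have "i - q \<in> Pn n" unfolding i_def by (intro Pn_diff Suc.prems harmonics_Pn[OF c(1)] qP)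
  then obtain c' where c': "c' \<in> harmonics n k" "\<forall>\<rho>. \<rho> ` {1..n} = {..<k} \<longrightarrow> eval (locus_point \<rho>) c' = eval (locus_point \<rho>) (i - q)"
    using Suc.IH low by blast
  show ?case
  proof (intro bexI allI impI)
    show "c + c' \<in> harmonics n k" by (rule PM.subspace_add[OF subspace_harmonics c(1) c'(1)])
    fix \<rho> assume \<rho>: "\<rho> ` {1..n} = {..<k}"
    then have "eval (locus_point \<rho>) q = 0" using q(1) by (simp add: vanishing_def)
    then show "eval (locus_point \<rho>) (c + c') = eval (locus_point \<rho>) p"
      using c'(2) \<rho> by (simp add: eval_add eval_diff i_def)
  qed
qed

section \<open>Evaluation on ordered set partitions\<close>

definition row_fun :: "nat \<Rightarrow> nat \<Rightarrow> nat set list \<Rightarrow> nat \<Rightarrow> nat" where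
  "row_fun n k B = (SOME \<rho>. B = tab k n \<rho> \<and> \<rho> ` {1..n} = {..<k})"

definition evOP :: "nat \<Rightarrow> nat \<Rightarrow> mpoly \<Rightarrow> nat set list \<Rightarrow>\<^sub>0 rat" where
  "evOP n k c = (\<Sum>B\<in>ordered_set_partitions n k. sng B (eval (locus_point (row_fun n k B)) c))"

lemma row_fun:
  assumes "B \<in> ordered_set_partitions n k"
  shows "B = tab k n (row_fun n k B)" "row_fun n k B ` {1..n} = {..<k}"
proof -
  have "\<exists>\<rho>. B = tab k n \<rho> \<and> \<rho> ` {1..n} = {..<k}" using osp_tab[OF assms] by metis
  then have "B = tab k n (row_fun n k B) \<and> row_fun n k B ` {1..n} = {..<k}" unfolding row_fun_def by (rule someI_ex)
  then show "B = tab k n (row_fun n k B)" "row_fun n k B ` {1..n} = {..<k}" by auto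
qed

lemma lookup_evOP:
  "lk (evOP n k c) B = (if B \<in> ordered_set_partitions n k then eval (locus_point (row_fun n k B)) c else 0)"
proof -
  have "lk (evOP n k c) B = (\<Sum>B'\<in>ordered_set_partitions n k. if B' = B then eval (locus_point (row_fun n k B')) c else 0)"
    unfolding evOP_def lookup_sum by (intro sum.cong refl) (simp add: lookup_single when_def)
  then show ?thesis using finite_osp by simp
qed

lemma lookup_evOP_tab:
  assumes "\<rho> ` {1..n} = {..<k}" "c \<in> Pn n"
  shows "lk (evOP n k c) (tab k n \<rho>) = eval (locus_point \<rho>) c"
proof -
  have B: "tab k n \<rho> \<in> ordered_set_partitions n k" using assms(1) by (simp add: tab_in_osp_iff)
  have "eval (locus_point (row_fun n k (tab k n \<rho>))) c = eval (locus_point \<rho>) c"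
  proof (rule eval_cong[OF assms(2)])
    fix i assume i: "i \<in> {1..n}"
    have "\<rho> i < k" using assms(1) i by blast
    from tab_eqD[OF row_fun(1)[OF B] i this] show "locus_point (row_fun n k (tab k n \<rho>)) i = locus_point \<rho> i" by (simp add: locus_point_def)
  qed
  with B show ?thesis by (simp add: lookup_evOP)
qed

lemma evOP_add: "evOP n k (c + d) = evOP n k c + evOP n k d"
  and evOP_scl: "evOP n k (scl e c) = scl e (evOP n k c)"
  and evOP_0: "evOP n k 0 = 0"
  by (rule poly_mapping_eqI; simp add: lookup_evOP lookup_add eval_add eval_scl)+

lemma evOP_sum: "evOP n k (sum f A) = (\<Sum>a\<in>A. evOP n k (f a))"
  by (induction A rule: infinite_finite_induct) (simp_all add: evOP_add evOP_0)

lemma keys_evOP: "ks (evOP n k c) \<subseteq> ordered_set_partitions n k"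
  by (auto simp: in_keys_iff lookup_evOP split: if_splits)

lemma meval_push:
  assumes "inj \<pi>" shows "meval a (push \<pi> m) = meval (a \<circ> \<pi>) m"
proof -
  have "meval a (push \<pi> m) = (\<Prod>i\<in>\<pi> ` ks m. a i ^ lk (push \<pi> m) i)"
    by (rule meval_superset) (simp_all add: keys_push)
  also have "\<dots> = (\<Prod>i\<in>ks m. a (\<pi> i) ^ lk (push \<pi> m) (\<pi> i))"
    using assms by (subst prod.reindex) (auto intro: inj_on_subset)
  also have "\<dots> = meval (a \<circ> \<pi>) m"
    unfolding meval_def using assms by (intro prod.cong refl) (simp add: lookup_push_inj[of \<pi> UNIV])
  finally show ?thesis .
qed

lemma eval_pact: "inj \<pi> \<Longrightarrow> eval a (pact \<pi> p) = eval (a \<circ> \<pi>) p"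
  by (induction p rule: mpoly_induct) (simp_all add: pact_add eval_add eval_single meval_push)

lemma evOP_pact:
  assumes \<pi>: "\<pi> permutes {1..n}" and c: "c \<in> Pn n"
  shows "evOP n k (pact \<pi> c) = sact \<pi> (evOP n k c)"
proof (rule poly_mapping_eqI)
  fix B
  show "lk (evOP n k (pact \<pi> c)) B = lk (sact \<pi> (evOP n k c)) B"
  proof (cases "B \<in> ordered_set_partitions n k")
    case True
    then obtain \<rho> where \<rho>: "B = tab k n \<rho>" "\<rho> ` {1..n} = {..<k}" by (rule osp_tab)
    have "(\<rho> \<circ> \<pi>) ` {1..n} = {..<k}" using \<rho>(2) permutes_image[OF \<pi>] by (metis image_comp)
    then have "lk (sact \<pi> (evOP n k c)) B = eval (locus_point (\<rho> \<circ> \<pi>)) c"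
      unfolding \<rho>(1) lookup_sact_tab[OF \<pi>] by (rule lookup_evOP_tab[OF _ c])
    also have "locus_point (\<rho> \<circ> \<pi>) = locus_point \<rho> \<circ> \<pi>" by (auto simp: locus_point_def)
    also have "eval (locus_point \<rho> \<circ> \<pi>) c = lk (evOP n k (pact \<pi> c)) B"
      unfolding \<rho>(1) lookup_evOP_tab[OF \<rho>(2) pact_Pn[OF \<pi> c]] eval_pact[OF permutes_inj[OF \<pi>]] ..
    finally show ?thesis by simp
  next
    case False
    have "lk (sact \<pi> (evOP n k c)) B = 0"
    proof (rule ccontr)
      assume "lk (sact \<pi> (evOP n k c)) B \<noteq> 0"
      then have "B \<in> permute_blocks \<pi> ` ks (evOP n k c)"
        using keys_push[of "permute_blocks \<pi>" "evOP n k c"] by (auto simp: sact_def in_keys_iff)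
      with keys_evOP permute_blocks_osp[OF \<pi>] False show False by blast
    qed
    with False show ?thesis by (simp add: lookup_evOP)
  qed
qed

lemma interpolation:
  assumes "k \<le> n" "B \<in> ordered_set_partitions n k"
  shows "\<exists>c\<in>harmonics n k. evOP n k c = sng B 1"
proof -
  define \<rho> where "\<rho> = row_fun n k B"
  have \<rho>: "B = tab k n \<rho>" "\<rho> ` {1..n} = {..<k}" using row_fun[OF assms(2)] by (simp_all add: \<rho>_def)
  \<comment> \<open>Lagrange interpolation on the grid of all points with coordinates below
    \<open>k\<close>: every grid point other than \<open>\<rho>\<close> makes a factor vanish. A
    harmonic polynomial with the same values is then rescaled.\<close>
  define q where "q = (\<Prod>i\<in>{1..n}. \<Prod>j\<in>{..<k} - {\<rho> i}. pvar i - pconst (of_nat j))"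
  have q: "q \<in> Pn n" unfolding q_def by (intro Pn_prod Pn_diff Pn_pvar Pn_pconst)
  have ev: "eval (locus_point \<theta>) q = (\<Prod>i\<in>{1..n}. \<Prod>j\<in>{..<k} - {\<rho> i}. of_nat (\<theta> i) - of_nat j)" for \<theta>
    unfolding q_def by (simp add: eval_prod eval_diff locus_point_def)
  have nz: "eval (locus_point \<rho>) q \<noteq> 0" unfolding ev by auto
  have z: "eval (locus_point \<theta>) q = 0" if "\<theta> ` {1..n} = {..<k}" "i \<in> {1..n}" "\<theta> i \<noteq> \<rho> i" for \<theta> i
  proof -
    have "\<theta> i \<in> {..<k} - {\<rho> i}" using that by blast
    then have "(\<Prod>j\<in>{..<k} - {\<rho> i}. of_nat (\<theta> i) - of_nat j :: rat) = 0" by (intro prod_zero) auto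
    with that(2) show ?thesis unfolding ev by (intro prod_zero) auto
  qed
  obtain d where "lowdeg d q" using ex_lowdeg by blast
  then obtain c where c: "c \<in> harmonics n k" "\<forall>\<theta>. \<theta> ` {1..n} = {..<k} \<longrightarrow> eval (locus_point \<theta>) c = eval (locus_point \<theta>) q"
    using harmonic_eval[OF assms(1) q] by blast
  define c' where "c' = scl (1 / eval (locus_point \<rho>) q) c"
  have c'H: "c' \<in> harmonics n k" unfolding c'_def by (rule PM.subspace_scale[OF subspace_harmonics c(1)])
  have "evOP n k c' = sng B 1"
  proof (rule poly_mapping_eqI)
    fix B'
    show "lk (evOP n k c') B' = lk (sng B 1) B'"
    proof (cases "B' \<in> ordered_set_partitions n k")
      case True
      then obtain \<theta> where \<theta>: "B' = tab k n \<theta>" "\<theta> ` {1..n} = {..<k}" by (rule osp_tab)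
      have val: "lk (evOP n k c') B' = eval (locus_point \<theta>) q / eval (locus_point \<rho>) q"
        unfolding \<theta>(1) lookup_evOP_tab[OF \<theta>(2) harmonics_Pn[OF c'H]] using c(2) \<theta>(2) by (simp add: c'_def eval_scl)
      show ?thesis
      proof (cases "\<exists>i\<in>{1..n}. \<theta> i \<noteq> \<rho> i")
        case neq: True
        then obtain i where i: "i \<in> {1..n}" "\<theta> i \<noteq> \<rho> i" by blast
        have "B' \<noteq> B"
        proof
          assume "B' = B"
          then have "tab k n \<theta> = tab k n \<rho>" using \<theta>(1) \<rho>(1) by simp
          moreover have "\<theta> i < k" using \<theta>(2) i(1) by blast
          ultimately show False using tab_eqD[of k n \<theta> \<rho> i] i by simp
        qed
        with z[OF \<theta>(2) i] show ?thesis unfolding val by (simp add: lookup_single)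
      next
        case False
        then have "tab k n \<theta> = tab k n \<rho>" by (intro tab_cong) blast
        moreover have "eval (locus_point \<theta>) q = eval (locus_point \<rho>) q"
          by (rule eval_cong[OF q]) (use False in \<open>auto simp: locus_point_def\<close>)
        ultimately show ?thesis unfolding val using nz \<theta>(1) \<rho>(1) by simp
      qed
    next
      case False
      with assms(2) have "B' \<noteq> B" by blast
      with False show ?thesis by (auto simp: lookup_evOP lookup_single)
    qed
  qed
  with c'H show ?thesis by blast
qed

lemma card_hitting_le: "card (hitting n k {..<k}) \<le> card (ordered_set_partitions n k)"
proof (rule card_inj_on_le[OF _ _ finite_osp])
  show "(\<lambda>\<rho>. tab k n \<rho>) ` hitting n k {..<k} \<subseteq> ordered_set_partitions n k"
    by (auto simp: hitting_def tab_in_osp_iff)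
  show "inj_on (\<lambda>\<rho>. tab k n \<rho>) (hitting n k {..<k})"
  proof (rule inj_onI)
    fix \<rho> \<theta> assume *: "\<rho> \<in> hitting n k {..<k}" "\<theta> \<in> hitting n k {..<k}" "tab k n \<rho> = tab k n \<theta>"
    then have P: "\<rho> \<in> {1..n} \<rightarrow>\<^sub>E {..<k}" "\<theta> \<in> {1..n} \<rightarrow>\<^sub>E {..<k}" by (auto simp: hitting_def)
    show "\<rho> = \<theta>"
    proof (rule PiE_ext[OF P])
      fix y assume y: "y \<in> {1..n}"
      then have "\<rho> y < k" using P(1) by (auto simp: PiE_def Pi_def)
      from tab_eqD[OF *(3) y this] show "\<rho> y = \<theta> y" by simp
    qed
  qed
qed

text \<open>Harmonic representatives of a spanning family of the quotient span the harmonics, so the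
  dimension is at most the number of ordered set partitions. The interpolating harmonics
  \<open>e\<close> are independent and attain this number, hence span; evaluation then reads off the
  coefficients of \<open>c\<close> one by one.\<close>

lemma evOP_inj:
  assumes kn: "k \<le> n" and c: "c \<in> harmonics n k" "evOP n k c = 0"
  shows "c = 0"
proof -
  let ?OP = "ordered_set_partitions n k" and ?I = "I_ideal n k"
  note I = poly_idealD[OF isid_I_ideal[of n k]]
  note sub = PM.subspace_0[OF subspace_harmonics] PM.subspace_add[OF subspace_harmonics]
    PM.subspace_diff[OF subspace_harmonics] PM.subspace_scale[OF subspace_harmonics]
  have "\<exists>B. finite B \<and> B \<subseteq> Pn n \<and> card B \<le> card (hitting n k {..<k}) \<and> (\<forall>p\<in>Pn n. \<exists>b\<in>PM.span B. p - b \<in> ?I)"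
  proof (rule quotient_spanning[OF isid_I_ideal])
    show "pvar i ^ k \<in> ?I" if "i \<in> {1..n}" for i
      by (rule subsetD[OF gens_I_ideal UnI1[OF imageI[OF that]]])
    show "esym pvar {1..n} d \<in> ?I" if d: "n < d + card {..<k}" for d
    proof (cases "d \<le> n")
      case True
      then have "d \<in> {n - k + 1..n}" using d kn by simp
      then have "elem_sym n d \<in> ?I" by (intro subsetD[OF gens_I_ideal UnI2[OF imageI]])
      then show ?thesis by (simp add: elem_sym_esym)
    next
      case False
      then show ?thesis using I(2) by (simp add: esym_gt)
    qed
  qed simp
  then obtain B where B: "finite B" "B \<subseteq> Pn n" "card B \<le> card ?OP" "\<And>p. p \<in> Pn n \<Longrightarrow> \<exists>b\<in>PM.span B. p - b \<in> ?I"
    using card_hitting_le[of n k] by (meson order_trans)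
  have "\<exists>h. \<forall>b\<in>B. h b \<in> harmonics n k \<and> b - h b \<in> ?I"
  proof (rule bchoice, rule ballI)
    fix b assume "b \<in> B"
    then have b: "b \<in> Pn n" using B(2) by blast
    obtain d where "lowdeg d b" using ex_lowdeg by blast
    from harmonic_part[OF kn b this] show "\<exists>c. c \<in> harmonics n k \<and> b - c \<in> ?I" by metis
  qed
  then obtain h where h: "\<And>b. b \<in> B \<Longrightarrow> h b \<in> harmonics n k" "\<And>b. b \<in> B \<Longrightarrow> b - h b \<in> ?I" by blast
  have spanh: "x \<in> PM.span (h ` B)" if x: "x \<in> harmonics n k" for x
  proof -
    obtain b where b: "b \<in> PM.span B" "x - b \<in> ?I" using B(4)[OF harmonics_Pn[OF x]] by blast
    have "\<exists>y\<in>PM.span (h ` B). y \<in> harmonics n k \<and> b - y \<in> ?I" using b(1)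
    proof (induction b rule: PM.span_induct)
      case base
      show ?case
      proof (intro PM.subspaceI CollectI)
        show "\<exists>y\<in>PM.span (h ` B). y \<in> harmonics n k \<and> 0 - y \<in> ?I"
          by (intro bexI[of _ 0]) (simp_all add: PM.span_zero sub I)
      next
        fix a b assume "a \<in> {b. \<exists>y\<in>PM.span (h ` B). y \<in> harmonics n k \<and> b - y \<in> ?I}"
          "b \<in> {b. \<exists>y\<in>PM.span (h ` B). y \<in> harmonics n k \<and> b - y \<in> ?I}"
        then obtain y z where yz: "y \<in> PM.span (h ` B)" "z \<in> PM.span (h ` B)" "y \<in> harmonics n k" "z \<in> harmonics n k"
          "a - y \<in> ?I" "b - z \<in> ?I" by blast
        have "(a - y) + (b - z) \<in> ?I" by (rule I(3)[OF yz(5,6)])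
        then have "(a + b) - (y + z) \<in> ?I" by (simp add: algebra_simps)
        then show "\<exists>y\<in>PM.span (h ` B). y \<in> harmonics n k \<and> a + b - y \<in> ?I"
          using yz by (intro bexI[of _ "y + z"]) (simp_all add: PM.span_add sub)
      next
        fix e b assume "b \<in> {b. \<exists>y\<in>PM.span (h ` B). y \<in> harmonics n k \<and> b - y \<in> ?I}"
        then obtain y where y: "y \<in> PM.span (h ` B)" "y \<in> harmonics n k" "b - y \<in> ?I" by blast
        have "scl e (b - y) \<in> ?I" by (rule I(5)[OF y(3)])
        then show "\<exists>y\<in>PM.span (h ` B). y \<in> harmonics n k \<and> scl e b - y \<in> ?I"
          using y by (intro bexI[of _ "scl e y"]) (simp_all add: PM.scale_right_diff_distrib PM.span_scale sub)
      qed
    next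
      case (step b)
      then show ?case using h by (intro bexI[of _ "h b"] PM.span_base) auto
    qed
    then obtain y where y: "y \<in> PM.span (h ` B)" "y \<in> harmonics n k" "b - y \<in> ?I" by blast
    have "(x - b) + (b - y) \<in> ?I" by (rule I(3)[OF b(2) y(3)])
    then have "x - y = 0" by (intro harmonics_I_ideal[of _ n k] sub x y(2)) simp
    with y(1) show ?thesis by simp
  qed
  have "\<exists>e. \<forall>B\<in>?OP. e B \<in> harmonics n k \<and> evOP n k (e B) = sng B 1"
    by (rule bchoice) (use interpolation[OF kn] in blast)
  then obtain e where e: "\<And>B. B \<in> ?OP \<Longrightarrow> e B \<in> harmonics n k" "\<And>B. B \<in> ?OP \<Longrightarrow> evOP n k (e B) = sng B 1"
    by blast
  have inj: "inj_on e ?OP"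
  proof (rule inj_onI)
    fix A B assume AB: "A \<in> ?OP" "B \<in> ?OP" "e A = e B"
    then have "lk (sng A (1::rat)) A = lk (sng B 1) A" using e(2)[OF AB(1)] e(2)[OF AB(2)] by simp
    then show "A = B" by (simp add: lookup_single when_def split: if_splits)
  qed
  have coeff: "lk (evOP n k (\<Sum>B\<in>?OP. scl (u (e B)) (e B))) B = u (e B)" if "B \<in> ?OP" for u B
  proof -
    have "lk (evOP n k (\<Sum>B\<in>?OP. scl (u (e B)) (e B))) B = (\<Sum>B'\<in>?OP. if B' = B then u (e B') else 0)"
      unfolding evOP_sum lookup_sum by (intro sum.cong refl) (simp add: evOP_scl e(2) lookup_single when_def)
    then show ?thesis using that finite_osp by simp
  qed
  have ind: "PM.independent (e ` ?OP)"
  proof (rule PM.independent_if_scalars_zero)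
    fix u x assume "(\<Sum>x\<in>e ` ?OP. scl (u x) x) = 0" "x \<in> e ` ?OP"
    then show "u x = 0" using coeff[of _ u] by (auto simp: sum.reindex[OF inj] evOP_0)
  qed (simp add: finite_osp)
  have "c \<in> PM.span (e ` ?OP)"
  proof (rule ccontr)
    assume nc: "c \<notin> PM.span (e ` ?OP)"
    then have "PM.independent (insert c (e ` ?OP))" using ind by (rule PM.independent_insertI)
    moreover have "insert c (e ` ?OP) \<subseteq> PM.span (h ` B)" using spanh c(1) e(1) by blast
    ultimately have "card (insert c (e ` ?OP)) \<le> card (h ` B)"
      using PM.independent_span_bound[of "h ` B"] B(1) by blast
    also have "\<dots> \<le> card ?OP" using card_image_le[OF B(1), of h] B(3) by simp
    also have "\<dots> = card (e ` ?OP)" by (simp add: card_image[OF inj])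
    finally have "card (insert c (e ` ?OP)) \<le> card (e ` ?OP)" .
    moreover have "c \<notin> e ` ?OP" using nc PM.span_base by blast
    ultimately show False by (simp add: finite_osp)
  qed
  then obtain u where u: "c = (\<Sum>x\<in>e ` ?OP. scl (u x) x)" using PM.span_finite[of "e ` ?OP"] finite_osp by auto
  then have "c = (\<Sum>B\<in>?OP. scl (u (e B)) (e B))" by (simp add: sum.reindex[OF inj])
  moreover have "u (e B) = 0" if "B \<in> ?OP" for B
    using coeff[OF that, of u] c(2) calculation by simp
  ultimately show "c = 0" by simp
qed

text \<open>A \<open>rep\<close> record carries no axioms; closure under its operations is what
  allows an isomorphism to be inverted in \<open>rep_iso_sym\<close>.\<close>

definition rep_closed :: "('g, 'm) monoid_scheme \<Rightarrow> ('g, 'v) rep \<Rightarrow> bool" where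
  "rep_closed G V \<longleftrightarrow> (\<forall>x\<in>carrier V. \<forall>y\<in>carrier V. x \<oplus>\<^bsub>V\<^esub> y \<in> carrier V) \<and>
     (\<forall>c. \<forall>x\<in>carrier V. c \<odot>\<^bsub>V\<^esub> x \<in> carrier V) \<and>
     (\<forall>g\<in>carrier G. \<forall>x\<in>carrier V. act V g x \<in> carrier V)"

lemma rep_iso_trans:
  assumes "rep_iso G U V" "rep_iso G V W" shows "rep_iso G U W"
proof -
  obtain f where f: "bij_betw f (carrier U) (carrier V)"
    "\<And>x y. x \<in> carrier U \<Longrightarrow> y \<in> carrier U \<Longrightarrow> f (x \<oplus>\<^bsub>U\<^esub> y) = f x \<oplus>\<^bsub>V\<^esub> f y"
    "\<And>c x. x \<in> carrier U \<Longrightarrow> f (c \<odot>\<^bsub>U\<^esub> x) = c \<odot>\<^bsub>V\<^esub> f x"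
    "\<And>g x. g \<in> carrier G \<Longrightarrow> x \<in> carrier U \<Longrightarrow> f (act U g x) = act V g (f x)"
    using assms(1) unfolding rep_iso_def by blast
  obtain h where h: "bij_betw h (carrier V) (carrier W)"
    "\<And>x y. x \<in> carrier V \<Longrightarrow> y \<in> carrier V \<Longrightarrow> h (x \<oplus>\<^bsub>V\<^esub> y) = h x \<oplus>\<^bsub>W\<^esub> h y"
    "\<And>c x. x \<in> carrier V \<Longrightarrow> h (c \<odot>\<^bsub>V\<^esub> x) = c \<odot>\<^bsub>W\<^esub> h x"
    "\<And>g x. g \<in> carrier G \<Longrightarrow> x \<in> carrier V \<Longrightarrow> h (act V g x) = act W g (h x)"
    using assms(2) unfolding rep_iso_def by blast
  note fV = bij_betw_apply[OF f(1)]
  show ?thesis unfolding rep_iso_def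
    by (rule exI[of _ "h \<circ> f"]) (simp add: bij_betw_trans[OF f(1) h(1)] f(2-4) h(2-4) fV)
qed

lemma rep_iso_sym:
  assumes "rep_closed G U" "rep_iso G U V" shows "rep_iso G V U"
proof -
  obtain f where f: "bij_betw f (carrier U) (carrier V)"
    "\<And>x y. x \<in> carrier U \<Longrightarrow> y \<in> carrier U \<Longrightarrow> f (x \<oplus>\<^bsub>U\<^esub> y) = f x \<oplus>\<^bsub>V\<^esub> f y"
    "\<And>c x. x \<in> carrier U \<Longrightarrow> f (c \<odot>\<^bsub>U\<^esub> x) = c \<odot>\<^bsub>V\<^esub> f x"
    "\<And>g x. g \<in> carrier G \<Longrightarrow> x \<in> carrier U \<Longrightarrow> f (act U g x) = act V g (f x)"
    using assms(2) unfolding rep_iso_def by blast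
  let ?h = "inv_into (carrier U) f"
  have h: "bij_betw ?h (carrier V) (carrier U)" by (rule bij_betw_inv_into[OF f(1)])
  have hU: "?h x \<in> carrier U" "f (?h x) = x" if "x \<in> carrier V" for x
    using bij_betw_apply[OF h that] bij_betw_inv_into_right[OF f(1) that] by auto
  have eq: "?h x = a" if "a \<in> carrier U" "f a = x" for a x
    using bij_betw_inv_into_left[OF f(1) that(1)] that(2) by simp
  show ?thesis unfolding rep_iso_def
  proof (intro exI[of _ ?h] conjI ballI allI h)
    fix x y assume "x \<in> carrier V" "y \<in> carrier V"
    then show "?h (x \<oplus>\<^bsub>V\<^esub> y) = ?h x \<oplus>\<^bsub>U\<^esub> ?h y"
      using assms(1) unfolding rep_closed_def by (intro eq) (simp_all add: f(2) hU)
  next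
    fix c x assume "x \<in> carrier V"
    then show "?h (c \<odot>\<^bsub>V\<^esub> x) = c \<odot>\<^bsub>U\<^esub> ?h x"
      using assms(1) unfolding rep_closed_def by (intro eq) (simp_all add: f(3) hU)
  next
    fix g x assume "g \<in> carrier G" "x \<in> carrier V"
    then show "?h (act V g x) = act U g (?h x)"
      using assms(1) unfolding rep_closed_def by (intro eq) (simp_all add: f(4) hU)
  qed
qed

section \<open>Cosets and the isomorphism with the permutation module\<close>

abbreviation coset :: "nat \<Rightarrow> nat \<Rightarrow> mpoly \<Rightarrow> mpoly set" where
  "coset n k p \<equiv> I_ideal n k +>\<^bsub>mpoly_ring n\<^esub> p"

lemma mem_coset: "q \<in> coset n k p \<longleftrightarrow> q - p \<in> I_ideal n k"
proof -
  have "q \<in> coset n k p \<longleftrightarrow> (\<exists>i\<in>I_ideal n k. q = i + p)" by (simp add: a_r_coset_def')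
  also have "\<dots> \<longleftrightarrow> q - p \<in> I_ideal n k" by (metis diff_add_cancel add_diff_cancel_right')
  finally show ?thesis .
qed

lemma coset_eq_iff: "coset n k p = coset n k q \<longleftrightarrow> p - q \<in> I_ideal n k"
proof
  note I = poly_idealD[OF isid_I_ideal[of n k]]
  assume "coset n k p = coset n k q"
  moreover have "p \<in> coset n k p" by (simp add: mem_coset I(2))
  ultimately show "p - q \<in> I_ideal n k" by (simp add: mem_coset)
next
  note I = poly_idealD[OF isid_I_ideal[of n k]]
  assume pq: "p - q \<in> I_ideal n k"
  have "x - p \<in> I_ideal n k \<longleftrightarrow> x - q \<in> I_ideal n k" for x
    using I(3)[OF _ pq, of "x - p"] I(7)[OF _ pq, of "x - q"] by auto
  then show "coset n k p = coset n k q" by (intro Set.set_eqI) (simp add: mem_coset)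
qed

lemma R_rep_ops:
  shows carrier_R_rep: "carrier (R_rep n k) = coset n k ` Pn n"
    and add_R_rep: "p \<in> Pn n \<Longrightarrow> q \<in> Pn n \<Longrightarrow> coset n k p \<oplus>\<^bsub>R_rep n k\<^esub> coset n k q = coset n k (p + q)"
    and smult_R_rep: "p \<in> Pn n \<Longrightarrow> c \<odot>\<^bsub>R_rep n k\<^esub> coset n k p = coset n k (scl c p)"
    and act_R_rep: "\<pi> permutes {1..n} \<Longrightarrow> act (R_rep n k) \<pi> (coset n k p) = coset n k (pact \<pi> p)"
proof -
  interpret ideal "I_ideal n k" "mpoly_ring n" by (rule isid_ideal[OF isid_I_ideal])
  show "carrier (R_rep n k) = coset n k ` Pn n"
    by (auto simp: R_rep_def Let_def FactRing_def A_RCOSETS_def')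
  show "coset n k p \<oplus>\<^bsub>R_rep n k\<^esub> coset n k q = coset n k (p + q)" if "p \<in> Pn n" "q \<in> Pn n"
    using a_rcos_sum[of p q] that by (simp add: R_rep_def Let_def FactRing_def)
  show "c \<odot>\<^bsub>R_rep n k\<^esub> coset n k p = coset n k (scl c p)" if "p \<in> Pn n"
    using rcoset_mult_add[of "pconst c" p] that Pn_pconst by (simp add: R_rep_def Let_def FactRing_def pconst_mult)
  show "act (R_rep n k) \<pi> (coset n k p) = coset n k (pact \<pi> p)" if \<pi>: "\<pi> permutes {1..n}"
  proof -
    have "act (R_rep n k) \<pi> (coset n k p) = pact \<pi> ` coset n k p"
      by (simp add: R_rep_def Let_def pact_def)
    also have "\<dots> = coset n k (pact \<pi> p)"
    proof (intro Set.set_eqI iffI)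
      fix x assume "x \<in> pact \<pi> ` coset n k p"
      then obtain y where y: "x = pact \<pi> y" "y - p \<in> I_ideal n k" by (auto simp: mem_coset)
      then show "x \<in> coset n k (pact \<pi> p)" using pact_I_ideal[OF \<pi> y(2)] by (simp add: mem_coset pact_diff)
    next
      fix x assume "x \<in> coset n k (pact \<pi> p)"
      then have "pact (pinv \<pi>) (x - pact \<pi> p) \<in> I_ideal n k"
        by (intro pact_I_ideal permutes_inv \<pi>) (simp add: mem_coset)
      then have "pact (pinv \<pi>) x \<in> coset n k p"
        using \<pi> by (simp add: mem_coset pact_diff pact_pact permutes_inv_o)
      moreover have "x = pact \<pi> (pact (pinv \<pi>) x)" using \<pi> by (simp add: pact_pact permutes_inv_o)
      ultimately show "x \<in> pact \<pi> ` coset n k p" by blast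
    qed
    finally show ?thesis .
  qed
qed

lemma rep_closed_R_rep: "rep_closed (sym_group n) (R_rep n k)"
  unfolding rep_closed_def carrier_R_rep
  by (auto simp: add_R_rep smult_R_rep act_R_rep sym_group_carrier intro!: imageI Pn_add Pn_scl pact_Pn)

lemma OP_rep_ops:
  "carrier (OP_rep n k) = {v. ks v \<subseteq> ordered_set_partitions n k}" "ring.add (OP_rep n k) = (+)"
  "smult (OP_rep n k) = scl" "act (OP_rep n k) = sact"
  by (auto simp: OP_rep_def perm_rep_def sact_def)

text \<open>Each coset has exactly one harmonic representative: existence is
  \<open>harmonic_part\<close>, uniqueness holds since harmonics meet the ideal in 0. Evaluating it
  is injective by \<open>evOP_inj\<close>, surjective by \<open>interpolation\<close>, and
  equivariant because the harmonics are stable.\<close>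

theorem rep_iso_R_rep_OP_rep:
  assumes kn: "k \<le> n" shows "rep_iso (sym_group n) (R_rep n k) (OP_rep n k)"
proof -
  note sub = PM.subspace_0[OF subspace_harmonics] PM.subspace_add[OF subspace_harmonics]
    PM.subspace_diff[OF subspace_harmonics] PM.subspace_scale[OF subspace_harmonics]
  note I = poly_idealD[OF isid_I_ideal[of n k]]
  \<comment> \<open>The representative must be the harmonic one; other elements of the coset have in
    general other values on the locus.\<close>
  define f where "f = (\<lambda>C. evOP n k (THE c. c \<in> C \<and> c \<in> harmonics n k))"
  have uniq: "c = d" if "c \<in> harmonics n k" "d \<in> harmonics n k" "c - d \<in> I_ideal n k" for c d
    using harmonics_I_ideal[of "c - d" n k] sub(3)[OF that(1,2)] that(3) by simp
  have f: "f (coset n k c) = evOP n k c" if c: "c \<in> harmonics n k" for c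
  proof -
    have "(THE d. d \<in> coset n k c \<and> d \<in> harmonics n k) = c"
      by (rule the_equality) (use c uniq in \<open>auto simp: mem_coset I(2)\<close>)
    then show ?thesis by (simp add: f_def)
  qed
  have rep: "\<exists>c\<in>harmonics n k. C = coset n k c" if "C \<in> coset n k ` Pn n" for C
  proof -
    from that obtain p where p: "p \<in> Pn n" "C = coset n k p" by blast
    obtain d where "lowdeg d p" using ex_lowdeg by blast
    from harmonic_part[OF kn p(1) this] obtain c where "c \<in> harmonics n k" "p - c \<in> I_ideal n k" by metis
    then show ?thesis by (intro bexI[of _ c]) (simp_all add: coset_eq_iff p(2))
  qed
  have carrier: "carrier (R_rep n k) = coset n k ` harmonics n k"
    unfolding carrier_R_rep
  proof
    show "coset n k ` Pn n \<subseteq> coset n k ` harmonics n k"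
    proof (rule subsetI)
      fix C assume "C \<in> coset n k ` Pn n"
      from rep[OF this] obtain c where c: "c \<in> harmonics n k" "C = coset n k c" ..
      show "C \<in> coset n k ` harmonics n k" unfolding c(2) by (rule imageI) (rule c(1))
    qed
    show "coset n k ` harmonics n k \<subseteq> coset n k ` Pn n" by (intro image_mono subsetI harmonics_Pn)
  qed
  have inj: "c = d" if "c \<in> harmonics n k" "d \<in> harmonics n k" "evOP n k c = evOP n k d" for c d
  proof -
    have "evOP n k (c - d) = 0"
      using evOP_add[of n k "c - d" d] that(3) by simp
    then have "c - d = 0" by (rule evOP_inj[OF kn sub(3)[OF that(1,2)]])
    then show ?thesis by simp
  qed
  have surj: "\<exists>c\<in>harmonics n k. evOP n k c = v" if v: "ks v \<subseteq> ordered_set_partitions n k" for v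
  proof -
    have "\<exists>e. \<forall>B\<in>ordered_set_partitions n k. e B \<in> harmonics n k \<and> evOP n k (e B) = sng B 1"
      by (rule bchoice) (use interpolation[OF kn] in blast)
    then obtain e where e: "\<And>B. B \<in> ordered_set_partitions n k \<Longrightarrow> e B \<in> harmonics n k"
      "\<And>B. B \<in> ordered_set_partitions n k \<Longrightarrow> evOP n k (e B) = sng B 1" by blast
    have "evOP n k (\<Sum>B\<in>ordered_set_partitions n k. scl (lk v B) (e B)) =
      (\<Sum>B\<in>ordered_set_partitions n k. sng B (lk v B))"
      unfolding evOP_sum by (intro sum.cong refl) (simp add: evOP_scl e(2))
    also have "\<dots> = v" by (rule poly_mapping_sum_single[OF finite_osp v, symmetric])
    finally show ?thesis
      by (intro bexI[of _ "\<Sum>B\<in>ordered_set_partitions n k. scl (lk v B) (e B)"])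
        (auto intro!: PM.subspace_sum[OF subspace_harmonics] sub(4) e(1))
  qed
  show ?thesis unfolding rep_iso_def
  proof (intro exI[of _ f] conjI ballI allI)
    show "bij_betw f (carrier (R_rep n k)) (carrier (OP_rep n k))"
      unfolding bij_betw_def
    proof
      show "inj_on f (carrier (R_rep n k))"
        unfolding carrier
      proof (rule inj_onI, elim imageE)
        fix x y c d assume "f x = f y" "x = coset n k c" "c \<in> harmonics n k" "y = coset n k d" "d \<in> harmonics n k"
        then show "x = y" using inj[of c d] f[of c] f[of d] by simp
      qed
      have "f ` coset n k ` harmonics n k = evOP n k ` harmonics n k"
        unfolding image_image by (rule image_cong[OF refl f])
      also have "\<dots> = {v :: nat set list \<Rightarrow>\<^sub>0 rat. ks v \<subseteq> ordered_set_partitions n k}"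
      proof (intro Set.set_eqI iffI)
        fix v assume "v \<in> evOP n k ` harmonics n k"
        then show "v \<in> {v :: nat set list \<Rightarrow>\<^sub>0 rat. ks v \<subseteq> ordered_set_partitions n k}" using keys_evOP[of n k] by auto
      next
        fix v :: "nat set list \<Rightarrow>\<^sub>0 rat" assume "v \<in> {v. ks v \<subseteq> ordered_set_partitions n k}"
        then obtain c where "c \<in> harmonics n k" "evOP n k c = v" using surj[of v] by auto
        then show "v \<in> evOP n k ` harmonics n k" by auto
      qed
      finally show "f ` carrier (R_rep n k) = carrier (OP_rep n k)" unfolding carrier OP_rep_ops .
    qed
  next
    fix x y assume "x \<in> carrier (R_rep n k)" "y \<in> carrier (R_rep n k)"
    then obtain c d where cd: "x = coset n k c" "y = coset n k d" "c \<in> harmonics n k" "d \<in> harmonics n k"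
      unfolding carrier by blast
    then show "f (x \<oplus>\<^bsub>R_rep n k\<^esub> y) = f x \<oplus>\<^bsub>OP_rep n k\<^esub> f y"
      by (simp add: add_R_rep harmonics_Pn f sub(2) evOP_add OP_rep_ops)
  next
    fix e x assume "x \<in> carrier (R_rep n k)"
    then obtain c where cd: "x = coset n k c" "c \<in> harmonics n k" unfolding carrier by blast
    then show "f (e \<odot>\<^bsub>R_rep n k\<^esub> x) = e \<odot>\<^bsub>OP_rep n k\<^esub> f x"
      by (simp add: smult_R_rep harmonics_Pn f sub(4) evOP_scl OP_rep_ops)
  next
    fix \<pi> x assume "\<pi> \<in> carrier (sym_group n)" "x \<in> carrier (R_rep n k)"
    then obtain c where cd: "\<pi> permutes {1..n}" "x = coset n k c" "c \<in> harmonics n k"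
      unfolding carrier sym_group_carrier by blast
    then show "f (act (R_rep n k) \<pi> x) = act (OP_rep n k) \<pi> (f x)"
      by (simp add: act_R_rep harmonics_Pn f pact_harmonics evOP_pact OP_rep_ops)
  qed
qed

section \<open>Counting invariants\<close>

lemma specht_rep_ops:
  shows carrier_specht: "\<mu> \<in> partitions n \<Longrightarrow> carrier (specht n \<mu>) = hw n \<mu>"
    and add_specht: "ring.add (specht n \<mu>) = (+)"
    and smult_specht: "smult (specht n \<mu>) = scl"
    and act_specht: "act (specht n \<mu>) = sact"
  by (auto simp: specht_def perm_rep_def sact_def specht_space_eq_hw[symmetric])

abbreviation specht_sum :: "nat \<Rightarrow> (nat list \<Rightarrow> nat) \<Rightarrow> (nat \<Rightarrow> nat, nat list \<times> nat \<Rightarrow> nat set list \<Rightarrow>\<^sub>0 rat) rep" where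
  "specht_sum n c \<equiv> rep_sum {(\<mu>, j). \<mu> \<in> partitions n \<and> j < c \<mu>} (\<lambda>(\<mu>, j). specht n \<mu>)"

lemma specht_sum_ops:
  shows carrier_specht_sum: "carrier (specht_sum n c) = (\<Pi>\<^sub>E p\<in>specht_index n c. hw n (fst p))"
    and "x \<oplus>\<^bsub>specht_sum n c\<^esub> y = (\<lambda>p\<in>specht_index n c. x p + y p)"
    and "r \<odot>\<^bsub>specht_sum n c\<^esub> x = (\<lambda>p\<in>specht_index n c. scl r (x p))"
    and "act (specht_sum n c) g x = (\<lambda>p\<in>specht_index n c. sact g (x p))"
proof -
  have "carrier (specht_sum n c) = (\<Pi>\<^sub>E p\<in>specht_index n c. carrier (specht n (fst p)))"
    by (simp add: rep_sum_def case_prod_beta)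
  also have "\<dots> = (\<Pi>\<^sub>E p\<in>specht_index n c. hw n (fst p))"
    by (rule PiE_cong) (auto simp: carrier_specht)
  finally show "carrier (specht_sum n c) = (\<Pi>\<^sub>E p\<in>specht_index n c. hw n (fst p))" .
qed (simp_all add: rep_sum_def case_prod_beta add_specht smult_specht act_specht)

lemma stable_osp_space: "stable n {v :: nat set list \<Rightarrow>\<^sub>0 rat. ks v \<subseteq> ordered_set_partitions n k}"
  unfolding stable_def
proof (intro conjI allI impI ballI subspace_keys)
  fix \<pi> v assume p: "\<pi> permutes {1..n}" and "v \<in> {v :: nat set list \<Rightarrow>\<^sub>0 rat. ks v \<subseteq> ordered_set_partitions n k}"
  then show "sact \<pi> v \<in> {v. ks v \<subseteq> ordered_set_partitions n k}"
    using keys_push[of "permute_blocks \<pi>" v] permute_blocks_osp[OF p] unfolding sact_def by blast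
qed

lemma OP_rep_decomposes: "\<exists>c. rep_iso (sym_group n) (OP_rep n k) (specht_sum n c)"
proof -
  define U where "U = {v :: nat set list \<Rightarrow>\<^sub>0 rat. ks v \<subseteq> ordered_set_partitions n k}"
  have U: "stable n U" unfolding U_def by (rule stable_osp_space)
  obtain c G where dec: "specht_decomposition n U c G"
    using ex_specht_decomposition[OF U _ finite_osp] unfolding U_def by blast
  let ?I = "specht_index n c"
  let ?X = "\<Pi>\<^sub>E p\<in>?I. hw n (fst p)"
  define \<Phi> where "\<Phi> = (\<lambda>x. \<Sum>p\<in>?I. G p (x p))"
  have G: "\<And>p. p \<in> ?I \<Longrightarrow> equivariant n (hw n (fst p)) (G p)" and bij: "bij_betw \<Phi> ?X U"
    using dec unfolding specht_decomposition_def \<Phi>_def by blast+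
  define f where "f = inv_into ?X \<Phi>"
  have f: "f x \<in> ?X" "\<Phi> (f x) = x" if "x \<in> U" for x
    unfolding f_def using bij_betw_apply[OF bij_betw_inv_into[OF bij] that] bij_betw_inv_into_right[OF bij that] by auto
  have eq: "f x = y" if "y \<in> ?X" "\<Phi> y = x" for x y
    unfolding f_def using bij_betw_inv_into_left[OF bij that(1)] that(2) by simp
  have fp: "f x p \<in> hw n (fst p)" if "x \<in> U" "p \<in> ?I" for x p
    using f(1)[OF that(1)] that(2) by (rule PiE_mem)
  show ?thesis
  proof (intro exI[of _ c], unfold rep_iso_def, intro exI[of _ f] conjI ballI allI)
    show "bij_betw f (carrier (OP_rep n k)) (carrier (specht_sum n c))"
      unfolding OP_rep_ops carrier_specht_sum f_def U_def[symmetric] by (rule bij_betw_inv_into[OF bij])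
  next
    fix x y assume "x \<in> carrier (OP_rep n k)" "y \<in> carrier (OP_rep n k)"
    then have xy: "x \<in> U" "y \<in> U" by (simp_all add: OP_rep_ops U_def)
    have "\<Phi> (\<lambda>p\<in>?I. f x p + f y p) = \<Phi> (f x) + \<Phi> (f y)"
      unfolding \<Phi>_def sum.distrib[symmetric]
      by (intro sum.cong refl) (simp add: equivariantD(1)[OF G] fp xy del: mem_Collect_eq)
    then have "f (x + y) = (\<lambda>p\<in>?I. f x p + f y p)"
      by (intro eq restrict_PiE_iff[THEN iffD2] ballI stableD(3)[OF stable_hw] fp xy) (simp_all only: f xy)
    then show "f (x \<oplus>\<^bsub>OP_rep n k\<^esub> y) = f x \<oplus>\<^bsub>specht_sum n c\<^esub> f y"
      unfolding OP_rep_ops specht_sum_ops .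
  next
    fix r x assume "x \<in> carrier (OP_rep n k)"
    then have x: "x \<in> U" by (simp add: OP_rep_ops U_def)
    have "\<Phi> (\<lambda>p\<in>?I. scl r (f x p)) = scl r (\<Phi> (f x))"
      unfolding \<Phi>_def PM.scale_sum_right
      by (intro sum.cong refl) (simp add: equivariantD(2)[OF G] fp x del: mem_Collect_eq)
    then have "f (scl r x) = (\<lambda>p\<in>?I. scl r (f x p))"
      by (intro eq restrict_PiE_iff[THEN iffD2] ballI stableD(5)[OF stable_hw] fp x) (simp_all only: f x)
    then show "f (r \<odot>\<^bsub>OP_rep n k\<^esub> x) = r \<odot>\<^bsub>specht_sum n c\<^esub> f x"
      unfolding OP_rep_ops specht_sum_ops .
  next
    fix \<pi> x assume "\<pi> \<in> carrier (sym_group n)" "x \<in> carrier (OP_rep n k)"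
    then have x: "x \<in> U" and p: "\<pi> permutes {1..n}" by (simp_all add: OP_rep_ops U_def sym_group_carrier)
    have "G q (sact \<pi> (f x q)) = sact \<pi> (G q (f x q))" if "q \<in> ?I" for q
      by (rule equivariantD(3)[OF G[OF that] p fp[OF x that]])
    then have "\<Phi> (\<lambda>p\<in>?I. sact \<pi> (f x p)) = sact \<pi> (\<Phi> (f x))"
      unfolding \<Phi>_def sact_sum
      by (intro sum.cong refl) (simp del: mem_Collect_eq)
    then have "f (sact \<pi> x) = (\<lambda>p\<in>?I. sact \<pi> (f x p))"
      by (intro eq restrict_PiE_iff[THEN iffD2] ballI stableD(6)[OF stable_hw] fp x p) (simp_all only: f x)
    then show "f (act (OP_rep n k) \<pi> x) = act (specht_sum n c) \<pi> (f x)"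
      unfolding OP_rep_ops specht_sum_ops .
  qed
qed

text \<open>Formulated for indexed families so that index sets are compared; two equal members would
  satisfy the relation with coefficients 1 and -1.\<close>

lemma family_card_le:
  fixes b :: "'i \<Rightarrow> 'a \<Rightarrow>\<^sub>0 rat"
  assumes "finite J" "finite K" "\<And>j. j \<in> J \<Longrightarrow> b j \<in> PM.span (e ` K)"
    and ind: "\<And>c j. (\<Sum>j\<in>J. scl (c j) (b j)) = 0 \<Longrightarrow> j \<in> J \<Longrightarrow> c j = 0"
  shows "card J \<le> card K"
proof -
  have inj: "inj_on b J"
  proof (rule inj_onI, rule ccontr)
    fix i j assume ij: "i \<in> J" "j \<in> J" "b i = b j" "i \<noteq> j"
    have "(\<Sum>l\<in>J. scl ((if l = i then 1 else 0) - (if l = j then 1 else 0)) (b l)) =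
      (\<Sum>l\<in>J. if l = i then b l else 0) - (\<Sum>l\<in>J. if l = j then b l else 0)"
      unfolding sum_subtractf[symmetric] by (intro sum.cong refl) auto
    also have "\<dots> = 0" using ij assms(1) by simp
    finally have "(if i = i then 1 else 0) - (if i = j then 1 else 0) = (0::rat)" by (rule ind[OF _ ij(1)])
    with ij(4) show False by simp
  qed
  have "PM.independent (b ` J)"
  proof (rule PM.independent_if_scalars_zero)
    fix u x assume "(\<Sum>x\<in>b ` J. scl (u x) x) = 0" "x \<in> b ` J"
    then show "u x = 0" using ind[of "\<lambda>j. u (b j)"] by (auto simp: sum.reindex[OF inj])
  qed (simp add: assms(1))
  moreover have "b ` J \<subseteq> PM.span (e ` K)" using assms(3) by blast
  ultimately have "card (b ` J) \<le> card (e ` K)"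
    using PM.independent_span_bound[OF finite_imageI[OF assms(2)]] by blast
  also have "\<dots> \<le> card K" by (rule card_image_le[OF assms(2)])
  finally show ?thesis by (simp add: card_image[OF inj])
qed

lemma finite_partitions: "finite (partitions n)"
proof (rule finite_subset)
  show "partitions n \<subseteq> {xs. set xs \<subseteq> {..n} \<and> length xs \<le> n}"
  proof
    fix \<mu> assume \<mu>: "\<mu> \<in> partitions n"
    have "length xs \<le> sum_list xs" if "0 \<notin> set xs" for xs :: "nat list"
      using that by (induction xs) auto
    with partitionsD(1,2)[OF \<mu>] member_le_sum_list show "\<mu> \<in> {xs. set xs \<subseteq> {..n} \<and> length xs \<le> n}" by fastforce
  qed
qed (rule finite_lists_length_le, simp)

lemma specht_index_Sigma: "specht_index n c = (SIGMA \<mu>:partitions n. {..<c \<mu>})"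
  by auto

lemma finite_specht_index: "finite (specht_index n c)"
  unfolding specht_index_Sigma by (intro finite_SigmaI finite_partitions) simp

text \<open>The rows of the matrix \<open>mat\<close>, each written as a monomial. In this form the
  orbits can be compared with products of complete homogeneous symmetric functions.\<close>

definition block_content :: "(nat \<Rightarrow> nat) \<Rightarrow> nat set list \<Rightarrow> (nat \<Rightarrow>\<^sub>0 nat) list" where
  "block_content w B = map (\<lambda>b. \<Sum>y\<in>b. sng (w y) 1) B"

lemma lookup_block_content_tab:
  assumes "i < l" shows "lk (block_content w (tab l n \<rho>) ! i) a = mat n w \<rho> i a"
proof -
  have "lk (block_content w (tab l n \<rho>) ! i) a = (\<Sum>y\<in>{y\<in>{1..n}. \<rho> y = i}. if w y = a then Suc 0 else 0)"
    using assms by (simp add: block_content_def lookup_sum lookup_single when_def)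
  also have "\<dots> = card {y\<in>{y\<in>{1..n}. \<rho> y = i}. w y = a}"
    by (subst sum.inter_filter[symmetric]) simp_all
  also have "{y\<in>{y\<in>{1..n}. \<rho> y = i}. w y = a} = {y\<in>{1..n}. \<rho> y = i \<and> w y = a}" by auto
  finally show ?thesis unfolding mat_def .
qed

lemma mat_eq_of_block_content:
  assumes "block_content w (tab k n \<rho>) = block_content w (tab k n \<theta>)"
    "\<rho> ` {1..n} = {..<k}" "\<theta> ` {1..n} = {..<k}"
  shows "mat n w \<rho> = mat n w \<theta>"
proof (intro ext)
  fix i a
  show "mat n w \<rho> i a = mat n w \<theta> i a"
  proof (cases "i < k")
    case True
    then show ?thesis using assms(1) lookup_block_content_tab by metis
  next
    case False
    then have "{y\<in>{1..n}. \<rho> y = i \<and> w y = a} = {}" "{y\<in>{1..n}. \<theta> y = i \<and> w y = a} = {}"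
      using assms(2,3) by blast+
    then show ?thesis unfolding mat_def by (simp only:)
  qed
qed

lemma lookup_sum_list: "lk (sum_list xs) a = (\<Sum>i<length xs. lk (xs ! i) (a :: 'a))" for xs :: "('a \<Rightarrow>\<^sub>0 nat) list"
  unfolding sum_list_sum_nth atLeast0LessThan lookup_sum ..

lemma block_content_image:
  assumes w: "\<And>a. card {y\<in>{1..n}. w y = a} = lk m a"
  shows "block_content w ` ordered_set_partitions n k = {xs. length xs = k \<and> 0 \<notin> set xs \<and> sum_list xs = m}"
proof (intro Set.set_eqI iffI)
  fix xs assume "xs \<in> block_content w ` ordered_set_partitions n k"
  then obtain \<rho> where \<rho>: "xs = block_content w (tab k n \<rho>)" "\<rho> ` {1..n} = {..<k}" using osp_tab by blast
  have len: "length xs = k" by (simp add: \<rho>(1) block_content_def)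
  have nth: "lk (xs ! i) a = mat n w \<rho> i a" if "i < k" for i a
    unfolding \<rho>(1) by (rule lookup_block_content_tab[OF that])
  have "xs ! i \<noteq> 0" if i: "i < k" for i
  proof
    assume z: "xs ! i = 0"
    have "i \<in> \<rho> ` {1..n}" using \<rho>(2) i by simp
    then obtain y where y: "y \<in> {1..n}" "\<rho> y = i" by blast
    have "mat n w \<rho> i (w y) = 0" using nth[OF i, of "w y"] z by simp
    then have "{z\<in>{1..n}. \<rho> z = i \<and> w z = w y} = {}" unfolding mat_def by (subst (asm) card_eq_0_iff) auto
    with y show False by blast
  qed
  then have "0 \<notin> set xs" using len by (auto simp: in_set_conv_nth)
  moreover have "sum_list xs = m"
  proof (rule poly_mapping_eqI)
    fix a
    have "lk (sum_list xs) a = (\<Sum>i<k. card {y\<in>{y\<in>{1..n}. w y = a}. \<rho> y = i})"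
      unfolding lookup_sum_list len by (intro sum.cong refl) (auto simp: nth mat_def intro!: arg_cong[of _ _ card])
    also have "\<dots> = card {y\<in>{1..n}. w y = a}"
      by (rule card_fibre_sum[symmetric]) (use \<rho>(2) in auto)
    finally show "lk (sum_list xs) a = lk m a" unfolding w .
  qed
  ultimately show "xs \<in> {xs. length xs = k \<and> 0 \<notin> set xs \<and> sum_list xs = m}" using len by simp
next
  fix xs assume "xs \<in> {xs. length xs = k \<and> 0 \<notin> set xs \<and> sum_list xs = m}"
  then have xs: "length xs = k" "0 \<notin> set xs" "sum_list xs = m" by auto
  \<comment> \<open>One element for each letter to be placed: its row \<open>i\<close>, its value
    \<open>a\<close> and a copy number. Matching \<open>{1..n}\<close> with this set so that values
    agree with \<open>w\<close> produces a row function with the prescribed matrix.\<close>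
  define D where "D = (SIGMA i:{..<k}. SIGMA a:ks (xs ! i). {..<lk (xs ! i) a})"
  have D: "finite D" unfolding D_def by auto
  have cardD: "card {d\<in>D. fst d = i \<and> fst (snd d) = a} = lk (xs ! i) a" if "i < k" for i a
  proof -
    have "{d\<in>D. fst d = i \<and> fst (snd d) = a} = (\<lambda>s. (i, a, s)) ` {..<lk (xs ! i) a}"
      using that by (auto simp: D_def in_keys_iff image_iff)
    then show ?thesis by (simp add: card_image inj_on_def)
  qed
  have "card {y\<in>{1..n}. w y = a} = card {d\<in>D. fst (snd d) = a}" for a
  proof -
    have "card {d\<in>D. fst (snd d) = a} = (\<Sum>i<k. card {d\<in>{d\<in>D. fst (snd d) = a}. fst d = i})"
      by (rule card_fibre_sum) (use D in \<open>auto simp: D_def\<close>)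
    also have "\<dots> = (\<Sum>i<k. lk (xs ! i) a)"
    proof (intro sum.cong refl)
      fix i assume "i \<in> {..<k}"
      moreover have "{d\<in>{d\<in>D. fst (snd d) = a}. fst d = i} = {d\<in>D. fst d = i \<and> fst (snd d) = a}" by auto
      ultimately show "card {d\<in>{d\<in>D. fst (snd d) = a}. fst d = i} = lk (xs ! i) a" by (simp only: cardD lessThan_iff)
    qed
    also have "\<dots> = lk m a" using xs(3) lookup_sum_list[of xs a] xs(1) by simp
    finally show ?thesis by (simp only: w)
  qed
  from bij_betw_fibres[OF finite_atLeastAtMost D this] obtain h where
    h: "bij_betw h {1..n} D" "\<And>y. y \<in> {1..n} \<Longrightarrow> fst (snd (h y)) = w y" by metis
  define \<rho> where "\<rho> = (\<lambda>y. fst (h y))"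
  have mat: "mat n w \<rho> i a = lk (xs ! i) a" if "i < k" for i a
  proof -
    have im: "h ` {y\<in>{1..n}. \<rho> y = i \<and> w y = a} = {d\<in>D. fst d = i \<and> fst (snd d) = a}"
    proof (intro Set.set_eqI iffI)
      fix d assume d: "d \<in> {d\<in>D. fst d = i \<and> fst (snd d) = a}"
      then obtain y where "y \<in> {1..n}" "d = h y" using bij_betw_imp_surj_on[OF h(1)] by blast
      with d h(2) show "d \<in> h ` {y\<in>{1..n}. \<rho> y = i \<and> w y = a}" by (auto simp: \<rho>_def)
    qed (use bij_betw_apply[OF h(1)] h(2) in \<open>auto simp: \<rho>_def\<close>)
    have "inj_on h {y\<in>{1..n}. \<rho> y = i \<and> w y = a}"
      using bij_betw_imp_inj_on[OF h(1)] by (rule inj_on_subset) auto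
    then have "card (h ` {y\<in>{1..n}. \<rho> y = i \<and> w y = a}) = mat n w \<rho> i a" unfolding mat_def by (rule card_image)
    then show ?thesis unfolding im cardD[OF that] by simp
  qed
  have "\<rho> ` {1..n} = {..<k}"
  proof (intro Set.set_eqI iffI)
    fix i assume "i \<in> \<rho> ` {1..n}"
    then obtain y where "y \<in> {1..n}" "i = fst (h y)" unfolding \<rho>_def by blast
    moreover from this have "h y \<in> D" by (intro bij_betw_apply[OF h(1)])
    ultimately show "i \<in> {..<k}" by (cases "h y") (simp add: D_def)
  next
    fix i assume i: "i \<in> {..<k}"
    then have "xs ! i \<noteq> 0" using xs(1,2) by (metis lessThan_iff nth_mem)
    then obtain a where "lk (xs ! i) a \<noteq> 0" by (metis lookup_zero poly_mapping_eqI)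
    then have "mat n w \<rho> i a \<noteq> 0" using mat i by simp
    then have "{y\<in>{1..n}. \<rho> y = i \<and> w y = a} \<noteq> {}" unfolding mat_def by (metis card.empty)
    then show "i \<in> \<rho> ` {1..n}" by blast
  qed
  then have "tab k n \<rho> \<in> ordered_set_partitions n k" by (simp add: tab_in_osp_iff)
  moreover have "block_content w (tab k n \<rho>) = xs"
  proof (rule nth_equalityI)
    show "length (block_content w (tab k n \<rho>)) = length xs" by (simp add: block_content_def xs(1))
    fix i assume "i < length (block_content w (tab k n \<rho>))"
    then have "i < k" by (simp add: block_content_def)
    then show "block_content w (tab k n \<rho>) ! i = xs ! i"
      by (intro poly_mapping_eqI) (simp add: lookup_block_content_tab mat)
  qed
  ultimately show "xs \<in> block_content w ` ordered_set_partitions n k" by blast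
qed

text \<open>Both sides count the dimension of the invariants of a Young subgroup: on the left by the semistandard bases of the
  Specht modules, on the right by the orbits on ordered set partitions.\<close>

theorem specht_multiplicities_count:
  assumes iso: "rep_iso (sym_group n) (OP_rep n k) (specht_sum n c)"
    and w: "\<And>a. card {y\<in>{1..n}. w y = a} = lk m a"
  shows "(\<Sum>\<mu>\<in>partitions n. c \<mu> * card (ssyt_with_content \<mu> m)) =
    card {xs. length xs = k \<and> 0 \<notin> set xs \<and> sum_list xs = m}"
proof -
  let ?OP = "ordered_set_partitions n k" and ?I = "specht_index n c"
  let ?X = "\<Pi>\<^sub>E p\<in>?I. hw n (fst p)"
  define U where "U = {v :: nat set list \<Rightarrow>\<^sub>0 rat. ks v \<subseteq> ?OP}"
  have U: "stable n U" unfolding U_def by (rule stable_osp_space)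
  from iso[unfolded rep_iso_def OP_rep_ops specht_sum_ops, folded U_def] obtain F where
    F': "bij_betw F U ?X" "\<forall>x\<in>U. \<forall>y\<in>U. F (x + y) = (\<lambda>p\<in>?I. F x p + F y p)"
    "\<forall>r. \<forall>x\<in>U. F (scl r x) = (\<lambda>p\<in>?I. scl r (F x p))"
    "\<forall>\<pi>\<in>carrier (sym_group n). \<forall>x\<in>U. F (sact \<pi> x) = (\<lambda>p\<in>?I. sact \<pi> (F x p))"
    by (elim exE conjE) (rule that)
  have F: "bij_betw F U ?X"
    "\<And>x y. x \<in> U \<Longrightarrow> y \<in> U \<Longrightarrow> F (x + y) = (\<lambda>p\<in>?I. F x p + F y p)"
    "\<And>r x. x \<in> U \<Longrightarrow> F (scl r x) = (\<lambda>p\<in>?I. scl r (F x p))"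
    "\<And>\<pi> x. \<pi> permutes {1..n} \<Longrightarrow> x \<in> U \<Longrightarrow> F (sact \<pi> x) = (\<lambda>p\<in>?I. sact \<pi> (F x p))"
    using F' unfolding sym_group_carrier[symmetric] by blast+
  have F0: "F 0 = (\<lambda>p\<in>?I. 0)" using F(3)[OF stableD(2)[OF U], of 0] by simp
  have Fsum: "F (\<Sum>j\<in>J. scl (r j) (g j)) = (\<lambda>p\<in>?I. \<Sum>j\<in>J. scl (r j) (F (g j) p))"
    if "finite J" "\<And>j. j \<in> J \<Longrightarrow> g j \<in> U" for J :: "'z set" and r g
    using that
  proof (induction J rule: finite_induct)
    case empty
    then show ?case by (simp add: F0)
  next
    case (insert j J)
    have s: "(\<Sum>j\<in>J. scl (r j) (g j)) \<in> U" using insert.prems by (intro stable_sum[OF U] stableD(5)[OF U]) auto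
    have g: "g j \<in> U" using insert.prems by simp
    have "F (\<Sum>j\<in>insert j J. scl (r j) (g j)) = (\<lambda>p\<in>?I. F (scl (r j) (g j)) p + F (\<Sum>j\<in>J. scl (r j) (g j)) p)"
      using insert.hyps F(2)[OF stableD(5)[OF U g] s] by simp
    then show ?case using insert F(3)[OF g] by (auto simp: fun_eq_iff restrict_def)
  qed
  note Finj = inj_onD[OF bij_betw_imp_inj_on[OF F(1)]]
  define Z where "Z = {z\<in>U. \<forall>\<sigma>\<in>stab n w. sact \<sigma> z = z}"
  define good where "good = (\<lambda>\<mu> t. (\<forall>v\<in>hw n \<mu>. (\<forall>\<sigma>\<in>stab n w. sact \<sigma> v = v) \<longrightarrow>
      (\<exists>r. v = (\<Sum>T\<in>ssyt_with_content \<mu> m. scl (r T) (stab_sum n w (polytabloid n \<mu> (t T)))))) \<and>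
    (\<forall>r. (\<Sum>T\<in>ssyt_with_content \<mu> m. scl (r T) (stab_sum n w (polytabloid n \<mu> (t T)))) = 0 \<longrightarrow>
      (\<forall>T\<in>ssyt_with_content \<mu> m. r T = 0)) \<and>
    (\<forall>T\<in>ssyt_with_content \<mu> m. stab_sum n w (polytabloid n \<mu> (t T)) \<in> hw n \<mu>))"
  have "\<exists>t. good \<mu> t" if \<mu>: "\<mu> \<in> partitions n" for \<mu>
  proof -
    from hw_invariants_basis[OF \<mu> w] obtain t where
      t: "\<forall>T\<in>ssyt_with_content \<mu> m. bij_betw (t T) (cells \<mu>) {1..n}"
      "\<forall>v\<in>hw n \<mu>. (\<forall>\<sigma>\<in>stab n w. sact \<sigma> v = v) \<longrightarrow>
        (\<exists>r. v = (\<Sum>T\<in>ssyt_with_content \<mu> m. scl (r T) (stab_sum n w (polytabloid n \<mu> (t T)))))"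
      "\<forall>r. (\<Sum>T\<in>ssyt_with_content \<mu> m. scl (r T) (stab_sum n w (polytabloid n \<mu> (t T)))) = 0 \<longrightarrow>
        (\<forall>T\<in>ssyt_with_content \<mu> m. r T = 0)" by (elim exE conjE) (rule that)
    have "\<forall>T\<in>ssyt_with_content \<mu> m. stab_sum n w (polytabloid n \<mu> (t T)) \<in> hw n \<mu>"
      using t(1) by (intro ballI stab_sum_hw tableau.polytabloid_hw tableau.intro \<mu>) blast
    with t(2,3) show ?thesis unfolding good_def by (intro exI[of _ t] conjI)
  qed
  then have "\<exists>t. \<forall>\<mu>\<in>partitions n. good \<mu> (t \<mu>)" by (intro bchoice ballI)
  then obtain t where good: "\<And>\<mu>. \<mu> \<in> partitions n \<Longrightarrow> good \<mu> (t \<mu>)" by blast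
  have t: "\<mu> \<in> partitions n \<Longrightarrow> v \<in> hw n \<mu> \<Longrightarrow> (\<forall>\<sigma>\<in>stab n w. sact \<sigma> v = v) \<Longrightarrow>
      \<exists>r. v = (\<Sum>T\<in>ssyt_with_content \<mu> m. scl (r T) (stab_sum n w (polytabloid n \<mu> (t \<mu> T))))"
    "\<mu> \<in> partitions n \<Longrightarrow> (\<Sum>T\<in>ssyt_with_content \<mu> m. scl (r T) (stab_sum n w (polytabloid n \<mu> (t \<mu> T)))) = 0 \<Longrightarrow>
      T \<in> ssyt_with_content \<mu> m \<Longrightarrow> r T = 0"
    "\<mu> \<in> partitions n \<Longrightarrow> T \<in> ssyt_with_content \<mu> m \<Longrightarrow> stab_sum n w (polytabloid n \<mu> (t \<mu> T)) \<in> hw n \<mu>" for \<mu> v r T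
    using good[of \<mu>] unfolding good_def by blast+
  define a where "a = (\<lambda>(p :: nat list \<times> nat) T. stab_sum n w (polytabloid n (fst p) (t (fst p) T)) :: nat set list \<Rightarrow>\<^sub>0 rat)"
  define J1 where "J1 = (SIGMA p:?I. ssyt_with_content (fst p) m)"
  \<comment> \<open>The preimage under \<open>F\<close> of the family that has one symmetrized
    polytabloid in component \<open>fst j\<close> and 0 elsewhere.\<close>
  define b where "b = (\<lambda>j. inv_into U F (\<lambda>q\<in>?I. if q = fst j then a (fst j) (snd j) else 0))"
  have a_hw: "a p T \<in> hw n (fst p)" if "(p, T) \<in> J1" for p T
    unfolding a_def using that t(3) by (auto simp: J1_def)
  have bX: "(\<lambda>q\<in>?I. if q = p then a p T else 0) \<in> ?X" if "(p, T) \<in> J1" for p T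
    using a_hw[OF that] stableD(2)[OF stable_hw] by auto
  have bU: "b j \<in> U" and Fb: "F (b j) = (\<lambda>q\<in>?I. if q = fst j then a (fst j) (snd j) else 0)" if "j \<in> J1" for j
  proof -
    have "(fst j, snd j) \<in> J1" using that by simp
    note X = bX[OF this]
    have bj: "b j = inv_into U F (\<lambda>q\<in>?I. if q = fst j then a (fst j) (snd j) else 0)"
      unfolding b_def ..
    show "b j \<in> U" unfolding bj by (rule bij_betw_apply[OF bij_betw_inv_into[OF F(1)] X])
    show "F (b j) = (\<lambda>q\<in>?I. if q = fst j then a (fst j) (snd j) else 0)"
      unfolding bj by (rule bij_betw_inv_into_right[OF F(1) X])
  qed
  have finJ1: "finite J1"
    unfolding J1_def by (intro finite_SigmaI finite_specht_index finite_ssyt_with_content)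
  have comb: "F (\<Sum>j\<in>J1. scl (r j) (b j)) q = (\<Sum>T\<in>ssyt_with_content (fst q) m. scl (r (q, T)) (a q T))"
    if q: "q \<in> ?I" for r q
  proof -
    have "F (\<Sum>j\<in>J1. scl (r j) (b j)) = (\<lambda>p\<in>?I. \<Sum>j\<in>J1. scl (r j) (F (b j) p))"
      by (rule Fsum[OF finJ1]) (rule bU)
    then have "F (\<Sum>j\<in>J1. scl (r j) (b j)) q = (\<Sum>j\<in>J1. scl (r j) (F (b j) q))"
      by (simp only: restrict_apply'[OF q])
    also have "\<dots> = (\<Sum>j\<in>J1. if fst j = q then scl (r j) (a q (snd j)) else 0)"
      by (intro sum.cong refl) (use q in \<open>simp add: Fb\<close>)
    also have "\<dots> = (\<Sum>p\<in>?I. \<Sum>T\<in>ssyt_with_content (fst p) m. if p = q then scl (r (p, T)) (a q T) else 0)"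
      unfolding J1_def
      by (subst sum.Sigma[OF finite_specht_index], intro ballI finite_ssyt_with_content, intro sum.cong refl) auto
    also have "\<dots> = (\<Sum>p\<in>?I. if p = q then \<Sum>T\<in>ssyt_with_content (fst p) m. scl (r (p, T)) (a q T) else 0)"
      by (intro sum.cong refl) auto
    also have "\<dots> = (\<Sum>T\<in>ssyt_with_content (fst q) m. scl (r (q, T)) (a q T))"
      using q finite_specht_index by (simp only: sum.delta if_True)
    finally show ?thesis .
  qed
  have b_ind: "r j = 0" if "(\<Sum>j\<in>J1. scl (r j) (b j)) = 0" "j \<in> J1" for r j
  proof -
    from that(2) obtain p T where j: "j = (p, T)" "p \<in> ?I" "T \<in> ssyt_with_content (fst p) m" by (auto simp: J1_def)
    have "(\<Sum>T\<in>ssyt_with_content (fst p) m. scl (r (p, T)) (a p T)) = 0"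
      using comb[OF j(2), of r] that(1) F0 j(2) by simp
    moreover have "fst p \<in> partitions n" using j(2) by auto
    ultimately show ?thesis using t(2)[of "fst p" "\<lambda>T. r (p, T)" T] j(1,3) unfolding a_def by blast
  qed
  have b_Z: "b j \<in> Z" if "j \<in> J1" for j
    unfolding Z_def
  proof (intro CollectI conjI bU ballI that)
    fix \<sigma> assume \<sigma>: "\<sigma> \<in> stab n w"
    then have p: "\<sigma> permutes {1..n}" by (simp add: stab_def)
    show "sact \<sigma> (b j) = b j"
    proof (rule Finj)
      show "F (sact \<sigma> (b j)) = F (b j)"
        unfolding F(4)[OF p bU[OF that]] Fb[OF that] a_def
        by (auto simp: fun_eq_iff restrict_def sact_stab_sum[OF \<sigma>])
    qed (intro stableD(6)[OF U p] bU that)+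
  qed
  have Z_b: "z \<in> PM.span (b ` J1)" if z: "z \<in> Z" for z
  proof -
    have zU: "z \<in> U" using z by (simp add: Z_def)
    have "\<exists>r. F z p = (\<Sum>T\<in>ssyt_with_content (fst p) m. scl (r T) (a p T))" if p: "p \<in> ?I" for p
    proof -
      have "fst p \<in> partitions n" using p by auto
      moreover have "F z p \<in> hw n (fst p)" using PiE_mem[OF bij_betw_apply[OF F(1) zU] p] .
      moreover have "sact \<sigma> (F z p) = F z p" if "\<sigma> \<in> stab n w" for \<sigma>
      proof -
        have "\<sigma> permutes {1..n}" "sact \<sigma> z = z" using z that by (auto simp: Z_def stab_def)
        then show ?thesis using fun_cong[OF F(4)[of \<sigma> z], of p] zU by (simp only: restrict_apply'[OF p])
      qed
      ultimately show ?thesis unfolding a_def by (intro t(1) ballI)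
    qed
    then have "\<exists>r. \<forall>p\<in>?I. F z p = (\<Sum>T\<in>ssyt_with_content (fst p) m. scl (r p T) (a p T))"
      by (intro bchoice ballI)
    then obtain r where r: "\<forall>p\<in>?I. F z p = (\<Sum>T\<in>ssyt_with_content (fst p) m. scl (r p T) (a p T))" by blast
    have sumU: "(\<Sum>j\<in>J1. scl (r (fst j) (snd j)) (b j)) \<in> U"
      by (intro stable_sum[OF U] stableD(5)[OF U] bU)
    have "z = (\<Sum>j\<in>J1. scl (r (fst j) (snd j)) (b j))"
    proof (rule Finj[OF _ zU sumU], rule PiE_ext[OF bij_betw_apply[OF F(1) zU] bij_betw_apply[OF F(1) sumU]])
      fix p assume p: "p \<in> ?I"
      show "F z p = F (\<Sum>j\<in>J1. scl (r (fst j) (snd j)) (b j)) p"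
        unfolding comb[OF p] using bspec[OF r p] by (simp only: fst_conv snd_conv)
    qed
    then show ?thesis by (rule ssubst) (intro PM.span_sum PM.span_scale PM.span_base imageI)
  qed
  define J2 where "J2 = block_content w ` ?OP"
  \<comment> \<open>Sums over the orbits of the Young subgroup, which are indexed by the possible
    contents of blocks.\<close>
  define orb where "orb = (\<lambda>xs. \<Sum>B\<in>{B\<in>?OP. block_content w B = xs}. sng B (1::rat))"
  have lk_orb: "lk (orb xs) B = (if B \<in> ?OP \<and> block_content w B = xs then 1 else 0)" for xs B
  proof -
    have "lk (orb xs) B = (\<Sum>B'\<in>{B\<in>?OP. block_content w B = xs}. if B' = B then 1 else 0)"
      unfolding orb_def lookup_sum by (intro sum.cong refl) (simp add: lookup_single when_def)
    then show ?thesis using finite_osp by simp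
  qed
  have finJ2: "finite J2" unfolding J2_def using finite_osp by simp
  have orb_comb: "lk (\<Sum>xs\<in>J2. scl (r xs) (orb xs)) B = (if B \<in> ?OP then r (block_content w B) else 0)" for r B
  proof -
    have "lk (\<Sum>xs\<in>J2. scl (r xs) (orb xs)) B = (\<Sum>xs\<in>J2. if xs = block_content w B then (if B \<in> ?OP then r xs else 0) else 0)"
      unfolding lookup_sum by (intro sum.cong refl) (auto simp: lk_orb)
    then show ?thesis using finJ2 by (auto simp: J2_def)
  qed
  have orb_ind: "r xs = 0" if "(\<Sum>xs\<in>J2. scl (r xs) (orb xs)) = 0" "xs \<in> J2" for r xs
  proof -
    from that(2) obtain B where "B \<in> ?OP" "xs = block_content w B" by (auto simp: J2_def)
    with orb_comb[of r B] that(1) show ?thesis by simp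
  qed
  have content_stab: "block_content w (permute_blocks \<sigma> B) = block_content w B" if \<sigma>: "\<sigma> \<in> stab n w" and B: "B \<in> ?OP" for \<sigma> B
  proof -
    have p: "\<sigma> permutes {1..n}" using \<sigma> by (simp add: stab_def)
    have "(\<Sum>y\<in>\<sigma> ` b. sng (w y) (1::nat)) = (\<Sum>y\<in>b. sng (w y) 1)" if "b \<in> set B" for b
    proof -
      have "b \<subseteq> {1..n}" using B that by (auto simp: ordered_set_partitions_def partition_on_def)
      then show ?thesis unfolding sum.reindex[OF permutes_inj_on[OF p]] o_def
        using \<sigma> by (intro sum.cong refl) (auto simp: stab_def)
    qed
    then show ?thesis by (simp add: block_content_def permute_blocks_def)
  qed
  have orb_Z: "orb xs \<in> Z" for xs
    unfolding Z_def
  proof (intro CollectI conjI ballI)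
    show "orb xs \<in> U" by (auto simp: U_def in_keys_iff lk_orb split: if_splits)
    fix \<sigma> assume \<sigma>: "\<sigma> \<in> stab n w"
    then have p: "\<sigma> permutes {1..n}" by (simp add: stab_def)
    show "sact \<sigma> (orb xs) = orb xs"
    proof (rule poly_mapping_eqI)
      fix B
      define B' where "B' = permute_blocks (pinv \<sigma>) B"
      have B: "B = permute_blocks \<sigma> B'" unfolding B'_def by (simp add: permute_blocks_comp permutes_inv_o[OF p])
      have "B \<in> ?OP \<longleftrightarrow> B' \<in> ?OP"
        using permute_blocks_osp[OF p, of B'] permute_blocks_osp[OF permutes_inv[OF p], of B]
        unfolding B[symmetric] B'_def[symmetric] by blast
      moreover have "B' \<in> ?OP \<Longrightarrow> block_content w B = block_content w B'"
        unfolding B by (rule content_stab[OF \<sigma>])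
      ultimately have "lk (orb xs) B = lk (orb xs) B'" by (auto simp: lk_orb)
      moreover have "lk (sact \<sigma> (orb xs)) B = lk (orb xs) B'" unfolding B by (rule lookup_sact_permute[OF p])
      ultimately show "lk (sact \<sigma> (orb xs)) B = lk (orb xs) B" by simp
    qed
  qed
  have Z_orb: "z \<in> PM.span (orb ` J2)" if z: "z \<in> Z" for z
  proof -
    have const: "lk z B = lk z B'" if BB: "B \<in> ?OP" "B' \<in> ?OP" "block_content w B = block_content w B'" for B B'
    proof -
      obtain \<rho> where \<rho>: "B = tab k n \<rho>" "\<rho> ` {1..n} = {..<k}" using osp_tab[OF BB(1)] .
      obtain \<theta> where \<theta>: "B' = tab k n \<theta>" "\<theta> ` {1..n} = {..<k}" using osp_tab[OF BB(2)] .
      have "mat n w \<rho> = mat n w \<theta>" using mat_eq_of_block_content BB(3) \<rho> \<theta> by blast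
      from mat_eq_imp_stab[OF this] obtain \<sigma> where \<sigma>: "\<sigma> \<in> stab n w" "\<And>y. y \<in> {1..n} \<Longrightarrow> \<theta> (\<sigma> y) = \<rho> y" by metis
      have "lk z B' = lk (sact \<sigma> z) (tab k n \<theta>)" using z \<sigma>(1) \<theta>(1) by (simp add: Z_def)
      also have "\<dots> = lk z (tab k n (\<theta> \<circ> \<sigma>))" using \<sigma>(1) by (intro lookup_sact_tab) (simp add: stab_def)
      also have "tab k n (\<theta> \<circ> \<sigma>) = B" unfolding \<rho>(1) by (rule tab_cong) (use \<sigma>(2) in simp)
      finally show ?thesis by simp
    qed
    define r where "r = (\<lambda>xs. lk z (SOME B. B \<in> ?OP \<and> block_content w B = xs))"
    have "z = (\<Sum>xs\<in>J2. scl (r xs) (orb xs))"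
    proof (rule poly_mapping_eqI)
      fix B
      show "lk z B = lk (\<Sum>xs\<in>J2. scl (r xs) (orb xs)) B"
      proof (cases "B \<in> ?OP")
        case True
        let ?P = "\<lambda>B'. B' \<in> ?OP \<and> block_content w B' = block_content w B"
        have "?P (SOME B'. ?P B')" using someI[of ?P B] True by blast
        then have "lk z (SOME B'. ?P B') = lk z B" using const True by blast
        then show ?thesis unfolding orb_comb r_def using True by simp
      next
        case False
        then show ?thesis using z by (auto simp: orb_comb Z_def U_def in_keys_iff)
      qed
    qed
    then show ?thesis by (rule ssubst) (intro PM.span_sum PM.span_scale PM.span_base imageI)
  qed
  \<comment> \<open>Both families are independent and span the invariants \<open>Z\<close>, so each
    is bounded by the size of the other.\<close>
  have "card J1 = card J2"
  proof (rule antisym)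
    show "card J1 \<le> card J2"
      by (rule family_card_le[OF finJ1 finJ2, of b orb]) (use Z_orb b_Z b_ind in blast)+
    show "card J2 \<le> card J1"
      by (rule family_card_le[OF finJ2 finJ1, of orb b]) (use Z_b orb_Z orb_ind in blast)+
  qed
  moreover have "card J1 = (\<Sum>\<mu>\<in>partitions n. c \<mu> * card (ssyt_with_content \<mu> m))"
  proof -
    have "card J1 = (\<Sum>p\<in>?I. card (ssyt_with_content (fst p) m))"
      unfolding J1_def by (intro card_SigmaI finite_specht_index ballI finite_ssyt_with_content)
    also have "\<dots> = (\<Sum>\<mu>\<in>partitions n. \<Sum>j\<in>{..<c \<mu>}. card (ssyt_with_content \<mu> m))"
      unfolding specht_index_Sigma by (subst sum.Sigma) (auto simp: finite_partitions case_prod_beta)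
    finally show ?thesis by simp
  qed
  ultimately show ?thesis unfolding J2_def block_content_image[OF w] by simp
qed

section \<open>The Frobenius character\<close>

lemma mdeg_eq_0_iff: "mdeg m = 0 \<longleftrightarrow> m = 0"
proof
  assume "mdeg m = 0"
  then show "m = 0" using lookup_le_mdeg[of m] by (intro poly_mapping_eqI) (metis le_zero_eq lookup_zero)
qed simp

lemma mdeg_sum_list: "mdeg (sum_list xs) = sum_list (map mdeg xs)"
  by (induction xs) (simp_all add: mdeg_add)

lemma finite_add_pairs: "finite {(a, b). a + b = (m :: nat \<Rightarrow>\<^sub>0 nat)}"
proof (rule inj_on_finite[where f = fst])
  show "inj_on fst {(a, b). a + b = m}" by (auto simp: inj_on_def)
  show "fst ` {(a, b). a + b = m} \<subseteq> {a. ks a \<subseteq> ks m \<and> mdeg a < Suc (mdeg m)}"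
    by (auto simp: in_keys_iff lookup_add mdeg_add)
  show "finite {a. ks a \<subseteq> ks m \<and> mdeg a < Suc (mdeg m)}" by (rule finite_monomials) simp
qed

text \<open>Read as matrices these have row sums \<open>\<mu>\<close> and column sums given by
  \<open>m\<close>; their number is the coefficient of \<open>m\<close> in the product of complete
  homogeneous functions.\<close>

definition rows_with_degrees :: "nat list \<Rightarrow> (nat \<Rightarrow>\<^sub>0 nat) \<Rightarrow> (nat \<Rightarrow>\<^sub>0 nat) list set" where
  "rows_with_degrees \<mu> m = {xs. map mdeg xs = \<mu> \<and> sum_list xs = m}"

text \<open>Finiteness is carried through the same induction, since counting the pairs of a first
  factor and a remaining list requires finite fibres.\<close>

lemma h_fun_card: "finite (rows_with_degrees \<mu> m) \<and> h_fun \<mu> m = of_nat (card (rows_with_degrees \<mu> m))"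
proof (induction \<mu> arbitrary: m)
  case Nil
  have "rows_with_degrees [] m = (if m = 0 then {[]} else {})" by (auto simp: rows_with_degrees_def)
  then show ?case by (simp add: h_fun_def)
next
  case (Cons d \<mu>)
  let ?P = "{(a, b). a + b = m}"
  let ?Q = "{ab\<in>?P. mdeg (fst ab) = d}"
  let ?S = "SIGMA ab:?Q. rows_with_degrees \<mu> (snd ab)"
  have Q: "finite ?Q" using finite_add_pairs[of m] by simp
  have eq: "rows_with_degrees (d # \<mu>) m = (\<lambda>(ab, xs). fst ab # xs) ` ?S"
  proof (intro Set.set_eqI iffI)
    fix xs assume "xs \<in> rows_with_degrees (d # \<mu>) m"
    then obtain a ys where "xs = a # ys" "mdeg a = d" "map mdeg ys = \<mu>" "a + sum_list ys = m"
      by (cases xs) (auto simp: rows_with_degrees_def)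
    then show "xs \<in> (\<lambda>(ab, xs). fst ab # xs) ` ?S"
      by (intro image_eqI[of _ _ "((a, sum_list ys), ys)"]) (auto simp: rows_with_degrees_def)
  qed (auto simp: rows_with_degrees_def)
  have inj: "inj_on (\<lambda>(ab, xs). fst ab # xs) ?S" by (auto simp: inj_on_def)
  have fin: "finite ?S" using Q Cons.IH by (intro finite_SigmaI) auto
  have "h_fun (d # \<mu>) m = (\<Sum>ab\<in>?P. if mdeg (fst ab) = d then h_fun \<mu> (snd ab) else 0)"
    by (auto simp: h_fun_def sf_mult_def h_single_def mdeg_def intro!: sum.cong)
  also have "\<dots> = (\<Sum>ab\<in>?Q. h_fun \<mu> (snd ab))"
    by (rule sum.inter_filter[symmetric, OF finite_add_pairs])
  also have "\<dots> = of_nat (\<Sum>ab\<in>?Q. card (rows_with_degrees \<mu> (snd ab)))"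
    unfolding of_nat_sum by (intro sum.cong refl) (use Cons.IH in blast)
  also have "(\<Sum>ab\<in>?Q. card (rows_with_degrees \<mu> (snd ab))) = card ?S"
    by (rule card_SigmaI[symmetric, OF Q]) (use Cons.IH in blast)
  also have "card ?S = card (rows_with_degrees (d # \<mu>) m)" unfolding eq by (rule card_image[symmetric, OF inj])
  finally show ?case using fin eq by simp
qed

lemma card_rows_mset_le:
  assumes "mset \<nu> = mset \<mu>" shows "card (rows_with_degrees \<mu> m) \<le> card (rows_with_degrees \<nu> m)"
proof -
  obtain p where p: "p permutes {..<length \<mu>}" "permute_list p \<mu> = \<nu>"
    using mset_eq_permutation[OF assms] by blast
  show ?thesis
  proof (rule card_inj_on_le[where f = "permute_list p"])
    show "finite (rows_with_degrees \<nu> m)" using h_fun_card by blast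
    show "permute_list p ` rows_with_degrees \<mu> m \<subseteq> rows_with_degrees \<nu> m"
    proof
      fix ys assume "ys \<in> permute_list p ` rows_with_degrees \<mu> m"
      then obtain xs where xs: "ys = permute_list p xs" "map mdeg xs = \<mu>" "sum_list xs = m" by (auto simp: rows_with_degrees_def)
      then have "length xs = length \<mu>" by auto
      then have px: "p permutes {..<length xs}" using p(1) by simp
      have "map mdeg ys = \<nu>" unfolding xs(1) permute_list_map[OF px, symmetric] xs(2) by (rule p(2))
      moreover have "sum_list ys = m"
        unfolding xs(1) xs(3)[symmetric] sum_mset_sum_list[symmetric] mset_permute_list[OF px] ..
      ultimately show "ys \<in> rows_with_degrees \<nu> m" by (simp add: rows_with_degrees_def)
    qed
    show "inj_on (permute_list p) (rows_with_degrees \<mu> m)"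
    proof (rule inj_onI)
      fix xs ys assume *: "xs \<in> rows_with_degrees \<mu> m" "ys \<in> rows_with_degrees \<mu> m" "permute_list p xs = permute_list p ys"
      then have len: "length xs = length \<mu>" "length ys = length \<mu>"
        by (auto simp: rows_with_degrees_def dest: map_eq_imp_length_eq)
      show "xs = ys"
      proof (rule nth_equalityI)
        show "length xs = length ys" using len by simp
        fix i assume i: "i < length xs"
        define j where "j = inv_into UNIV p i"
        have j: "j < length \<mu>" "p j = i"
          using i len permutes_in_image[OF permutes_inv[OF p(1)], of i] permutes_inverses(1)[OF p(1), of i]
          by (auto simp: j_def)
        have "permute_list p xs ! j = permute_list p ys ! j" using *(3) by simp
        then show "xs ! i = ys ! i" using j len p(1) by (simp add: permute_list_nth)
      qed
    qed
  qed
qed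

lemma card_rows_mset: "mset \<nu> = mset \<mu> \<Longrightarrow> card (rows_with_degrees \<nu> m) = card (rows_with_degrees \<mu> m)"
  using card_rows_mset_le[of \<nu> \<mu> m] card_rows_mset_le[of \<mu> \<nu> m] by simp

text \<open>The quotient counts the rearrangements of \<open>\<mu>\<close>. All parts lie in
  \<open>{1..n}\<close>, and an index that is not a part contributes the factor 0! = 1.\<close>

lemma multinomial_coefficient:
  assumes "\<mu> \<in> partitions n"
  shows "(fact (length \<mu>) / (\<Prod>i=1..n. fact (count_list \<mu> i)) :: rat) = of_nat (card (permutations_of_multiset (mset \<mu>)))"
proof -
  have sub: "set \<mu> \<subseteq> {1..n}"
  proof
    fix x assume x: "x \<in> set \<mu>"
    with partitionsD(1)[OF assms] have "x \<noteq> 0" by metis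
    moreover have "x \<le> n" using member_le_sum_list[OF x] partitionsD(2)[OF assms] by simp
    ultimately show "x \<in> {1..n}" by simp
  qed
  have "(\<Prod>i=1..n. fact (count_list \<mu> i) :: nat) = (\<Prod>i\<in>set \<mu>. fact (count_list \<mu> i))"
    using sub by (intro prod.mono_neutral_right) (auto simp: count_list_0_iff)
  also have "\<dots> = (\<Prod>x\<in>set_mset (mset \<mu>). fact (count (mset \<mu>) x))" by (simp add: count_mset)
  finally have "card (permutations_of_multiset (mset \<mu>)) * (\<Prod>i=1..n. fact (count_list \<mu> i) :: nat) = fact (length \<mu>)"
    using card_permutations_of_multiset_aux[of "mset \<mu>"] by simp
  from arg_cong[OF this, of "of_nat :: nat \<Rightarrow> rat"]
  have "of_nat (card (permutations_of_multiset (mset \<mu>))) * (\<Prod>i=1..n. fact (count_list \<mu> i)) = (fact (length \<mu>) :: rat)"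
    by simp
  moreover have "(\<Prod>i=1..n. fact (count_list \<mu> i) :: rat) \<noteq> 0" by simp
  ultimately show ?thesis by (simp add: field_simps)
qed

text \<open>Lists without zero entries have positive degrees, which when sorted form a partition
  with \<open>k\<close> parts. Over a fixed \<open>\<mu>\<close> every rearrangement of the degrees
  occurs, and by commutativity each contributes the same number of lists.\<close>

lemma card_matrices_by_row_degrees:
  assumes m: "mdeg m = n" and fin: "finite {xs. length xs = k \<and> 0 \<notin> set xs \<and> sum_list xs = m}"
  shows "card {xs. length xs = k \<and> 0 \<notin> set xs \<and> sum_list xs = m} =
    (\<Sum>\<mu>\<in>{\<mu>. \<mu> \<in> partitions n \<and> length \<mu> = k}. card (permutations_of_multiset (mset \<mu>)) * card (rows_with_degrees \<mu> m))"
proof -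
  let ?S = "{xs. length xs = k \<and> 0 \<notin> set xs \<and> sum_list xs = m}" and ?A = "{\<mu>. \<mu> \<in> partitions n \<and> length \<mu> = k}"
  define g where "g = (\<lambda>xs :: (nat \<Rightarrow>\<^sub>0 nat) list. rev (sort (map mdeg xs)))"
  have g: "g xs \<in> ?A" if xs: "xs \<in> ?S" for xs
  proof -
    have "sorted_wrt (\<ge>) (g xs)" by (simp add: g_def sorted_wrt_rev)
    moreover have "0 \<notin> set (g xs)" using xs by (auto simp: g_def mdeg_eq_0_iff)
    moreover have "sum_list (g xs) = n"
    proof -
      have "sum_list (g xs) = sum_mset (mset (g xs))" by (simp only: sum_mset_sum_list)
      also have "mset (g xs) = mset (map mdeg xs)" by (simp add: g_def)
      also have "sum_mset (mset (map mdeg xs)) = mdeg (sum_list xs)" unfolding sum_mset_sum_list mdeg_sum_list ..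
      finally show ?thesis using xs m by simp
    qed
    ultimately show ?thesis using xs by (simp add: partitions_def g_def)
  qed
  have finA: "finite ?A" using finite_partitions[of n] by simp
  have fibre: "card {xs\<in>?S. g xs = \<mu>} = card (permutations_of_multiset (mset \<mu>)) * card (rows_with_degrees \<mu> m)"
    if \<mu>: "\<mu> \<in> ?A" for \<mu>
  proof -
    have part: "\<mu> \<in> partitions n" "length \<mu> = k" using \<mu> by auto
    have "card {xs\<in>?S. g xs = \<mu>} =
      (\<Sum>\<nu>\<in>permutations_of_multiset (mset \<mu>). card {xs\<in>{xs\<in>?S. g xs = \<mu>}. map mdeg xs = \<nu>})"
    proof (rule card_fibre_sum)
      show "finite {xs\<in>?S. g xs = \<mu>}" using fin by (rule finite_subset[rotated]) auto
      show "map mdeg xs \<in> permutations_of_multiset (mset \<mu>)" if "xs \<in> {xs\<in>?S. g xs = \<mu>}" for xs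
        using that by (auto simp: permutations_of_multiset_def g_def)
    qed simp
    also have "\<dots> = (\<Sum>\<nu>\<in>permutations_of_multiset (mset \<mu>). card (rows_with_degrees \<mu> m))"
    proof (intro sum.cong refl)
      fix \<nu> assume "\<nu> \<in> permutations_of_multiset (mset \<mu>)"
      then have \<nu>: "mset \<nu> = mset \<mu>" by (simp add: permutations_of_multiset_def)
      have "{xs\<in>{xs\<in>?S. g xs = \<mu>}. map mdeg xs = \<nu>} = rows_with_degrees \<nu> m"
      proof (intro Set.set_eqI iffI)
        fix xs assume "xs \<in> rows_with_degrees \<nu> m"
        then have xs: "map mdeg xs = \<nu>" "sum_list xs = m" by (auto simp: rows_with_degrees_def)
        have "length xs = length \<nu>" using xs(1) by auto
        then have "length xs = k" using part(2) mset_eq_length[OF \<nu>] by simp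
        moreover have "0 \<notin> set xs"
        proof
          assume "0 \<in> set xs"
          then have "mdeg 0 \<in> set \<nu>" unfolding xs(1)[symmetric] set_map by (rule imageI)
          then have "0 \<in> set \<nu>" by simp
          then show False using partitionsD(1)[OF part(1)] mset_eq_setD[OF \<nu>] by blast
        qed
        moreover have "g xs = \<mu>"
        proof -
          have "sorted (rev \<mu>)" using part(1) by (simp add: partitions_def sorted_wrt_rev)
          then have "sort \<nu> = rev \<mu>" using \<nu> by (intro properties_for_sort) simp_all
          then show ?thesis by (simp add: g_def xs(1))
        qed
        ultimately show "xs \<in> {xs\<in>{xs\<in>?S. g xs = \<mu>}. map mdeg xs = \<nu>}" using xs by simp
      qed (auto simp: rows_with_degrees_def)
      then show "card {xs\<in>{xs\<in>?S. g xs = \<mu>}. map mdeg xs = \<nu>} = card (rows_with_degrees \<mu> m)"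
        using card_rows_mset[OF \<nu>] by simp
    qed
    finally show ?thesis by simp
  qed
  have "card ?S = (\<Sum>\<mu>\<in>?A. card {xs\<in>?S. g xs = \<mu>})" by (rule card_fibre_sum[OF fin g finA])
  also have "\<dots> = (\<Sum>\<mu>\<in>?A. card (permutations_of_multiset (mset \<mu>)) * card (rows_with_degrees \<mu> m))"
    by (intro sum.cong refl fibre)
  finally show ?thesis .
qed

lemma ex_filling_with_content:
  assumes "mdeg m = n"
  obtains w :: "nat \<Rightarrow> nat" where "\<And>a. card {y\<in>{1..n}. w y = a} = lk m a"
proof -
  define D where "D = (SIGMA a:ks m. {..<lk m a})"
  have "card D = n" "finite D" using assms by (simp_all add: D_def mdeg_def)
  then obtain h where h: "bij_betw h {1..n} D"
    using finite_same_card_bij[of "{1..n}" D] by auto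
  have "card {y\<in>{1..n}. fst (h y) = a} = lk m a" for a
  proof -
    have "card {y\<in>{1..n}. fst (h y) = a} = card (h ` {y\<in>{1..n}. fst (h y) = a})"
      by (rule card_image[symmetric], rule inj_on_subset[OF bij_betw_imp_inj_on[OF h]]) auto
    also have "h ` {y\<in>{1..n}. fst (h y) = a} = {d\<in>h ` {1..n}. fst d = a}" by auto
    also have "\<dots> = Pair a ` {..<lk m a}"
      unfolding bij_betw_imp_surj_on[OF h] by (auto simp: D_def in_keys_iff)
    finally show ?thesis by (simp add: card_image inj_on_def)
  qed
  with that[of "\<lambda>y. fst (h y)"] show ?thesis by blast
qed

lemma mdeg_content: "mdeg (content \<mu> T) = sum_list \<mu>"
  by (simp add: content_def mdeg_sum card_cells)

theorem theorem4p11: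
  fixes n k :: nat
  assumes "1 \<le> k" and "k \<le> n"
  shows "rep_iso (sym_group n) (R_rep n k) (OP_rep n k) \<and>
    Frob n (R_rep n k) =
      (\<lambda>m. \<Sum>\<mu> | \<mu> \<in> partitions n \<and> length \<mu> = k.
         fact k / (\<Prod>i=1..n. fact (count_list \<mu> i)) * h_fun \<mu> m)"
proof
  show iso: "rep_iso (sym_group n) (R_rep n k) (OP_rep n k)" by (rule rep_iso_R_rep_OP_rep[OF assms(2)])
  \<comment> \<open>All that is used about the chosen multiplicities is that they decompose the
    module; the count of invariants then fixes each coefficient of the character.\<close>
  define c where "c = specht_mults n (R_rep n k)"
  have "\<exists>c. rep_iso (sym_group n) (R_rep n k) (specht_sum n c)"
    using OP_rep_decomposes[of n k] rep_iso_trans[OF iso] by blast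
  then have "rep_iso (sym_group n) (R_rep n k) (specht_sum n c)"
    unfolding c_def specht_mults_def by (rule someI_ex)
  then have c: "rep_iso (sym_group n) (OP_rep n k) (specht_sum n c)"
    by (rule rep_iso_trans[OF rep_iso_sym[OF rep_closed_R_rep iso]])
  show "Frob n (R_rep n k) =
      (\<lambda>m. \<Sum>\<mu> | \<mu> \<in> partitions n \<and> length \<mu> = k.
         fact k / (\<Prod>i=1..n. fact (count_list \<mu> i)) * h_fun \<mu> m)"
  proof
    fix m
    have rhs: "(\<Sum>\<mu> | \<mu> \<in> partitions n \<and> length \<mu> = k. fact k / (\<Prod>i=1..n. fact (count_list \<mu> i)) * h_fun \<mu> m) =
      of_nat (\<Sum>\<mu>\<in>{\<mu>. \<mu> \<in> partitions n \<and> length \<mu> = k}. card (permutations_of_multiset (mset \<mu>)) * card (rows_with_degrees \<mu> m))"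
      unfolding of_nat_sum of_nat_mult
    proof (intro sum.cong refl)
      fix \<mu> assume "\<mu> \<in> {\<mu>. \<mu> \<in> partitions n \<and> length \<mu> = k}"
      then show "fact k / (\<Prod>i=1..n. fact (count_list \<mu> i)) * h_fun \<mu> m =
          of_nat (card (permutations_of_multiset (mset \<mu>))) * of_nat (card (rows_with_degrees \<mu> m))"
        using multinomial_coefficient[of \<mu> n] h_fun_card[of \<mu> m] by auto
    qed
    have lhs: "Frob n (R_rep n k) m = of_nat (\<Sum>\<mu>\<in>partitions n. c \<mu> * card (ssyt_with_content \<mu> m))"
      by (simp add: Frob_def schur_def c_def)
    show "Frob n (R_rep n k) m =
      (\<Sum>\<mu> | \<mu> \<in> partitions n \<and> length \<mu> = k. fact k / (\<Prod>i=1..n. fact (count_list \<mu> i)) * h_fun \<mu> m)"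
    proof (cases "mdeg m = n")
      case True
      from ex_filling_with_content[OF this] obtain w where w: "\<And>a. card {y\<in>{1..n}. w y = a} = lk m a" by metis
      have "finite {xs. length xs = k \<and> 0 \<notin> set xs \<and> sum_list xs = m}"
        unfolding block_content_image[OF w, symmetric] using finite_osp by simp
      with specht_multiplicities_count[OF c w] card_matrices_by_row_degrees[OF True]
      show ?thesis unfolding lhs rhs by simp
    next
      case False
      \<comment> \<open>In degrees other than \<open>n\<close> there are neither tableaux of shape
        \<open>\<mu>\<close> nor lists of monomials with degrees \<open>\<mu>\<close>, so both sides
        vanish.\<close>
      have ss: "ssyt_with_content \<mu> m = {}" if "\<mu> \<in> partitions n" for \<mu>
        using False mdeg_content partitionsD(2)[OF that] by auto
      have rows: "rows_with_degrees \<mu> m = {}" if "\<mu> \<in> partitions n" for \<mu>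
        using False partitionsD(2)[OF that] by (auto simp: rows_with_degrees_def mdeg_sum_list)
      have "(\<Sum>\<mu>\<in>partitions n. c \<mu> * card (ssyt_with_content \<mu> m)) = 0"
        by (intro sum.neutral ballI) (simp only: ss card.empty mult_0_right)
      moreover have "(\<Sum>\<mu>\<in>{\<mu>. \<mu> \<in> partitions n \<and> length \<mu> = k}.
          card (permutations_of_multiset (mset \<mu>)) * card (rows_with_degrees \<mu> m)) = 0"
        by (intro sum.neutral) (simp add: rows)
      ultimately show ?thesis unfolding lhs rhs by (simp only:)
    qed
  qed
qed

end
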